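(* Assume that $u\in L^0_a(\mu,H)$ is such that $E[\rho(-\delta u)]=1$ and let $U=I_W+u$. Then there exists a unique absolutely continuous (with respect to $\mu$) Girsanov measure associated to $(U,\mu)$ if and only if $U$ is almost surely invertible.
   Context: $(W,H,\mu)$ is the classical Wiener space: $W=C([0,1],\mathbb{R}^d)$, $d\ge1$, $\mu$ is the standard Wiener measure, $(W_t)_{t\in[0,1]}$ is the canonical (coordinate) Wiener process, $H$ is the Cameron-Martin space with $(h,k)_H=\int_0^1\dot h_s\cdot\dot k_s\,ds$ and norm $|\cdot|_H$, and $(\mathcal F_t)_{t\in[0,1]}$ is the canonical filtration completed with $\mu$-null sets. $E$ is expectation under $\mu$. $L^0_a(\mu,H)$ is the set of ($dt\times d\mu$-equivalence classes of) $H$-valued random variables $u(t)=\int_0^t\dot u_s\,ds$ whose Lebesgue density $\dot u$ is adapted to $(\mathcal F_t)$. For $u\in L^0_a(\mu,H)$, $\delta u=\int_0^1\dot u_s\cdot dW_s$ (It\^o integral, also when $\dot u$ is not square integrable w.r.t. $dt\times d\mu$), and $\rho(-\delta u)=\exp\left(-\int_0^1\dot u_s\cdot dW_s-\frac12\int_0^1|\dot u_s|^2ds\right)$. $I_W$ is the identity of $W$; $U\mu$ is the image of $\mu$ under $U$. A (positive) measure $\nu$ is a Girsanov measure associated to $(U,\mu)$ if $U\nu=\mu$, i.e. $\int_W f\circ U\,d\nu=\int_W f\,d\mu$ for every measurable positive function $f$ on $W$. For measurable $A,B:W\to W$, $A$ is an (almost sure) right inverse of $B$ if $A\mu$ is absolutely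 continuous w.r.t. $\mu$ and $B\circ A(w)=w$ $\mu$-a.s. $B$ is almost surely invertible if it has a right inverse $A$ and if there is a measurable map $C$ such that $B$ is a right inverse of $C$ (including $B\mu\ll\mu$); then $A=C$ a.s. is the almost sure inverse of $B$. *)

theory Defs
  imports "HOL-Probability.Probability"
begin

section \<open>Classical Wiener space\<close>

text \<open>
  \<open>W = C([0,1], R^d)\<close> with \<open>d = CARD('n)\<close>. A path is a function on all of \<open>real\<close> that is
  \<open>extensional\<close> on \<open>{0..1}\<close>, so that equality of paths is equality on \<open>[0,1]\<close>.
\<close>

definition paths :: "(real \<Rightarrow> real ^ 'n) set" where
  "paths = {w \<in> extensional {0..1}. continuous_on {0..1} w}"

text \<open>
  The \<open>\<sigma>\<close>-algebra generated by the coordinates, which is the Borel \<open>\<sigma>\<close>-algebra of the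
  sup-norm topology. This is only used as a measurable space.
\<close>

definition path_space :: "(real \<Rightarrow> real ^ 'n) measure" where
  "path_space = restrict_space (PiM {0..1} (\<lambda>_. borel)) paths"

text \<open>\<open>classical_wiener \<mu>\<close> says that \<open>\<mu>\<close> is the standard Wiener measure on \<open>W\<close>.\<close>

locale classical_wiener = prob_space \<mu> for \<mu> :: "(real \<Rightarrow> real ^ 'n) measure" +
  assumes sets_wiener: "sets \<mu> = sets path_space"
    and AE_start: "AE w in \<mu>. w 0 = 0"
    and distributed_increment: "\<And>s t. 0 \<le> s \<Longrightarrow> s < t \<Longrightarrow> t \<le> 1 \<Longrightarrow>
      distributed \<mu> lborel (\<lambda>w. w t - w s)
        (\<lambda>x. ennreal (\<Prod>i\<in>UNIV. normal_density 0 (sqrt (t - s)) (x $ i)))"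
    and indep_increments: "\<And>k \<tau>. strict_mono_on {..k} \<tau> \<Longrightarrow> \<tau> ` {..k} \<subseteq> {0..1} \<Longrightarrow>
      indep_vars (\<lambda>_. borel) (\<lambda>i w. w (\<tau> (Suc i)) - w (\<tau> i)) {..<k::nat}"

definition wiener_filtration ::
  "(real \<Rightarrow> real ^ 'n) measure \<Rightarrow> real \<Rightarrow> (real \<Rightarrow> real ^ 'n) measure" where
  "wiener_filtration \<mu> t = sigma (space \<mu>)
     ({(\<lambda>w. w s) -` B \<inter> space \<mu> |s B. s \<in> {0..t} \<and> B \<in> sets borel} \<union>
      null_sets (completion \<mu>))"


section \<open>The Cameron-Martin space and adapted shifts\<close>

definition cm_density :: "(real \<Rightarrow> real ^ 'n) \<Rightarrow> (real \<Rightarrow> real ^ 'n) \<Rightarrow> bool" where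
  "cm_density h g \<longleftrightarrow>
     h \<in> extensional {0..1} \<and>
     set_borel_measurable lborel {0..1} g \<and>
     (\<integral>\<^sup>+s\<in>{0..1}. ennreal ((norm (g s))\<^sup>2) \<partial>lborel) < \<infinity> \<and>
     (\<forall>t\<in>{0..1}. h t = (LINT s:{0..t}|lborel. g s))"

definition cameron_martin :: "(real \<Rightarrow> real ^ 'n) set" where
  "cameron_martin = {h. \<exists>g. cm_density h g}"

text \<open>
  \<open>L0a \<mu> u v\<close>: \<open>u\<close> is an \<open>H\<close>-valued random variable and the process \<open>v\<close>, with time as first
  argument, is an adapted version of its Lebesgue density. Random variables are measurable with
  respect to the completion of \<open>\<mu>\<close>, as the filtration contains the null sets. Such a pair represents
  an element of \<open>L^0_a(\<mu>,H)\<close>; every element has such representatives, and \<open>v\<close> is determined by \<open>u\<close>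
  up to equality \<open>dt \<times> d\<mu>\<close>-almost everywhere.
\<close>

definition L0a ::
  "(real \<Rightarrow> real ^ 'n) measure \<Rightarrow> ((real \<Rightarrow> real ^ 'n) \<Rightarrow> (real \<Rightarrow> real ^ 'n)) \<Rightarrow>
   (real \<Rightarrow> (real \<Rightarrow> real ^ 'n) \<Rightarrow> real ^ 'n) \<Rightarrow> bool" where
  "L0a \<mu> u v \<longleftrightarrow>
     u \<in> measurable (completion \<mu>) \<mu> \<and>
     (\<forall>w\<in>space \<mu>. u w \<in> cameron_martin) \<and>
     (\<lambda>(t, w). v t w) \<in>
       borel_measurable (restrict_space borel {0..1} \<Otimes>\<^sub>M completion \<mu>) \<and>
     (\<forall>t\<in>{0..1}. v t \<in> borel_measurable (wiener_filtration \<mu> t)) \<and>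
     (AE w in \<mu>. cm_density (u w) (\<lambda>t. v t w))"

text \<open>The map \<open>I_W + u\<close>.\<close>

definition perturb ::
  "((real \<Rightarrow> real ^ 'n) \<Rightarrow> (real \<Rightarrow> real ^ 'n)) \<Rightarrow> (real \<Rightarrow> real ^ 'n) \<Rightarrow> (real \<Rightarrow> real ^ 'n)" where
  "perturb u w = (\<lambda>t\<in>{0..1}. w t + u w t)"


section \<open>The Ito integral\<close>

text \<open>
  A simple adapted process \<open>\<Sum>i<k. \<xi> i * indicator {\<tau> i<..\<tau> (i+1)}\<close>, given by the number \<open>k\<close> of
  steps, the times \<open>\<tau>\<close> and the values \<open>\<xi>\<close>.
\<close>

definition simple_process ::
  "(real \<Rightarrow> real ^ 'n) measure \<Rightarrow> nat \<Rightarrow> (nat \<Rightarrow> real) \<Rightarrow>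
   (nat \<Rightarrow> (real \<Rightarrow> real ^ 'n) \<Rightarrow> real ^ 'n) \<Rightarrow> bool" where
  "simple_process \<mu> k \<tau> \<xi> \<longleftrightarrow>
     mono_on {..k} \<tau> \<and> \<tau> ` {..k} \<subseteq> {0..1} \<and>
     (\<forall>i<k. \<xi> i \<in> borel_measurable (wiener_filtration \<mu> (\<tau> i)) \<and> bounded (\<xi> i ` space \<mu>))"

definition simple_eval ::
  "nat \<Rightarrow> (nat \<Rightarrow> real) \<Rightarrow> (nat \<Rightarrow> (real \<Rightarrow> real ^ 'n) \<Rightarrow> real ^ 'n) \<Rightarrow>
   real \<Rightarrow> (real \<Rightarrow> real ^ 'n) \<Rightarrow> real ^ 'n" where
  "simple_eval k \<tau> \<xi> t w = (\<Sum>i<k. indicator {\<tau> i<..\<tau> (Suc i)} t *\<^sub>R \<xi> i w)"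

definition simple_integral ::
  "nat \<Rightarrow> (nat \<Rightarrow> real) \<Rightarrow> (nat \<Rightarrow> (real \<Rightarrow> real ^ 'n) \<Rightarrow> real ^ 'n) \<Rightarrow>
   (real \<Rightarrow> real ^ 'n) \<Rightarrow> real" where
  "simple_integral k \<tau> \<xi> w = (\<Sum>i<k. \<xi> i w \<bullet> (w (\<tau> (Suc i)) - w (\<tau> i)))"

text \<open>
  For an adapted \<open>v\<close> with almost surely square integrable paths, \<open>\<integral>\<^sub>0\<^sup>1 v dW\<close> is the limit in
  probability of the integrals of simple processes \<open>V n\<close> such that \<open>\<integral>\<^sub>0\<^sup>1 \<bar>V n - v\<bar>\<^sup>2 dt\<close> tends
  to 0 in probability.
\<close>

definition has_ito_integral ::
  "(real \<Rightarrow> real ^ 'n) measure \<Rightarrow> (real \<Rightarrow> (real \<Rightarrow> real ^ 'n) \<Rightarrow> real ^ 'n) \<Rightarrow>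
   ((real \<Rightarrow> real ^ 'n) \<Rightarrow> real) \<Rightarrow> bool" where
  "has_ito_integral \<mu> v X \<longleftrightarrow>
     X \<in> borel_measurable (completion \<mu>) \<and>
     (\<exists>k \<tau> \<xi>. (\<forall>n. simple_process \<mu> (k n) (\<tau> n) (\<xi> n)) \<and>
       (\<forall>\<epsilon>>0. (\<lambda>n. measure (completion \<mu>) {w \<in> space \<mu>. ennreal \<epsilon> <
          (\<integral>\<^sup>+t\<in>{0..1}. ennreal ((norm (simple_eval (k n) (\<tau> n) (\<xi> n) t w - v t w))\<^sup>2) \<partial>lborel)})
          \<longlonglongrightarrow> 0) \<and>
       (\<forall>\<epsilon>>0. (\<lambda>n. measure (completion \<mu>) {w \<in> space \<mu>.
          \<epsilon> < \<bar>simple_integral (k n) (\<tau> n) (\<xi> n) w - X w\<bar>}) \<longlonglongrightarrow> 0))"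

text \<open>The limit is unique up to almost sure equality, hence \<open>SOME\<close> rather than \<open>THE\<close>.\<close>

definition ito_integral ::
  "(real \<Rightarrow> real ^ 'n) measure \<Rightarrow> (real \<Rightarrow> (real \<Rightarrow> real ^ 'n) \<Rightarrow> real ^ 'n) \<Rightarrow>
   (real \<Rightarrow> real ^ 'n) \<Rightarrow> real" where
  "ito_integral \<mu> v = (SOME X. has_ito_integral \<mu> v X)"

text \<open>\<open>\<rho>(-\<delta>u)\<close> in terms of the density \<open>v\<close> of \<open>u\<close>.\<close>

definition girsanov_density ::
  "(real \<Rightarrow> real ^ 'n) measure \<Rightarrow> (real \<Rightarrow> (real \<Rightarrow> real ^ 'n) \<Rightarrow> real ^ 'n) \<Rightarrow>
   (real \<Rightarrow> real ^ 'n) \<Rightarrow> real" where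
  "girsanov_density \<mu> v w =
     exp (- ito_integral \<mu> v w - 1 / 2 * (LINT t:{0..1}|lborel. (norm (v t w))\<^sup>2))"


section \<open>Girsanov measures and almost sure invertibility\<close>

text \<open>
  Since \<open>U\<close> is only measurable with respect to the completion of \<open>\<mu>\<close>, \<open>\<nu>\<close> is taken on the
  completed \<open>\<sigma>\<close>-algebra. A \<open>\<nu>\<close> that is absolutely continuous with respect to \<open>\<mu>\<close> extends
  uniquely from the Borel \<open>\<sigma>\<close>-algebra to it.
\<close>

definition girsanov_measure ::
  "(real \<Rightarrow> real ^ 'n) measure \<Rightarrow> ((real \<Rightarrow> real ^ 'n) \<Rightarrow> (real \<Rightarrow> real ^ 'n)) \<Rightarrow>
   (real \<Rightarrow> real ^ 'n) measure \<Rightarrow> bool" where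
  "girsanov_measure \<mu> U \<nu> \<longleftrightarrow>
     sets \<nu> = sets (completion \<mu>) \<and> U \<in> measurable \<nu> \<mu> \<and>
     (\<forall>f\<in>borel_measurable \<mu>. (\<integral>\<^sup>+w. f (U w) \<partial>\<nu>) = (\<integral>\<^sup>+w. f w \<partial>\<mu>))"

text \<open>\<open>right_inverse \<mu> B A\<close>: \<open>A\<close> is an almost sure right inverse of \<open>B\<close>.\<close>

definition right_inverse ::
  "(real \<Rightarrow> real ^ 'n) measure \<Rightarrow> ((real \<Rightarrow> real ^ 'n) \<Rightarrow> (real \<Rightarrow> real ^ 'n)) \<Rightarrow>
   ((real \<Rightarrow> real ^ 'n) \<Rightarrow> (real \<Rightarrow> real ^ 'n)) \<Rightarrow> bool" where
  "right_inverse \<mu> B A \<longleftrightarrow>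
     A \<in> measurable (completion \<mu>) \<mu> \<and> B \<in> measurable (completion \<mu>) \<mu> \<and>
     absolutely_continuous \<mu> (distr (completion \<mu>) \<mu> A) \<and>
     (AE w in \<mu>. B (A w) = w)"

definition as_invertible ::
  "(real \<Rightarrow> real ^ 'n) measure \<Rightarrow> ((real \<Rightarrow> real ^ 'n) \<Rightarrow> (real \<Rightarrow> real ^ 'n)) \<Rightarrow> bool" where
  "as_invertible \<mu> B \<longleftrightarrow>
     (\<exists>A. right_inverse \<mu> B A) \<and> (\<exists>C. right_inverse \<mu> C B)"

end

theory Submission
  imports Defs
begin

text \<open>
  Write \<open>U = I\<^sub>W + u\<close> and \<open>\<rho> = \<rho>(-\<delta>u)\<close>. The theorem rests on Girsanov's theorem
  (\<open>girsanov_transform\<close>): since \<open>E[\<rho>] = 1\<close>, the measure \<open>\<nu>\<^sub>0 = \<rho> \<mu>\<close> is a Girsanov measure, and it is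
  equivalent to \<open>\<mu>\<close> because \<open>\<rho> > 0\<close>.

  If \<open>C \<circ> U\<close> is the identity almost surely and \<open>\<nu> \<lless> \<mu>\<close> satisfies \<open>U\<nu> = \<mu>\<close>, then
  \<open>\<nu> = (C \<circ> U)\<nu> = C\<mu>\<close>, so there is at most one such \<open>\<nu>\<close>; the image of \<open>\<mu>\<close> under a right inverse of
  \<open>U\<close> is one (\<open>ex1_girsanov_measure_if_invertible\<close>).

  Conversely, let \<open>\<nu>\<^sub>0\<close> be the only one. For a bounded random variable \<open>Z > 0\<close> write \<open>U(Z \<nu>\<^sub>0) = \<phi> \<mu>\<close>.
  Then \<open>(Z / \<phi> \<circ> U) \<nu>\<^sub>0\<close> is a Girsanov measure as well, hence \<open>Z = \<phi> \<circ> U\<close> (\<open>factor_if_push_unique\<close>).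
  So every random variable is almost surely a function of \<open>U\<close>. Applied to the coordinates at rational
  times this gives a map \<open>C\<close> with \<open>C \<circ> U = id\<close> (\<open>ex_measurable_path\<close>), and \<open>U \<circ> C = id\<close> follows
  from \<open>U\<nu>\<^sub>0 = \<mu>\<close>. Equivalence of \<open>\<nu>\<^sub>0\<close> and \<open>\<mu>\<close> is what allows to pass between the two null ideals.

  Girsanov's theorem is proved by approximation with simple integrands instead of martingale theory.
  For a simple integrand it is a change of variables in one Gaussian increment after the other
  (\<open>one_step_girsanov\<close>, \<open>grid_girsanov\<close>, \<open>simple_girsanov\<close>). If simple \<open>V\<^sub>n\<close> approximate the density
  \<open>v\<close> of \<open>u\<close>, then along a subsequence the densities \<open>\<rho>\<^sub>n\<close> and the shifted paths \<open>U\<^sub>n\<close> converge almost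
  surely to \<open>\<rho>\<close> and \<open>U\<close>. Fatou's lemma for a test function \<open>\<Phi>\<close> and for \<open>1 - \<Phi>\<close> gives two
  inequalities, and \<open>E[\<rho>] = 1\<close> forces both to be equalities.

  The density \<open>\<rho>\<close> refers to a chosen value of the Ito integral, so the existence of the integral has
  to be proved as well (\<open>ex_ito_integral\<close>). Approximating simple processes are obtained by sampling
  \<open>v\<close> on a grid with a well chosen offset (\<open>bounded_simple_approximation\<close>). Their integrals converge
  because the mean of \<open>exp(\<integral>V dW - 1/2 \<integral>\<bar>V\<bar>\<^sup>2 dt)\<close> is 1 for simple \<open>V\<close>, which bounds the tails of
  \<open>\<integral>V dW\<close> in terms of \<open>\<integral>\<bar>V\<bar>\<^sup>2 dt\<close> (\<open>simple_integral_tail_one_sided\<close>).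
\<close>

section \<open>Girsanov measures and almost sure inverses\<close>

lemma girsanov_measure_iff:
  assumes "sets \<nu> = sets (completion \<mu>)" "U \<in> measurable \<nu> \<mu>"
  shows "girsanov_measure \<mu> U \<nu> \<longleftrightarrow> distr \<nu> \<mu> U = \<mu>"
proof
  assume "girsanov_measure \<mu> U \<nu>"
  then have f: "f \<in> borel_measurable \<mu> \<Longrightarrow> (\<integral>\<^sup>+w. f (U w) \<partial>\<nu>) = (\<integral>\<^sup>+w. f w \<partial>\<mu>)" for f
    unfolding girsanov_measure_def by auto
  show "distr \<nu> \<mu> U = \<mu>"
  proof (rule measure_eqI)
    fix A assume "A \<in> sets (distr \<nu> \<mu> U)"
    then have A: "A \<in> sets \<mu>" by simp
    have "emeasure (distr \<nu> \<mu> U) A = (\<integral>\<^sup>+w. indicator A w \<partial>distr \<nu> \<mu> U)"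
      using A by simp
    also have "\<dots> = (\<integral>\<^sup>+w. indicator A (U w) \<partial>\<nu>)"
      using A assms by (subst nn_integral_distr) auto
    also have "\<dots> = emeasure \<mu> A"
      using A f[of "indicator A"] by simp
    finally show "emeasure (distr \<nu> \<mu> U) A = emeasure \<mu> A" .
  qed simp
next
  assume "distr \<nu> \<mu> U = \<mu>"
  then show "girsanov_measure \<mu> U \<nu>"
    unfolding girsanov_measure_def using assms by (metis nn_integral_distr)
qed

lemma vimage_null_set_ac:
  assumes "N \<in> null_sets \<mu>" "T \<in> measurable M \<mu>" "absolutely_continuous \<mu> (distr M \<mu> T)"
  shows "T -` N \<inter> space M \<in> null_sets M"
proof -
  have "N \<in> null_sets (distr M \<mu> T)"
    using assms(1,3) unfolding absolutely_continuous_def by auto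
  then show ?thesis
    using assms(2) by (auto simp: null_sets_def emeasure_distr)
qed

lemma AE_ac_completion:
  assumes "sets \<nu> = sets (completion \<mu>)" "absolutely_continuous (completion \<mu>) \<nu>"
    and "AE w in \<mu>. P w"
  shows "AE w in \<nu>. P w"
  using absolutely_continuous_AE[OF assms(1,2)] AE_completion[OF assms(3)] by blast

text \<open>
  A set of the completion is a Borel set up to a null set, which absolutely continuous measures ignore.
\<close>

lemma ac_measure_eqI:
  assumes "sets \<nu> = sets (completion \<mu>)" "sets \<nu>' = sets (completion \<mu>)"
    and "absolutely_continuous (completion \<mu>) \<nu>" "absolutely_continuous (completion \<mu>) \<nu>'"
    and eq: "\<And>A. A \<in> sets \<mu> \<Longrightarrow> emeasure \<nu> A = emeasure \<nu>' A"
  shows "\<nu> = \<nu>'"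
proof (rule measure_eqI)
  fix A assume "A \<in> sets \<nu>"
  then have A: "A \<in> sets (completion \<mu>)" using assms by simp
  have "null_part \<mu> A \<in> null_sets (completion \<mu>)"
    using null_part[OF A] null_sets_completion_iff2[of "null_part \<mu> A" \<mu>] by auto
  then have N: "null_part \<mu> A \<in> null_sets \<nu>" "null_part \<mu> A \<in> null_sets \<nu>'"
    using assms(3,4) unfolding absolutely_continuous_def by auto
  have m: "main_part \<mu> A \<in> sets \<mu>" using A by simp
  have "emeasure \<nu> (main_part \<mu> A \<union> null_part \<mu> A) = emeasure \<nu>' (main_part \<mu> A \<union> null_part \<mu> A)"
    using m N eq[OF m] assms by (subst (1 2) emeasure_Un_null_set) auto
  then show "emeasure \<nu> A = emeasure \<nu>' A" using A by simp
qed (use assms in simp)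

text \<open>
  The image of \<open>\<mu>\<close> under the right inverse \<open>A\<close> is a Girsanov measure since \<open>U \<circ> A = id\<close>. If
  \<open>C \<circ> U = id\<close> holds \<open>\<mu>\<close>-almost surely, it holds \<open>\<nu>\<close>-almost surely for \<open>\<nu> \<lless> \<mu>\<close>, so that
  \<open>\<nu> = (C \<circ> U)\<nu> = C\<mu>\<close> on Borel sets, whichever Girsanov measure \<open>\<nu>\<close> is.
\<close>

lemma ex1_girsanov_measure_if_invertible:
  assumes "as_invertible \<mu> U"
  shows "\<exists>!\<nu>. absolutely_continuous (completion \<mu>) \<nu> \<and> girsanov_measure \<mu> U \<nu>"
proof -
  let ?M = "completion \<mu>"
  obtain A C where A: "right_inverse \<mu> U A" and C: "right_inverse \<mu> C U"
    using assms unfolding as_invertible_def by blast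
  have U[measurable]: "U \<in> measurable ?M \<mu>" and Am[measurable]: "A \<in> measurable ?M \<mu>"
    and Aac: "absolutely_continuous \<mu> (distr ?M \<mu> A)" and UA: "AE w in \<mu>. U (A w) = w"
    using A unfolding right_inverse_def by auto
  have Cm[measurable]: "C \<in> measurable ?M \<mu>"
    and Uac: "absolutely_continuous \<mu> (distr ?M \<mu> U)" and CU: "AE w in \<mu>. C (U w) = w"
    using C unfolding right_inverse_def by auto
  have A2: "A \<in> measurable ?M ?M" 
    using completion.measurable_completion2[OF Am] Aac unfolding absolutely_continuous_def by auto
  have U2: "U \<in> measurable ?M ?M" 
    using completion.measurable_completion2[OF U] Uac unfolding absolutely_continuous_def by auto
  define \<nu> where "\<nu> = distr ?M ?M A"
  have 1: "absolutely_continuous ?M \<nu>"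
    unfolding absolutely_continuous_def
  proof
    fix N assume "N \<in> null_sets ?M"
    then obtain N' where N': "N' \<in> null_sets \<mu>" "N \<subseteq> N'"
      using null_sets_completion_iff2[of N \<mu>] by auto
    have "A -` N' \<inter> space ?M \<in> null_sets ?M"
      using vimage_null_set_ac[OF N'(1) Am Aac] .
    then have "A -` N \<inter> space ?M \<in> null_sets ?M"
      by (rule null_sets_completion_subset[rotated]) (use N' in auto)
    then show "N \<in> null_sets \<nu>"
      unfolding \<nu>_def using \<open>N \<in> null_sets ?M\<close> A2 by (simp add: null_sets_def emeasure_distr)
  qed
  have Un: "U \<in> measurable \<nu> \<mu>" unfolding \<nu>_def using U by simp
  have "distr \<nu> \<mu> U = distr ?M \<mu> (U \<circ> A)"
    unfolding \<nu>_def by (rule distr_distr[OF U A2])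
  also have "\<dots> = distr ?M \<mu> (\<lambda>x. x)"
    using U A2 by (intro distr_cong_AE) (auto intro!: AE_completion UA measurable_completion)
  also have "\<dots> = \<mu>"
    using distr_completion[of "\<lambda>x. x" \<mu> \<mu>] by (simp add: distr_id2)
  finally have "distr \<nu> \<mu> U = \<mu>" .
  then have 2: "girsanov_measure \<mu> U \<nu>"
    using girsanov_measure_iff[OF _ Un] by (simp add: \<nu>_def)
  have law: "emeasure \<nu>' B = emeasure (distr ?M \<mu> C) B" 
    if ac: "absolutely_continuous ?M \<nu>'" and g: "girsanov_measure \<mu> U \<nu>'" and B: "B \<in> sets \<mu>" for \<nu>' B
  proof -
    have s: "sets \<nu>' = sets ?M" and Un': "U \<in> measurable \<nu>' \<mu>"
      using g unfolding girsanov_measure_def by auto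
    have d: "distr \<nu>' \<mu> U = \<mu>" using girsanov_measure_iff[OF s Un'] g by simp
    let ?B = "C -` B \<inter> space ?M"
    have Bm: "?B \<in> sets ?M" using measurable_sets[OF Cm B] .
    have sp: "space \<nu>' = space \<mu>" using sets_eq_imp_space_eq[OF s] by simp
    \<comment> \<open>\<open>C\<close> is measurable only on the completion, so \<open>U\<nu>' = \<mu>\<close> is used on the Borel part of \<open>?B\<close>.\<close>
    have N: "U -` null_part \<mu> ?B \<inter> space \<nu>' \<in> null_sets \<nu>'"
    proof -
      obtain N' where N': "N' \<in> null_sets \<mu>" "null_part \<mu> ?B \<subseteq> N'"
        using null_part[OF Bm] by auto
      have "emeasure \<nu>' (U -` N' \<inter> space \<nu>') = emeasure (distr \<nu>' \<mu> U) N'"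
        using N' Un' by (subst emeasure_distr) auto
      then have "emeasure \<nu>' (U -` N' \<inter> space \<nu>') = 0" using d N' by auto
      moreover have "U -` null_part \<mu> ?B \<inter> space \<nu>' \<in> sets \<nu>'"
      proof -
        have "null_part \<mu> ?B \<in> sets ?M"
          using null_sets_completion[OF N'] .
        then have "U -` null_part \<mu> ?B \<inter> space ?M \<in> sets ?M"
          using U2 by (rule measurable_sets[rotated])
        then show ?thesis using s sp by simp
      qed
      ultimately show ?thesis
        using N' measurable_sets[OF Un', of N']
        by (intro null_setsI) (auto intro!: emeasure_eq_0[of "U -` N' \<inter> space \<nu>'"])
    qed
    have "emeasure \<nu>' B = emeasure \<nu>' (U -` ?B \<inter> space \<nu>')"
    proof (rule emeasure_eq_AE)
      show "AE w in \<nu>'. (w \<in> B) = (w \<in> U -` ?B \<inter> space \<nu>')"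
        using AE_ac_completion[OF s ac CU] AE_space
        by eventually_elim (use measurable_space[OF Un'] in auto)
      show "U -` ?B \<inter> space \<nu>' \<in> sets \<nu>'"
        using measurable_sets[OF U2 Bm] s sp by simp
    qed (use B s in auto)
    also have "U -` ?B \<inter> space \<nu>' = (U -` main_part \<mu> ?B \<inter> space \<nu>') \<union> (U -` null_part \<mu> ?B \<inter> space \<nu>')"
      using main_part_null_part_Un[OF Bm] by blast
    also have "emeasure \<nu>' \<dots> = emeasure \<nu>' (U -` main_part \<mu> ?B \<inter> space \<nu>')"
      using measurable_sets[OF Un' main_part_sets[OF Bm]] N by (rule emeasure_Un_null_set)
    also have "\<dots> = emeasure (distr \<nu>' \<mu> U) (main_part \<mu> ?B)"
      using Un' main_part_sets[OF Bm] by (simp add: emeasure_distr)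
    also have "\<dots> = emeasure ?M ?B" using Bm d by simp
    also have "\<dots> = emeasure (distr ?M \<mu> C) B"
      using B by (subst emeasure_distr) auto
    finally show ?thesis .
  qed
  show ?thesis
  proof (rule ex1I[of _ \<nu>])
    show "absolutely_continuous ?M \<nu> \<and> girsanov_measure \<mu> U \<nu>" using 1 2 by simp
    fix \<nu>' assume h: "absolutely_continuous ?M \<nu>' \<and> girsanov_measure \<mu> U \<nu>'"
    show "\<nu>' = \<nu>"
      using h 1 2 law[of \<nu>'] law[OF 1 2]
      by (intro ac_measure_eqI[of \<nu>' \<mu> \<nu>]) (auto simp: girsanov_measure_def)
  qed
qed

text \<open>
  Let \<open>\<phi>\<close> be the density of \<open>U(Z \<nu>)\<close> with respect to \<open>U\<nu> = \<mu>\<close>. It is positive and finite almost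
  everywhere, and the density \<open>Z / \<phi>(U)\<close> again gives a measure that \<open>U\<close> maps to \<open>\<mu>\<close>:
  \<open>\<integral> f(U) Z / \<phi>(U) d\<nu> = \<integral> (f / \<phi>) \<phi> d\<mu> = \<integral> f d\<mu>\<close>. By uniqueness this density is 1.
\<close>

lemma factor_if_push_unique:
  fixes Z :: "'a \<Rightarrow> real"
  assumes "prob_space \<nu>" and U[measurable]: "U \<in> measurable \<nu> \<mu>" and d: "distr \<nu> \<mu> U = \<mu>"
    and Z[measurable]: "Z \<in> borel_measurable \<nu>" and Zb: "\<And>w. 0 < Z w" "\<And>w. Z w \<le> b"
    and uniq: "\<And>g :: 'a \<Rightarrow> ennreal. g \<in> borel_measurable \<nu> \<Longrightarrow>
       distr (density \<nu> g) \<mu> U = \<mu> \<Longrightarrow> density \<nu> g = \<nu>"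
  shows "\<exists>\<phi>\<in>borel_measurable \<mu>. AE w in \<nu>. Z w = \<phi> (U w)"
proof -
  interpret prob_space \<nu> by fact
  interpret m: prob_space \<mu> using prob_space_distr[OF U] d by simp
  define \<kappa> where "\<kappa> = distr (density \<nu> (\<lambda>w. ennreal (Z w))) \<mu> U"
  have \<kappa>: "emeasure \<kappa> B = (\<integral>\<^sup>+w. ennreal (Z w) * indicator B (U w) \<partial>\<nu>)" if "B \<in> sets \<mu>" for B
  proof -
    have "emeasure \<kappa> B = emeasure (density \<nu> (\<lambda>w. ennreal (Z w))) (U -` B \<inter> space \<nu>)"
      unfolding \<kappa>_def using that U by (subst emeasure_distr) auto
    also have "\<dots> = (\<integral>\<^sup>+w. ennreal (Z w) * indicator (U -` B \<inter> space \<nu>) w \<partial>\<nu>)"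
      using that by (subst emeasure_density) auto
    also have "\<dots> = (\<integral>\<^sup>+w. ennreal (Z w) * indicator B (U w) \<partial>\<nu>)"
      by (intro nn_integral_cong) (auto simp: indicator_def)
    finally show ?thesis .
  qed
  have fin: "emeasure \<kappa> (space \<mu>) < \<infinity>"
  proof -
    have "emeasure \<kappa> (space \<mu>) \<le> (\<integral>\<^sup>+w. ennreal b \<partial>\<nu>)"
      unfolding \<kappa>[OF sets.top] by (intro nn_integral_mono) (auto simp: indicator_def ennreal_leI Zb(2))
    also have "\<dots> < \<infinity>" by (simp add: emeasure_space_1)
    finally show ?thesis .
  qed
  have ac: "absolutely_continuous \<mu> \<kappa>"
    unfolding absolutely_continuous_def
  proof
    fix N assume N: "N \<in> null_sets \<mu>"
    have "emeasure \<nu> (U -` N \<inter> space \<nu>) = emeasure (distr \<nu> \<mu> U) N"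
      using N by (subst emeasure_distr) auto
    then have "U -` N \<inter> space \<nu> \<in> null_sets \<nu>"
      using N d by (auto simp: null_sets_def)
    then have "AE w in \<nu>. w \<notin> U -` N \<inter> space \<nu>" by (rule AE_not_in)
    then have "emeasure \<kappa> N = (\<integral>\<^sup>+w. 0 \<partial>\<nu>)"
      unfolding \<kappa>[OF null_setsD2[OF N]]
      by (intro nn_integral_cong_AE, elim AE_mp) (auto intro!: AE_I2 simp: indicator_def)
    then show "N \<in> null_sets \<kappa>" using N by (simp add: null_sets_def \<kappa>_def)
  qed
  define \<phi> where "\<phi> = RN_deriv \<mu> \<kappa>"
  have [measurable]: "\<phi> \<in> borel_measurable \<mu>" unfolding \<phi>_def by simp
  have dens: "density \<mu> \<phi> = \<kappa>"
    unfolding \<phi>_def using ac by (intro m.density_RN_deriv) (auto simp: \<kappa>_def)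
  have \<phi>fin: "AE x in \<mu>. \<phi> x \<noteq> \<infinity>"
  proof (rule nn_integral_PInf_AE)
    have "(\<integral>\<^sup>+x. \<phi> x \<partial>\<mu>) = emeasure (density \<mu> \<phi>) (space \<mu>)"
      by (subst emeasure_density) (auto intro!: nn_integral_cong)
    then show "(\<integral>\<^sup>+x. \<phi> x \<partial>\<mu>) \<noteq> \<infinity>" using fin dens by simp
  qed simp
  have push: "(\<integral>\<^sup>+x. f x * \<phi> x \<partial>\<mu>) = (\<integral>\<^sup>+w. f (U w) * ennreal (Z w) \<partial>\<nu>)"
    if [measurable]: "f \<in> borel_measurable \<mu>" for f :: "'b \<Rightarrow> ennreal"
  proof -
    have "(\<integral>\<^sup>+x. f x * \<phi> x \<partial>\<mu>) = (\<integral>\<^sup>+x. f x \<partial>\<kappa>)"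
      unfolding dens[symmetric] by (subst nn_integral_density) (auto simp: mult.commute)
    also have "\<dots> = (\<integral>\<^sup>+w. f (U w) \<partial>density \<nu> (\<lambda>w. ennreal (Z w)))"
      unfolding \<kappa>_def by (subst nn_integral_distr) auto
    also have "\<dots> = (\<integral>\<^sup>+w. f (U w) * ennreal (Z w) \<partial>\<nu>)"
      by (subst nn_integral_density) (auto simp: mult.commute)
    finally show ?thesis .
  qed
  have pull: "AE w in \<nu>. P (U w)" if "AE x in \<mu>. P x" "Measurable.pred \<mu> P" for P
    using that d by (subst (asm) d[symmetric], subst (asm) AE_distr_iff) auto
  have \<phi>pos: "AE x in \<mu>. \<phi> x \<noteq> 0"
  proof -
    let ?f = "\<lambda>x. indicator {x \<in> space \<mu>. \<phi> x = 0} x :: ennreal"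
    have "0 = (\<integral>\<^sup>+x. ?f x * \<phi> x \<partial>\<mu>)"
      by (subst nn_integral_0_iff_AE[THEN iffD2]) (auto simp: indicator_def)
    also have "\<dots> = (\<integral>\<^sup>+w. ?f (U w) * ennreal (Z w) \<partial>\<nu>)"
      by (rule push) measurable
    finally have "AE w in \<nu>. ?f (U w) * ennreal (Z w) = 0"
      by (subst (asm) eq_commute, subst (asm) nn_integral_0_iff_AE) auto
    then have "AE w in \<nu>. \<phi> (U w) \<noteq> 0"
      using AE_space
    proof eventually_elim
      case (elim w)
      have "ennreal (Z w) \<noteq> 0" using Zb(1)[of w] by auto
      then show ?case using elim measurable_space[OF U] by (auto simp: indicator_def)
    qed
    then have "AE x in distr \<nu> \<mu> U. \<phi> x \<noteq> 0" by (subst AE_distr_iff) auto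
    then show ?thesis unfolding d .
  qed
  let ?g = "\<lambda>w. inverse (\<phi> (U w)) * ennreal (Z w)"
  have "distr (density \<nu> ?g) \<mu> U = \<mu>"
  proof (rule measure_eqI)
    fix B assume "B \<in> sets (distr (density \<nu> ?g) \<mu> U)"
    then have B[measurable]: "B \<in> sets \<mu>" by simp
    have "emeasure (distr (density \<nu> ?g) \<mu> U) B = emeasure (density \<nu> ?g) (U -` B \<inter> space \<nu>)"
      using B by (subst emeasure_distr) auto
    also have "\<dots> = (\<integral>\<^sup>+w. ?g w * indicator (U -` B \<inter> space \<nu>) w \<partial>\<nu>)"
      by (subst emeasure_density) auto
    also have "\<dots> = (\<integral>\<^sup>+w. (inverse (\<phi> (U w)) * indicator B (U w)) * ennreal (Z w) \<partial>\<nu>)"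
      by (intro nn_integral_cong) (auto simp: indicator_def)
    also have "\<dots> = (\<integral>\<^sup>+x. (inverse (\<phi> x) * indicator B x) * \<phi> x \<partial>\<mu>)"
      by (rule push[symmetric]) measurable
    also have "\<dots> = (\<integral>\<^sup>+x. indicator B x \<partial>\<mu>)"
    proof (intro nn_integral_cong_AE)
      show "AE x in \<mu>. (inverse (\<phi> x) * indicator B x) * \<phi> x = indicator B x"
        using \<phi>pos \<phi>fin
      proof eventually_elim
        case (elim x)
        have "\<phi> x / \<phi> x = 1" using elim by (intro ennreal_divide_self) (auto simp: top.not_eq_extremum)
        then show ?case by (simp add: indicator_def divide_ennreal_def mult.commute)
      qed
    qed
    finally show "emeasure (distr (density \<nu> ?g) \<mu> U) B = emeasure \<mu> B" by simp
  qed simp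
  then have "density \<nu> ?g = density \<nu> (\<lambda>_. 1)"
    using uniq[of ?g] by (simp add: density_1)
  then have "AE w in \<nu>. ?g w = 1"
    by (subst (asm) density_unique_iff) auto
  moreover have "AE w in \<nu>. \<phi> (U w) \<noteq> 0" "AE w in \<nu>. \<phi> (U w) \<noteq> \<infinity>"
    using pull[OF \<phi>pos] pull[OF \<phi>fin] by auto
  ultimately have "AE w in \<nu>. Z w = enn2real (\<phi> (U w))"
  proof eventually_elim
    case (elim w)
    have "\<phi> (U w) / \<phi> (U w) = 1" using elim by (intro ennreal_divide_self) (auto simp: top.not_eq_extremum)
    then have "\<phi> (U w) = (\<phi> (U w) * inverse (\<phi> (U w))) * ennreal (Z w)"
      using elim(1) by (simp add: mult.assoc)
    also have "\<dots> = ennreal (Z w)"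
      using \<open>\<phi> (U w) / \<phi> (U w) = 1\<close> by (simp add: divide_ennreal_def)
    finally show ?case using Zb(1)[of w] by (simp add: less_imp_le)
  qed
  then show ?thesis by (intro bexI[of _ "\<lambda>x. enn2real (\<phi> x)"]) auto
qed

lemma closure_unit_rationals: "{0..1} \<subseteq> closure (\<rat> \<inter> {0..1::real})"
proof
  fix t :: real assume t: "t \<in> {0..1}"
  show "t \<in> closure (\<rat> \<inter> {0..1})"
  proof (cases "t = 1")
    case True
    then show ?thesis by (intro subsetD[OF closure_subset]) auto
  next
    case False
    show ?thesis
      unfolding closure_approachable
    proof (intro allI impI)
      fix e :: real assume "0 < e"
      obtain q where "q \<in> \<rat>" "t < q" "q < min 1 (t + e)"
        using Rats_dense_in_real[of t "min 1 (t + e)"] False t \<open>0 < e\<close> by auto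
      then show "\<exists>y\<in>\<rat> \<inter> {0..1}. dist y t < e"
        using t by (intro bexI[of _ q]) (auto simp: dist_real_def)
    qed
  qed
qed

lemma paths_eqI:
  assumes "x \<in> paths" "y \<in> paths" and eq: "\<And>q. q \<in> \<rat> \<inter> {0..1} \<Longrightarrow> x q = y q"
  shows "x = y"
proof
  fix t show "x t = y t"
  proof (cases "t \<in> {0..1}")
    case True
    then have "t \<in> closure (\<rat> \<inter> {0..1})" using closure_unit_rationals by auto
    then obtain f where f: "\<And>n. f n \<in> \<rat> \<inter> {0..1}" "f \<longlonglongrightarrow> t" unfolding closure_sequential by auto
    have f01: "\<And>n. f n \<in> {0..1}" using f(1) by auto
    have "(\<lambda>n. x (f n)) \<longlonglongrightarrow> x t" "(\<lambda>n. y (f n)) \<longlonglongrightarrow> y t"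
      using assms(1,2) True f01 f(2)
      by (auto simp: paths_def intro!: continuous_on_tendsto_compose[of "{0..1}" _ f])
    then show ?thesis using eq[OF f(1)] LIMSEQ_unique by simp
  next
    case False
    then show ?thesis using assms(1,2) by (simp add: paths_def extensional_def)
  qed
qed

text \<open>
  If the values of \<open>X w\<close> at rational times are functions of \<open>U w\<close>, so is the whole path. The
  functions \<open>c q\<close> need not fit together to a path at every point; the set \<open>D\<close> where they are uniformly
  continuous in \<open>q\<close> is measurable, as only countably many conditions are involved, and it contains
  almost every \<open>U w\<close>. On \<open>D\<close> the value at time \<open>t\<close> is the limit along the rationals \<open>r n t\<close>.
\<close>

lemma ex_measurable_path:
  fixes \<mu> :: "(real \<Rightarrow> real ^ 'n) measure" and \<nu> :: "'a measure"
  assumes \<mu>: "sets \<mu> = sets path_space"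
    and X: "\<And>w. w \<in> space \<nu> \<Longrightarrow> X w \<in> paths" and U: "U \<in> measurable \<nu> \<mu>"
    and val: "\<And>q. q \<in> \<rat> \<inter> {0..1} \<Longrightarrow> \<exists>c\<in>borel_measurable \<mu>. AE w in \<nu>. X w q = c (U w)"
  shows "\<exists>C\<in>measurable \<mu> \<mu>. AE w in \<nu>. C (U w) = X w"
proof -
  define Q where "Q = (\<rat> \<inter> {0..1} :: real set)"
  have Qc: "countable Q" unfolding Q_def by (simp add: countable_rat)
  have "\<forall>q\<in>Q. \<exists>c. c \<in> borel_measurable \<mu> \<and> (AE w in \<nu>. X w q = c (U w))"
    using val unfolding Q_def by blast
  from bchoice[OF this] obtain c where c[measurable]: "\<And>q. q \<in> Q \<Longrightarrow> c q \<in> borel_measurable \<mu>"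
    and cX: "\<And>q. q \<in> Q \<Longrightarrow> AE w in \<nu>. X w q = c q (U w)"
    by blast
  define D where "D = {x \<in> space \<mu>. \<forall>k::nat. \<exists>m::nat. \<forall>p\<in>Q. \<forall>q\<in>Q.
    dist p q < 1 / Suc m \<longrightarrow> dist (c p x) (c q x) < 1 / Suc k}"
  have D: "D \<in> sets \<mu>"
    unfolding D_def using Qc by measurable
  define r where "r n t = (if t \<in> {0..1} then of_int \<lfloor>real (Suc n) * t\<rfloor> / real (Suc n) else 0)" for n :: nat and t :: real
  have rQ: "r n t \<in> Q" for n t
  proof (cases "t \<in> {0..1}")
    case True
    have "of_int \<lfloor>real (Suc n) * t\<rfloor> \<le> real (Suc n) * t" by simp
    also have "\<dots> \<le> real (Suc n) * 1" using True by (intro mult_left_mono) auto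
    finally show ?thesis using True unfolding Q_def r_def by (simp add: divide_le_eq)
  next
    case False
    then have "r n t = 0" by (auto simp: r_def)
    then show ?thesis by (simp add: Q_def)
  qed
  have rlim: "(\<lambda>n. r n t) \<longlonglongrightarrow> t" if "t \<in> {0..1}" for t
  proof (rule LIMSEQ_I)
    fix e :: real assume "0 < e"
    then obtain N where N: "1 / real (Suc N) < e" using nat_approx_posE by blast
    have "norm (r n t - t) < e" if "N \<le> n" for n
    proof -
      have "\<bar>of_int \<lfloor>real (Suc n) * t\<rfloor> - real (Suc n) * t\<bar> < 1" by linarith
      moreover have "r n t - t = (of_int \<lfloor>real (Suc n) * t\<rfloor> - real (Suc n) * t) / real (Suc n)"
        using \<open>t \<in> {0..1}\<close> by (simp add: r_def field_simps)
      ultimately have "\<bar>r n t - t\<bar> < 1 / real (Suc n)"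
        by (simp add: abs_divide divide_strict_right_mono)
      also have "\<dots> \<le> 1 / real (Suc N)" using that by (simp add: frac_le)
      finally show ?thesis using N by simp
    qed
    then show "\<exists>no. \<forall>n\<ge>no. norm (r n t - t) < e" by blast
  qed
  define C where "C x = (\<lambda>t\<in>{0..1}. if x \<in> D then lim (\<lambda>n. c (r n t) x) else 0)" for x
  have lim: "(\<lambda>n. c (r n t) x) \<longlonglongrightarrow> g t"
    if g: "continuous_on {0..1} g" and gc: "\<And>q. q \<in> Q \<Longrightarrow> g q = c q x" and t: "t \<in> {0..1}" for x g t
  proof -
    have "(\<lambda>n. g (r n t)) \<longlonglongrightarrow> g t"
      using rQ by (intro continuous_on_tendsto_compose[OF g rlim[OF t] t]) (auto simp: Q_def)
    then show ?thesis using gc[OF rQ] by simp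
  qed
  have Cg: "C x = g"
    if "continuous_on {0..1} g" "\<And>q. q \<in> Q \<Longrightarrow> g q = c q x" "g \<in> extensional {0..1}" "x \<in> D" for x g
  proof
    fix t show "C x t = g t"
      using lim[OF that(1,2), of t] that(3,4) limI unfolding C_def
      by (cases "t \<in> {0..1}") (auto simp: extensional_def)
  qed
  have Cpath: "C x \<in> paths" for x
  proof (cases "x \<in> D")
    case True
    have "uniformly_continuous_on Q (\<lambda>q. c q x)"
      unfolding uniformly_continuous_on_def
    proof safe
      fix e :: real assume "0 < e"
      then obtain k where k: "1 / real (Suc k) < e" using nat_approx_posE by blast
      obtain m where m: "\<And>p q. p \<in> Q \<Longrightarrow> q \<in> Q \<Longrightarrow> dist p q < 1 / Suc m \<Longrightarrow> dist (c p x) (c q x) < 1 / Suc k"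
        using True unfolding D_def by blast
      show "\<exists>d>0. \<forall>q\<in>Q. \<forall>p\<in>Q. dist p q < d \<longrightarrow> dist (c p x) (c q x) < e"
      proof (intro exI[of _ "1 / real (Suc m)"] conjI ballI impI)
        fix p q assume "p \<in> Q" "q \<in> Q" "dist q p < 1 / real (Suc m)"
        from m[OF this(2,1,3)] show "dist (c q x) (c p x) < e" using k by linarith
      qed simp
    qed
    then obtain g where g: "uniformly_continuous_on (closure Q) g" "\<And>q. q \<in> Q \<Longrightarrow> c q x = g q"
      using uniformly_continuous_on_extension_on_closure by metis
    have "{0..1} \<subseteq> closure Q" unfolding Q_def by (rule closure_unit_rationals)
    then have gc: "continuous_on {0..1} g"
      using uniformly_continuous_imp_continuous[OF g(1)] continuous_on_subset by blast
    let ?g = "restrict g {0..1}"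
    have 1: "continuous_on {0..1} ?g" by (rule continuous_on_eq[OF gc]) simp
    moreover have "?g q = c q x" if "q \<in> Q" for q using that g(2) by (auto simp: Q_def)
    ultimately have "C x = ?g" using True by (intro Cg) auto
    then show ?thesis using 1 by (simp add: paths_def)
  next
    case False
    then have "C x = (\<lambda>t\<in>{0..1}. 0)" by (simp add: C_def)
    moreover have "continuous_on {0..1} (\<lambda>t\<in>{0..1::real}. 0 :: real ^ 'n)"
      by (rule continuous_on_eq[of _ "\<lambda>_. 0"]) auto
    ultimately show ?thesis by (simp add: paths_def)
  qed
  have "C \<in> measurable \<mu> path_space"
    unfolding path_space_def
  proof (rule measurable_restrict_space2)
    show "C \<in> space \<mu> \<rightarrow> paths" using Cpath by blast
    have "(\<lambda>x. if x \<in> D then lim (\<lambda>n. c (r n t) x) else 0) \<in> borel_measurable \<mu>" for t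
      using D c rQ by (intro measurable_If_set borel_measurable_lim_metric) auto
    then show "C \<in> measurable \<mu> (PiM {0..1} (\<lambda>_. borel))"
      unfolding C_def by (intro measurable_restrict) auto
  qed
  then have Cm: "C \<in> measurable \<mu> \<mu>"
    using measurable_cong_sets[OF refl \<mu>, of \<mu>] by simp
  have "AE w in \<nu>. \<forall>q\<in>Q. X w q = c q (U w)"
    using cX Qc by (simp add: AE_ball_countable)
  then have "AE w in \<nu>. C (U w) = X w"
    using AE_space
  proof eventually_elim
    case (elim w)
    have Xw: "continuous_on {0..1} (X w)" "X w \<in> extensional {0..1}"
      using X[OF elim(2)] by (auto simp: paths_def)
    then have uc: "uniformly_continuous_on {0..1} (X w)"
      using compact_uniformly_continuous by blast
    have "U w \<in> D"
      unfolding D_def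
    proof (safe)
      show "U w \<in> space \<mu>" using measurable_space[OF U elim(2)] .
      fix k :: nat
      have "0 < 1 / real (Suc k)" by simp
      then obtain d where "d > 0"
        and d: "\<And>p q. p \<in> {0..1} \<Longrightarrow> q \<in> {0..1} \<Longrightarrow> dist p q < d \<Longrightarrow> dist (X w p) (X w q) < 1 / real (Suc k)"
        using uc unfolding uniformly_continuous_on_def by metis
      obtain m where m: "1 / real (Suc m) < d" using nat_approx_posE[OF \<open>d > 0\<close>] by blast
      show "\<exists>m. \<forall>p\<in>Q. \<forall>q\<in>Q. dist p q < 1 / real (Suc m) \<longrightarrow> dist (c p (U w)) (c q (U w)) < 1 / real (Suc k)"
      proof (intro exI ballI impI)
        fix p q assume pq: "p \<in> Q" "q \<in> Q" "dist p q < 1 / real (Suc m)"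
        then have "dist (X w p) (X w q) < 1 / real (Suc k)"
          using m by (intro d) (auto simp: Q_def)
        then show "dist (c p (U w)) (c q (U w)) < 1 / real (Suc k)"
          using elim(1) pq by simp
      qed
    qed
    then show ?case using Xw elim(1) by (intro Cg) auto
  qed
  then show ?thesis using Cm by blast
qed


text \<open>
  Since \<open>\<rho> > 0\<close>, the measure \<open>\<nu> = \<rho> \<mu>\<close> has the same null sets as \<open>\<mu>\<close>. By uniqueness the rational
  coordinates are functions of \<open>U\<close>, which gives \<open>C\<close> with \<open>C \<circ> U = id\<close>. Then \<open>U \<circ> C \<circ> U = U\<close>
  \<open>\<nu>\<close>-almost surely, that is, \<open>U \<circ> C = id\<close> almost surely for \<open>U\<nu> = \<mu>\<close>; likewise \<open>C\<mu> = (C \<circ> U)\<nu> = \<nu>\<close>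
  is absolutely continuous.
\<close>

lemma invertible_if_ex1_girsanov_measure:
  fixes \<mu> :: "(real \<Rightarrow> real ^ 'n) measure"
  assumes "prob_space \<mu>" and \<mu>: "sets \<mu> = sets path_space"
    and U: "U \<in> measurable (completion \<mu>) \<mu>"
    and \<rho>[measurable]: "\<rho> \<in> borel_measurable (completion \<mu>)" and \<rho>pos: "\<And>w. \<rho> w > (0 :: ennreal)"
    and G: "distr (density (completion \<mu>) \<rho>) \<mu> U = \<mu>"
    and ex1: "\<exists>!\<nu>. absolutely_continuous (completion \<mu>) \<nu> \<and> girsanov_measure \<mu> U \<nu>"
  shows "as_invertible \<mu> U"
proof -
  let ?M = "completion \<mu>"
  define \<nu> where "\<nu> = density ?M \<rho>"
  have s: "sets \<nu> = sets ?M" and sp: "space \<nu> = space \<mu>" unfolding \<nu>_def by simp_all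
  have U\<nu>: "U \<in> measurable \<nu> \<mu>" using U by (simp add: \<nu>_def)
  have d: "distr \<nu> \<mu> U = \<mu>" using G by (simp add: \<nu>_def)
  have ac: "absolutely_continuous ?M \<nu>"
    unfolding \<nu>_def by (rule absolutely_continuousI_density) simp
  interpret \<mu>: prob_space \<mu> by fact
  have p\<nu>: "prob_space \<nu>"
  proof
    have "emeasure \<nu> (space \<nu>) = emeasure (distr \<nu> \<mu> U) (space \<mu>)"
      using U\<nu> measurable_space[OF U\<nu>] by (subst emeasure_distr) (auto intro!: arg_cong[of _ _ "emeasure \<nu>"])
    then show "emeasure \<nu> (space \<nu>) = 1" unfolding d by (simp add: \<mu>.emeasure_space_1)
  qed
  have null: "N \<in> null_sets ?M" if "N \<in> null_sets \<nu>" for N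
  proof -
    have "N \<in> sets ?M" and ae: "AE w in ?M. w \<in> N \<longrightarrow> \<rho> w = 0"
      using that unfolding \<nu>_def by (auto simp: null_sets_density_iff)
    moreover have "AE w in ?M. w \<notin> N"
      using ae by eventually_elim (use \<rho>pos in \<open>metis less_irrefl\<close>)
    ultimately show ?thesis using AE_iff_null_sets[of N ?M] by simp
  qed
  have AEM: "AE w in \<mu>. P w" if P: "AE w in \<nu>. P w" for P
  proof -
    obtain N where N: "N \<in> null_sets \<nu>" "{w \<in> space \<nu>. \<not> P w} \<subseteq> N" using P unfolding eventually_ae_filter by auto
    then have "AE w in ?M. P w" using null[OF N(1)] sp unfolding eventually_ae_filter by auto
    then show ?thesis using AE_completion_iff by blast
  qed
  have uniq: "density \<nu> g = \<nu>"
    if g[measurable]: "g \<in> borel_measurable \<nu>" and dg: "distr (density \<nu> g) \<mu> U = \<mu>" for g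
  proof -
    have "girsanov_measure \<mu> U \<nu>"
      using girsanov_measure_iff[OF s U\<nu>] d by simp
    moreover have "girsanov_measure \<mu> U (density \<nu> g)"
      using girsanov_measure_iff[of "density \<nu> g" \<mu> U] s U\<nu> dg by simp
    moreover have "absolutely_continuous ?M (density \<nu> g)"
      using ac absolutely_continuousI_density[OF g] unfolding absolutely_continuous_def by auto
    ultimately show ?thesis using ac ex1 by blast
  qed
  have coord: "(\<lambda>w. w q) \<in> borel_measurable \<mu>" if "q \<in> {0..1}" for q
  proof -
    have "(\<lambda>w. w q) \<in> borel_measurable (path_space :: (real \<Rightarrow> real ^ 'n) measure)"
      unfolding path_space_def using that
      by (intro measurable_restrict_space1 measurable_component_singleton)
    then show ?thesis unfolding measurable_cong_sets[OF \<mu> refl] .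
  qed
  have val: "\<exists>c\<in>borel_measurable \<mu>. AE w in \<nu>. w q = c (U w)" if q: "q \<in> \<rat> \<inter> {0..1}" for q
  proof -
    \<comment> \<open>a bounded positive random variable that determines the coordinate\<close>
    have "\<exists>\<phi>\<in>borel_measurable \<mu>. AE w in \<nu>. arctan (w q $ i) + 2 = \<phi> (U w)" for i
    proof (rule factor_if_push_unique[OF p\<nu> U\<nu> d, where b = 4])
      have "(\<lambda>w. w q) \<in> borel_measurable ?M" using q coord by (auto intro: measurable_completion)
      then have [measurable]: "(\<lambda>w. w q) \<in> borel_measurable \<nu>" by (simp add: \<nu>_def)
      have "(\<lambda>w. w q $ i) \<in> borel_measurable \<nu>"
        using borel_measurable_continuous_onI[of "\<lambda>x::real^'n. x $ i"]
        by (rule measurable_compose[rotated]) (auto intro!: continuous_intros)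
      then show "(\<lambda>w. arctan (w q $ i) + 2) \<in> borel_measurable \<nu>" by measurable
      show "0 < arctan (w q $ i) + 2" for w
        using arctan_lbound[of "w q $ i"] pi_less_4 by linarith
      show "arctan (w q $ i) + 2 \<le> 4" for w
        using arctan_ubound[of "w q $ i"] pi_less_4 by linarith
    qed (use uniq in auto)
    then have "\<forall>i. \<exists>\<phi>. \<phi> \<in> borel_measurable \<mu> \<and> (AE w in \<nu>. arctan (w q $ i) + 2 = \<phi> (U w))" by blast
    from choice[OF this] obtain \<phi> where \<phi>: "\<And>i. \<phi> i \<in> borel_measurable \<mu>"
      "\<And>i. AE w in \<nu>. arctan (w q $ i) + 2 = \<phi> i (U w)" by auto
    have "AE w in \<nu>. \<forall>i\<in>UNIV. arctan (w q $ i) + 2 = \<phi> i (U w)"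
      using \<phi>(2) by (subst AE_ball_countable) auto
    then have "AE w in \<nu>. w q = (\<chi> i. tan (\<phi> i (U w) - 2))"
    proof eventually_elim
      case (elim w)
      have "tan (\<phi> i (U w) - 2) = w q $ i" for i
        using elim by (metis UNIV_I add_diff_cancel_right' tan_arctan)
      then show ?case by (simp add: vec_eq_iff)
    qed
    moreover have "(\<lambda>x. \<chi> i. tan (\<phi> i x - 2)) \<in> borel_measurable \<mu>"
    proof (rule borel_measurable_euclidean_space[THEN iffD2], rule ballI)
      fix b :: "real ^ 'n" assume "b \<in> Basis"
      then obtain i where "b = axis i 1" by (auto simp: Basis_vec_def)
      then show "(\<lambda>x. (\<chi> i. tan (\<phi> i x - 2)) \<bullet> b) \<in> borel_measurable \<mu>"
        using \<phi>(1)[of i] by (simp add: inner_axis tan_def)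
    qed
    ultimately show ?thesis by (intro bexI[of _ "\<lambda>x. \<chi> i. tan (\<phi> i x - 2)"])
  qed
  have pth: "w \<in> space \<nu> \<Longrightarrow> w \<in> paths" for w
    using sp sets_eq_imp_space_eq[OF \<mu>] by (auto simp: path_space_def space_restrict_space)
  obtain C where C: "C \<in> measurable \<mu> \<mu>" and CU: "AE w in \<nu>. C (U w) = w"
    using ex_measurable_path[of \<mu> \<nu> "\<lambda>w. w", OF \<mu> pth U\<nu> val] by auto
  have pull0: "U -` N \<inter> space \<nu> \<in> null_sets \<nu>" if N: "N \<in> null_sets \<mu>" for N
  proof -
    have "emeasure \<nu> (U -` N \<inter> space \<nu>) = emeasure (distr \<nu> \<mu> U) N"
      using N U\<nu> by (subst emeasure_distr) auto
    then show ?thesis using d N measurable_sets[OF U\<nu>, of N] by (auto simp: null_sets_def)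
  qed
  have Uac: "absolutely_continuous \<mu> (distr ?M \<mu> U)"
    unfolding absolutely_continuous_def
  proof
    fix N assume N: "N \<in> null_sets \<mu>"
    then have "U -` N \<inter> space ?M \<in> null_sets ?M" using null[OF pull0[OF N]] sp by simp
    then show "N \<in> null_sets (distr ?M \<mu> U)"
      using N U by (auto simp: null_sets_def emeasure_distr)
  qed
  have Cac: "absolutely_continuous \<mu> (distr ?M \<mu> C)"
    unfolding absolutely_continuous_def
  proof
    fix N assume N: "N \<in> null_sets \<mu>"
    have B: "C -` N \<inter> space \<mu> \<in> sets \<mu>" using measurable_sets[OF C] N by auto
    have "N \<in> null_sets \<nu>"
      using null_sets_completionI[OF N] ac unfolding absolutely_continuous_def by auto
    then have "AE w in \<nu>. w \<notin> N" by (rule AE_not_in)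
    then have "AE w in \<nu>. U w \<notin> C -` N \<inter> space \<mu>"
      using CU by eventually_elim auto
    moreover have "{x \<in> space \<mu>. x \<notin> C -` N \<inter> space \<mu>} = space \<mu> - (C -` N \<inter> space \<mu>)" by auto
    ultimately have "AE x in distr \<nu> \<mu> U. x \<notin> C -` N \<inter> space \<mu>"
      using sets.compl_sets[OF B] by (subst AE_distr_iff[OF U\<nu>]) simp_all
    then have "AE x in \<mu>. x \<notin> C -` N \<inter> space \<mu>" unfolding d .
    then have "C -` N \<inter> space \<mu> \<in> null_sets \<mu>" using AE_iff_null_sets[OF B] by simp
    then show "N \<in> null_sets (distr ?M \<mu> C)"
      using N C by (auto simp: distr_completion null_sets_def emeasure_distr)
  qed
  have U2: "U \<in> measurable ?M ?M"
    using completion.measurable_completion2[OF U] Uac unfolding absolutely_continuous_def by auto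
  have C2: "C \<in> measurable ?M ?M"
    using completion.measurable_completion2[OF measurable_completion[OF C]] Cac
    unfolding absolutely_continuous_def by auto
  have "AE x in \<mu>. U (C x) = x"
  proof -
    let ?R = "\<rat> \<inter> {0..1} :: real set"
    \<comment> \<open>\<open>S\<close> lies in the completion only, so the image measure of \<open>\<nu>\<close> is applied to its Borel part\<close>
    define S where "S = {x \<in> space ?M. \<exists>q\<in>?R. U (C x) q \<noteq> x q}"
    have S: "S \<in> sets ?M"
    proof -
      have "{x \<in> space ?M. U (C x) q \<noteq> x q} \<in> sets ?M" if "q \<in> ?R" for q
      proof -
        have "(\<lambda>x. U (C x) q - x q) \<in> borel_measurable ?M"
          using that by (intro borel_measurable_diff measurable_compose[OF C2 measurable_compose[OF U coord]]
              measurable_completion[OF coord]) auto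
        then have "(\<lambda>x. U (C x) q - x q) -` (UNIV - {0}) \<inter> space ?M \<in> sets ?M" by (rule measurable_sets) simp
        moreover have "(\<lambda>x. U (C x) q - x q) -` (UNIV - {0}) \<inter> space ?M = {x \<in> space ?M. U (C x) q \<noteq> x q}" by auto
        ultimately show ?thesis by simp
      qed
      moreover have "S = (\<Union>q\<in>?R. {x \<in> space ?M. U (C x) q \<noteq> x q})" unfolding S_def by auto
      ultimately show ?thesis
        using countable_rat by (auto intro!: sets.countable_UN'')
    qed
    have "AE w in \<nu>. U w \<notin> S"
      using CU by eventually_elim (auto simp: S_def)
    then have "AE w in \<nu>. U w \<notin> main_part \<mu> S"
      by eventually_elim (use main_part_null_part_Un[OF S] in blast)
    moreover have "{x \<in> space \<mu>. x \<notin> main_part \<mu> S} = space \<mu> - main_part \<mu> S" by auto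
    ultimately have "AE x in distr \<nu> \<mu> U. x \<notin> main_part \<mu> S"
      using sets.compl_sets[OF main_part_sets[OF S]] by (subst AE_distr_iff[OF U\<nu>]) simp_all
    then have "main_part \<mu> S \<in> null_sets \<mu>"
      unfolding d using AE_iff_null_sets[OF main_part_sets[OF S]] by simp
    then have "S \<in> null_sets ?M"
      using S by (auto simp: null_sets_def)
    then have "AE x in ?M. x \<notin> S" by (rule AE_not_in)
    then have "AE x in \<mu>. x \<notin> S" using AE_completion_iff by blast
    then show ?thesis
      using AE_space
    proof eventually_elim
      case (elim x)
      have eq: "U (C x) q = x q" if "q \<in> ?R" for q using elim that by (auto simp: S_def)
      have p: "x \<in> paths" "U (C x) \<in> paths"
        using elim(2) measurable_space[OF C] measurable_space[OF U] pth sp by auto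
      show ?case by (rule paths_eqI[OF p(2,1) eq])
    qed
  qed
  then have "right_inverse \<mu> U C"
    using U C Cac unfolding right_inverse_def by (auto intro: measurable_completion)
  moreover have "right_inverse \<mu> C U"
    using U C Uac AEM[OF CU] unfolding right_inverse_def by (auto intro: measurable_completion)
  ultimately show ?thesis unfolding as_invertible_def by blast
qed

section \<open>Independence of increments and filtration\<close>

lemma ex_strict_mono_enumeration:
  fixes S :: "'a :: linorder set"
  assumes "finite S" "S \<noteq> {}"
  obtains m :: nat and \<sigma> where "strict_mono_on {..m} \<sigma>" "\<sigma> ` {..m} = S" "\<sigma> 0 = Min S" "\<sigma> m = Max S"
proof -
  define xs where "xs = sorted_list_of_set S"
  have xs: "sorted_wrt (<) xs" "set xs = S" "xs \<noteq> []"
    using assms by (simp_all add: xs_def)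
  define m where "m = length xs - 1"
  have len: "length xs = Suc m" using xs(3) by (simp add: m_def)
  define h where "h = (\<lambda>i. xs ! i)"
  have sm: "strict_mono_on {..m} h"
    using xs(1) len by (auto intro!: strict_mono_onI simp: h_def sorted_wrt_iff_nth_less)
  have im: "h ` {..m} = S"
    using xs(2) len by (auto simp: h_def set_conv_nth less_Suc_eq_le)
  have le: "h i \<le> h j" if "i \<le> j" "j \<le> m" for i j
    using strict_mono_on_leD[OF sm] that by auto
  have "h 0 = Min S"
    using im assms le by (intro Min_eqI[symmetric]) auto
  moreover have "h m = Max S"
    using im assms le by (intro Max_eqI[symmetric]) auto
  ultimately show ?thesis using that sm im by blast
qed

context classical_wiener
begin

abbreviation M where "M \<equiv> completion \<mu>"
abbreviation F where "F \<equiv> wiener_filtration \<mu>"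

lemma space_wiener: "space \<mu> = paths"
  using sets_eq_imp_space_eq[OF sets_wiener]
  by (auto simp: path_space_def space_restrict_space space_PiM paths_def PiE_def)

lemma coordinate_measurable: "t \<in> {0..1} \<Longrightarrow> (\<lambda>w. w t) \<in> borel_measurable \<mu>"
  unfolding measurable_cong_sets[OF sets_wiener refl] path_space_def
  by (intro measurable_restrict_space1 measurable_component_singleton)

lemma increment_measurable:
  "s \<in> {0..1} \<Longrightarrow> t \<in> {0..1} \<Longrightarrow> (\<lambda>w. w t - w s) \<in> borel_measurable M"
  using coordinate_measurable by (intro borel_measurable_diff measurable_completion)

lemma filtration_generator:
  assumes "t \<le> 1"
  shows "{(\<lambda>w. w s) -` B \<inter> space \<mu> |s B. s \<in> {0..t} \<and> B \<in> sets borel} \<union>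
      null_sets M \<subseteq> sets M"
proof -
  have "(\<lambda>w. w s) -` B \<inter> space \<mu> \<in> sets \<mu>" if "s \<in> {0..t}" "B \<in> sets borel" for s B
    using that assms coordinate_measurable[of s] by (intro measurable_sets) auto
  then show ?thesis by auto
qed

lemma space_filtration: "space (F t) = space \<mu>"
  by (simp add: wiener_filtration_def space_measure_of_conv)

lemma sets_filtration:
  "t \<le> 1 \<Longrightarrow> sets (F t) = sigma_sets (space \<mu>) ({(\<lambda>w. w s) -` B \<inter> space \<mu> |s B. s \<in> {0..t} \<and> B \<in> sets borel} \<union>
      null_sets M)"
  unfolding wiener_filtration_def
  using subset_trans[OF filtration_generator[of t] sets.space_closed[of M]] by (intro sets_measure_of) simp

lemma filtration_le_completion: "t \<le> 1 \<Longrightarrow> sets (F t) \<subseteq> sets M"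
  unfolding sets_filtration using sets.sigma_sets_subset[OF filtration_generator, of t] by simp

lemma filtration_mono: "s \<le> t \<Longrightarrow> t \<le> 1 \<Longrightarrow> sets (F s) \<subseteq> sets (F t)"
  by (subst (1 2) sets_filtration) (auto intro!: sigma_sets_mono', fastforce)

lemma measurable_filtration_mono:
  "s \<le> t \<Longrightarrow> t \<le> 1 \<Longrightarrow> f \<in> measurable (F s) N \<Longrightarrow> f \<in> measurable (F t) N"
  using filtration_mono[of s t] by (auto simp: measurable_def space_filtration)

lemma measurable_filtration_completion:
  "t \<le> 1 \<Longrightarrow> f \<in> measurable (F t) N \<Longrightarrow> f \<in> measurable M N"
  using filtration_le_completion[of t] by (auto simp: measurable_def space_filtration)

lemma coordinate_adapted:
  assumes "0 \<le> s" "s \<le> t" "t \<le> 1"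
  shows "(\<lambda>w. w s) \<in> borel_measurable (F t)"
proof (rule measurableI)
  fix B :: "(real ^ 'n) set" assume "B \<in> sets borel"
  then show "(\<lambda>w. w s) -` B \<inter> space (F t) \<in> sets (F t)"
    unfolding space_filtration sets_filtration[OF assms(3)] using assms
    by (intro sigma_sets.Basic UnI1) auto
qed simp

lemma cylinder_measurable:
  assumes "finite J" "J \<subseteq> {0..1}" "\<And>r. B r \<in> sets borel"
  shows "{w \<in> space \<mu>. \<forall>r\<in>J. w r \<in> B r} \<in> sets \<mu>"
proof (rule sets.sets_Collect_finite_All[OF _ assms(1)])
  fix r assume "r \<in> J"
  then have "(\<lambda>w. w r) -` B r \<inter> space \<mu> \<in> sets \<mu>"
    using assms by (intro measurable_sets[OF coordinate_measurable]) auto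
  then show "{w \<in> space \<mu>. w r \<in> B r} \<in> sets \<mu>" by (simp add: vimage_def Collect_conj_eq Int_commute)
qed

text \<open>
  Refine the times of the cylinder to a grid from 0 to \<open>s\<close> and append \<open>t\<close>. As paths start at 0 almost
  surely, the values up to time \<open>s\<close> are sums of the first grid increments, and these are independent of
  the last one, which is the increment from \<open>s\<close> to \<open>t\<close>.
\<close>

lemma cylinder_indep_increment:
  assumes J: "finite J" "J \<subseteq> {0..s}" and B: "\<And>r. B r \<in> sets borel" and D: "D \<in> sets borel"
    and st: "0 \<le> s" "s < t" "t \<le> 1"
  shows "prob ({w \<in> space \<mu>. \<forall>r\<in>J. w r \<in> B r} \<inter> {w \<in> space \<mu>. w t - w s \<in> D}) =
    prob {w \<in> space \<mu>. \<forall>r\<in>J. w r \<in> B r} * prob {w \<in> space \<mu>. w t - w s \<in> D}"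
proof -
  let ?S = "insert 0 (insert s J)"
  obtain m :: nat and \<sigma> where \<sigma>: "strict_mono_on {..m} \<sigma>" "\<sigma> ` {..m} = ?S"
    and "\<sigma> 0 = Min ?S" and "\<sigma> m = Max ?S"
    by (rule ex_strict_mono_enumeration[of ?S]) (use J in auto)
  moreover have "Min ?S = 0" using J st by (intro Min_eqI) auto
  moreover have "Max ?S = s" using J st by (intro Max_eqI) auto
  ultimately have \<sigma>0: "\<sigma> 0 = 0" and \<sigma>m: "\<sigma> m = s" by simp_all
  define \<tau> where "\<tau> = \<sigma>(Suc m := t)"
  have \<sigma>le: "\<sigma> i \<le> s" if "i \<le> m" for i
    using strict_mono_on_leD[OF \<sigma>(1), of i m] that \<sigma>m by auto
  have \<tau>mono: "strict_mono_on {..Suc m} \<tau>"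
  proof (rule strict_mono_onI)
    fix i j assume ij: "i \<in> {..Suc m}" "j \<in> {..Suc m}" "i < j"
    then show "\<tau> i < \<tau> j"
      using strict_mono_onD[OF \<sigma>(1), of i j] \<sigma>le[of i] st by (cases "j = Suc m") (auto simp: \<tau>_def)
  qed
  have \<tau>im: "\<tau> ` {..Suc m} \<subseteq> {0..1}"
  proof (rule image_subsetI)
    fix i assume i: "i \<in> {..Suc m}"
    show "\<tau> i \<in> {0..1}"
    proof (cases "i = Suc m")
      case False
      then have "\<sigma> i \<in> ?S" using i unfolding \<sigma>(2)[symmetric] by auto
      then show ?thesis using False J st by (auto simp: \<tau>_def)
    qed (use st in \<open>simp add: \<tau>_def\<close>)
  qed
  define X where "X i w = w (\<tau> (Suc i)) - w (\<tau> i)" for i and w :: "real \<Rightarrow> real ^ 'n"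
  have ind: "indep_vars (\<lambda>_. borel) X {..<Suc m}"
    unfolding X_def using indep_increments[OF \<tau>mono \<tau>im] by simp
  have iv: "indep_var (PiM {..<m} (\<lambda>_. borel)) (\<lambda>w. restrict (\<lambda>i. X i w) {..<m})
     (PiM {m} (\<lambda>_. borel)) (\<lambda>w. restrict (\<lambda>i. X i w) {m})"
    by (rule indep_var_restrict[OF ind]) auto
  have "\<forall>r\<in>J. \<exists>i\<le>m. \<sigma> i = r" using \<sigma>(2) by (metis atMost_iff image_iff insertCI)
  then obtain i where i: "\<And>r. r \<in> J \<Longrightarrow> i r \<le> m" "\<And>r. r \<in> J \<Longrightarrow> \<sigma> (i r) = r" by metis
  define E where "E = {x \<in> space (PiM {..<m} (\<lambda>_. borel :: (real ^ 'n) measure)). \<forall>r\<in>J. (\<Sum>j<i r. x j) \<in> B r}"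
  have "(\<lambda>x. \<Sum>j<i r. x j) \<in> borel_measurable (PiM {..<m} (\<lambda>_. borel :: (real ^ 'n) measure))" if "r \<in> J" for r
    using i(1)[OF that] by (intro borel_measurable_sum measurable_component_singleton) auto
  then have E: "E \<in> sets (PiM {..<m} (\<lambda>_. borel))"
    unfolding E_def using B by (intro sets.sets_Collect_finite_All[OF _ J(1)]) (measurable, auto)
  define E' where "E' = {x \<in> space (PiM {m} (\<lambda>_. borel :: (real ^ 'n) measure)). x m \<in> D}"
  have E': "E' \<in> sets (PiM {m} (\<lambda>_. borel))"
    unfolding E'_def using D by measurable
  have sum: "w r = (\<Sum>j<i r. X j w)" if "r \<in> J" "w 0 = 0" for r w
  proof -
    have "(\<Sum>j<i r. X j w) = (\<Sum>j<i r. w (\<sigma> (Suc j)) - w (\<sigma> j))"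
      using i(1)[OF that(1)] by (intro sum.cong) (auto simp: X_def \<tau>_def)
    also have "\<dots> = w (\<sigma> (i r)) - w (\<sigma> 0)" by (rule sum_lessThan_telescope)
    finally show ?thesis using i(2)[OF that(1)] that(2) \<sigma>0 by simp
  qed
  have Xm: "X m w = w t - w s" for w using \<sigma>m by (simp add: X_def \<tau>_def)
  let ?A = "{w \<in> space \<mu>. \<forall>r\<in>J. w r \<in> B r}" and ?C = "{w \<in> space \<mu>. w t - w s \<in> D}"
  let ?f = "\<lambda>w. restrict (\<lambda>i. X i w) {..<m}" and ?g = "\<lambda>w. restrict (\<lambda>i. X i w) {m}"
  have A: "?A \<in> events" using J st B by (intro cylinder_measurable) auto
  have C: "?C \<in> events"
  proof -
    have "(\<lambda>w. w t - w s) -` D \<inter> space \<mu> \<in> events"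
      using st by (intro measurable_sets[OF borel_measurable_diff D] coordinate_measurable) auto
    then show ?thesis by (simp add: vimage_def Collect_conj_eq Int_commute)
  qed
  have f: "?f \<in> measurable \<mu> (PiM {..<m} (\<lambda>_. borel))" and g: "?g \<in> measurable \<mu> (PiM {m} (\<lambda>_. borel))"
    using indep_var_rv1[OF iv] indep_var_rv2[OF iv] by auto
  have Eset: "?f -` E \<inter> space \<mu> \<in> events" using f E by (rule measurable_sets)
  have e1: "AE w in \<mu>. w \<in> ?A \<longleftrightarrow> w \<in> ?f -` E \<inter> space \<mu>"
    using AE_start
  proof eventually_elim
    case (elim w)
    have "(\<Sum>j<i r. ?f w j) = w r" if "r \<in> J" for r
      using i(1)[OF that] sum[of r w, OF that elim] by (auto intro!: sum.cong)
    then show ?case by (auto simp: E_def space_PiM)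
  qed
  have e2: "?C = ?g -` E' \<inter> space \<mu>"
    by (auto simp: E'_def space_PiM Xm)
  have "prob (?A \<inter> ?C) = prob ((?f -` E \<inter> space \<mu>) \<inter> ?C)"
    using e1 A C Eset by (intro finite_measure_eq_AE) auto
  also have "(?f -` E \<inter> space \<mu>) \<inter> ?C = (\<lambda>w. (?f w, ?g w)) -` (E \<times> E') \<inter> space \<mu>"
    unfolding e2 by auto
  also have "prob \<dots> = prob (?f -` E \<inter> space \<mu>) * prob (?g -` E' \<inter> space \<mu>)"
    by (rule indep_varD[OF iv E E'])
  also have "prob (?f -` E \<inter> space \<mu>) = prob ?A"
    using e1 A Eset by (intro finite_measure_eq_AE) auto
  finally show ?thesis unfolding e2 .
qed

lemma prob_space_M: "prob_space M"
  by (rule prob_space_completion)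

text \<open>
  The finite-dimensional cylinders up to time \<open>s\<close> together with the null sets are stable under
  intersections and generate the completed \<open>\<sigma>\<close>-algebra at time \<open>s\<close>, so independence has to be checked
  on these sets only.
\<close>

lemma increment_indep_filtration:
  assumes st: "0 \<le> s" "s < t" "t \<le> 1"
    and AB: "A \<in> sets (F s)" "B \<in> sets borel"
  shows "measure M (A \<inter> {w \<in> space \<mu>. w t - w s \<in> B}) = measure M A * measure M {w \<in> space \<mu>. w t - w s \<in> B}"
proof -
  interpret M: prob_space M by (rule prob_space_M)
  let ?D = "\<lambda>w. w t - w s"
  let ?G = "{{w \<in> space \<mu>. \<forall>r\<in>J. w r \<in> B r} |J B. finite J \<and> J \<subseteq> {0..s} \<and> (\<forall>r. B r \<in> sets borel)} \<union> null_sets M"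
  let ?H = "{?D -` A \<inter> space M |A. A \<in> sets borel}"
  have D: "?D \<in> borel_measurable M" using st by (intro increment_measurable) auto
  have Dev: "{w \<in> space \<mu>. w t - w s \<in> A} \<in> sets \<mu>" if "A \<in> sets borel" for A
  proof -
    have "(\<lambda>w. w t - w s) -` A \<inter> space \<mu> \<in> events"
      using st by (intro measurable_sets[OF borel_measurable_diff that] coordinate_measurable) auto
    then show ?thesis by (simp add: vimage_def Collect_conj_eq Int_commute)
  qed
  have Heq: "?D -` A \<inter> space M = {w \<in> space \<mu>. w t - w s \<in> A}" for A by auto
  have Gev: "?G \<subseteq> M.events"
  proof (rule Un_least)
    show "{{w \<in> space \<mu>. \<forall>r\<in>J. w r \<in> B r} |J B. finite J \<and> J \<subseteq> {0..s} \<and> (\<forall>r. B r \<in> sets borel)} \<subseteq> M.events"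
    proof clarify
      fix J and B :: "real \<Rightarrow> (real ^ 'n) set"
      assume "finite J" "J \<subseteq> {0..s}" "\<forall>r. B r \<in> sets borel"
      then show "{w \<in> space \<mu>. \<forall>r\<in>J. w r \<in> B r} \<in> M.events"
        using st by (intro sets_completionI_sets cylinder_measurable) auto
    qed
  qed auto
  have "M.indep_set ?G ?H"
  proof (rule M.indep_setI[OF Gev])
    show "?H \<subseteq> M.events" using Dev unfolding Heq by auto
    fix a b assume a: "a \<in> ?G" and b: "b \<in> ?H"
    then obtain A where A: "A \<in> sets borel" "b = {w \<in> space \<mu>. w t - w s \<in> A}" unfolding Heq by auto
    show "M.prob (a \<inter> b) = M.prob a * M.prob b"
    proof (cases "a \<in> null_sets M")
      case True
      then have "a \<inter> b \<in> null_sets M" by (rule null_sets_completion_subset[rotated]) auto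
      then show ?thesis using True by (simp add: measure_eq_0_null_sets)
    next
      case False
      then obtain J B where J: "a = {w \<in> space \<mu>. \<forall>r\<in>J. w r \<in> B r}" "finite J" "J \<subseteq> {0..s}"
        "\<And>r. B r \<in> sets borel" using a by auto
      have "a \<in> sets \<mu>" "b \<in> sets \<mu>"
        using J A st Dev by (auto intro!: cylinder_measurable)
      then show ?thesis
        using cylinder_indep_increment[OF J(2,3,4) A(1) st] J A by (simp add: measure_completion)
    qed
  qed
  moreover have "Int_stable ?G"
  proof (rule Int_stableI)
    fix a b assume a: "a \<in> ?G" and b: "b \<in> ?G"
    show "a \<inter> b \<in> ?G"
    proof (cases "a \<in> null_sets M \<or> b \<in> null_sets M")
      case True
      then have "a \<inter> b \<in> null_sets M" 
        using null_sets_completion_subset[of "a \<inter> b" a] null_sets_completion_subset[of "a \<inter> b" b] by auto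
      then show ?thesis by auto
    next
      case False
      then obtain J B J' B' where J: "a = {w \<in> space \<mu>. \<forall>r\<in>J. w r \<in> B r}" "finite J" "J \<subseteq> {0..s}"
        "\<And>r. B r \<in> sets borel" and J': "b = {w \<in> space \<mu>. \<forall>r\<in>J'. w r \<in> B' r}" "finite J'" "J' \<subseteq> {0..s}"
        "\<And>r. B' r \<in> sets borel" using a b by auto
      let ?B = "\<lambda>r. (if r \<in> J then B r else UNIV) \<inter> (if r \<in> J' then B' r else UNIV)"
      have "a \<inter> b = {w \<in> space \<mu>. \<forall>r\<in>J \<union> J'. w r \<in> ?B r}" using J(1) J'(1) by auto
      moreover have "\<forall>r. ?B r \<in> sets borel" using J(4) J'(4) by auto
      moreover have "finite (J \<union> J')" "J \<union> J' \<subseteq> {0..s}" using J J' by auto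
      ultimately show ?thesis
        by (intro UnI1 CollectI exI[of _ "J \<union> J'"] exI[of _ ?B] conjI)
    qed
  qed
  moreover have "Int_stable ?H"
  proof (rule Int_stableI)
    fix a b assume "a \<in> ?H" "b \<in> ?H"
    then obtain A A' where "a = ?D -` A \<inter> space M" "b = ?D -` A' \<inter> space M" "A \<in> sets borel" "A' \<in> sets borel" by auto
    then show "a \<inter> b \<in> ?H" by (intro CollectI exI[of _ "A \<inter> A'"]) auto
  qed
  ultimately have ind: "M.indep_set (sigma_sets (space M) ?G) (sigma_sets (space M) ?H)"
    by (rule M.indep_set_sigma_sets)
  have sub: "sets (F s) \<subseteq> sigma_sets (space M) ?G"
  proof -
    have s1: "s \<le> 1" using st by simp
    have "{(\<lambda>w. w r) -` B \<inter> space \<mu> |r B. r \<in> {0..s} \<and> B \<in> sets borel} \<subseteq> ?G"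
    proof
      fix A assume "A \<in> {(\<lambda>w. w r) -` B \<inter> space \<mu> |r B. r \<in> {0..s} \<and> B \<in> sets borel}"
      then obtain r B where "A = (\<lambda>w. w r) -` B \<inter> space \<mu>" "r \<in> {0..s}" "B \<in> sets borel" by auto
      then show "A \<in> ?G"
        by (intro UnI1 CollectI exI[of _ "{r}"] exI[of _ "\<lambda>_. B"]) auto
    qed
    then show ?thesis unfolding sets_filtration[OF s1] space_completion
      by (rule sigma_sets_mono'[OF Un_least[OF _ Un_upper2]])
  qed
  show ?thesis
    using AB sub by (intro M.indep_setD[OF ind]) (auto simp flip: Heq)
qed

text \<open>
  By independence, an increment after time \<open>s\<close> can be integrated out against its Gaussian density
  while everything known at time \<open>s\<close> is kept fixed.
\<close>

lemma nn_integral_increment: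
  assumes st: "0 \<le> s" "s < t" "t \<le> 1"
    and H: "H \<in> borel_measurable (F s \<Otimes>\<^sub>M borel)"
  shows "(\<integral>\<^sup>+w. H (w, w t - w s) \<partial>M) = (\<integral>\<^sup>+w. (\<integral>\<^sup>+x. ennreal (\<Prod>i\<in>UNIV. normal_density 0 (sqrt (t - s)) (x $ i)) * H (w, x) \<partial>lborel) \<partial>M)"
proof -
  interpret M: prob_space M by (rule prob_space_M)
  let ?D = "\<lambda>w. w t - w s"
  let ?d = "\<lambda>x :: real ^ 'n. ennreal (\<Prod>i\<in>UNIV. normal_density 0 (sqrt (t - s)) (x $ i))"
  have s1: "s \<le> 1" using st by simp
  have rv: "(\<lambda>w. w) \<in> measurable M (F s)" "?D \<in> measurable M borel"
    using measurable_filtration_completion[OF s1 measurable_ident_sets[OF refl]] st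
    by (auto intro: increment_measurable)
  interpret P1: prob_space "distr M (F s) (\<lambda>w. w)" by (rule M.prob_space_distr[OF rv(1)])
  interpret D: prob_space "distr M borel ?D" by (rule M.prob_space_distr[OF rv(2)])
  have joint: "distr M (F s) (\<lambda>w. w) \<Otimes>\<^sub>M distr M borel ?D = distr M (F s \<Otimes>\<^sub>M borel) (\<lambda>w. (w, ?D w))"
  proof (rule pair_measure_eqI)
    fix A B assume "A \<in> sets (distr M (F s) (\<lambda>w. w))" "B \<in> sets (distr M borel ?D)"
    then have A: "A \<in> sets (F s)" and B: "B \<in> sets borel" by simp_all
    have "A \<subseteq> space \<mu>" using sets.sets_into_space[OF A] by (simp add: space_filtration)
    then have "(\<lambda>w. (w, ?D w)) -` (A \<times> B) \<inter> space M = A \<inter> {w \<in> space \<mu>. w t - w s \<in> B}"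
      "(\<lambda>w. w) -` A \<inter> space M = A" "?D -` B \<inter> space M = {w \<in> space \<mu>. w t - w s \<in> B}" by auto
    then show "emeasure (distr M (F s) (\<lambda>w. w)) A * emeasure (distr M borel ?D) B =
        emeasure (distr M (F s \<Otimes>\<^sub>M borel) (\<lambda>w. (w, ?D w))) (A \<times> B)"
      using A B rv increment_indep_filtration[OF st A B]
      by (simp add: emeasure_distr M.emeasure_eq_measure ennreal_mult)
  qed (auto intro: P1.sigma_finite_measure_axioms D.sigma_finite_measure_axioms)
  have "distributed \<mu> lborel ?D ?d" using distributed_increment[OF st] .
  then have dD: "distr \<mu> lborel ?D = density lborel ?d" and dm: "?d \<in> borel_measurable lborel"
    and Dm: "?D \<in> measurable \<mu> lborel"
    unfolding distributed_def by auto
  have dD: "distr M borel ?D = density lborel ?d"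
  proof -
    have "distr M borel ?D = distr \<mu> borel ?D"
      using Dm by (intro distr_completion) simp
    also have "\<dots> = distr \<mu> lborel ?D" by (intro distr_cong) auto
    finally show ?thesis using dD by simp
  qed
  have Hx: "(\<lambda>x. H (w, x)) \<in> borel_measurable borel" if "w \<in> space \<mu>" for w
    using measurable_Pair2[OF H, of w] that by (simp add: space_filtration)
  have H': "H \<in> borel_measurable (distr M (F s) (\<lambda>w. w) \<Otimes>\<^sub>M distr M borel ?D)"
    using H by simp
  have "(\<integral>\<^sup>+w. H (w, ?D w) \<partial>M) = (\<integral>\<^sup>+z. H z \<partial>distr M (F s \<Otimes>\<^sub>M borel) (\<lambda>w. (w, ?D w)))"
    using rv H by (subst nn_integral_distr) auto
  also have "\<dots> = (\<integral>\<^sup>+w. \<integral>\<^sup>+x. H (w, x) \<partial>distr M borel ?D \<partial>distr M (F s) (\<lambda>w. w))"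
    unfolding joint[symmetric] by (rule D.nn_integral_fst[OF H', symmetric])
  also have "\<dots> = (\<integral>\<^sup>+w. \<integral>\<^sup>+x. H (w, x) \<partial>distr M borel ?D \<partial>M)"
    using rv(1) D.borel_measurable_nn_integral_fst[OF H'] by (subst nn_integral_distr) auto
  also have "\<dots> = (\<integral>\<^sup>+w. (\<integral>\<^sup>+x. ?d x * H (w, x) \<partial>lborel) \<partial>M)"
    unfolding dD using Hx dm by (intro nn_integral_cong nn_integral_density) auto
  finally show ?thesis .
qed

end

section \<open>Change of drift on a grid\<close>

text \<open>
  Complete the square in each coordinate.
\<close>

lemma gaussian_density_shift:
  fixes a x :: "real ^ 'n"
  assumes "0 < d"
  shows "exp (- (a \<bullet> x) - (norm a)\<^sup>2 * d / 2) * (\<Prod>i\<in>UNIV. normal_density 0 (sqrt d) (x $ i))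
    = (\<Prod>i\<in>UNIV. normal_density 0 (sqrt d) ((x + d *\<^sub>R a) $ i))"
proof -
  have "- (a \<bullet> x) - (norm a)\<^sup>2 * d / 2 = (\<Sum>i\<in>UNIV. - (a $ i * x $ i) - (a $ i)\<^sup>2 * d / 2)"
    unfolding inner_vec_def power2_norm_eq_inner
    by (simp add: sum_subtractf sum_negf sum_distrib_right sum_divide_distrib power2_eq_square)
  then have "exp (- (a \<bullet> x) - (norm a)\<^sup>2 * d / 2) = (\<Prod>i\<in>UNIV. exp (- (a $ i * x $ i) - (a $ i)\<^sup>2 * d / 2))"
    by (simp add: exp_sum)
  moreover have "exp (- (a $ i * x $ i) - (a $ i)\<^sup>2 * d / 2) * normal_density 0 (sqrt d) (x $ i) =
     normal_density 0 (sqrt d) ((x + d *\<^sub>R a) $ i)" for i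
  proof -
    have "- (a $ i * x $ i) - (a $ i)\<^sup>2 * d / 2 + - (x $ i)\<^sup>2 / (2 * d) = - (x $ i + d * a $ i)\<^sup>2 / (2 * d)"
      using assms by (simp add: field_simps power2_eq_square)
    then show ?thesis
      using assms by (simp add: normal_density_def exp_add[symmetric])
  qed
  ultimately show ?thesis by (simp add: prod.distrib[symmetric])
qed

lemma nn_integral_lborel_shift:
  fixes f :: "'b :: euclidean_space \<Rightarrow> ennreal"
  assumes "f \<in> borel_measurable borel"
  shows "(\<integral>\<^sup>+x. f (x + c) \<partial>lborel) = (\<integral>\<^sup>+x. f x \<partial>lborel)"
  using assms by (subst (2) lborel_distr_plus[of c, symmetric], subst nn_integral_distr) (auto simp: add.commute)

lemma first_values_Suc: "(\<lambda>j::nat. if j < Suc m then f j else 0) = (\<lambda>j. if j < m then f j else 0)(m := f m)"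
  by (auto simp: less_Suc_eq)

context classical_wiener
begin

text \<open>
  The exponential factor moves the centre of the Gaussian density by the drift \<open>(t - s) a\<close>, and
  translation invariance of Lebesgue measure moves it back.
\<close>

lemma one_step_girsanov:
  assumes st: "0 \<le> s" "s < t" "t \<le> 1" and a: "a \<in> borel_measurable (F s)"
    and H: "H \<in> borel_measurable (F s \<Otimes>\<^sub>M borel)"
  shows "(\<integral>\<^sup>+w. ennreal (exp (- (a w \<bullet> (w t - w s)) - (norm (a w))\<^sup>2 * (t - s) / 2)) *
      H (w, (w t - w s) + (t - s) *\<^sub>R a w) \<partial>M) = (\<integral>\<^sup>+w. H (w, w t - w s) \<partial>M)"
proof -
  let ?d = "\<lambda>x :: real ^ 'n. ennreal (\<Prod>i\<in>UNIV. normal_density 0 (sqrt (t - s)) (x $ i))"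
  let ?K = "\<lambda>(w, x). ennreal (exp (- (a w \<bullet> x) - (norm (a w))\<^sup>2 * (t - s) / 2)) * H (w, x + (t - s) *\<^sub>R a w)"
  note [measurable] = a H
  have K: "?K \<in> borel_measurable (F s \<Otimes>\<^sub>M borel)" by measurable
  have "(\<integral>\<^sup>+w. ennreal (exp (- (a w \<bullet> (w t - w s)) - (norm (a w))\<^sup>2 * (t - s) / 2)) *
      H (w, (w t - w s) + (t - s) *\<^sub>R a w) \<partial>M) = (\<integral>\<^sup>+w. ?K (w, w t - w s) \<partial>M)" by simp
  also have "\<dots> = (\<integral>\<^sup>+w. (\<integral>\<^sup>+x. ?d x * ?K (w, x) \<partial>lborel) \<partial>M)"
    by (rule nn_integral_increment[OF st K])
  also have "\<dots> = (\<integral>\<^sup>+w. (\<integral>\<^sup>+x. ?d x * H (w, x) \<partial>lborel) \<partial>M)"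
  proof (rule nn_integral_cong)
    fix w assume w: "w \<in> space M"
    have [measurable]: "(\<lambda>x. H (w, x)) \<in> borel_measurable borel"
      using measurable_Pair2[OF H, of w] w by (simp add: space_filtration)
    have "?d x * ?K (w, x) = ?d (x + (t - s) *\<^sub>R a w) * H (w, x + (t - s) *\<^sub>R a w)" for x
    proof -
      have "?d (x + (t - s) *\<^sub>R a w) = ennreal (exp (- (a w \<bullet> x) - (norm (a w))\<^sup>2 * (t - s) / 2)) * ?d x"
        using st by (subst gaussian_density_shift[symmetric]) (auto simp: ennreal_mult prod_nonneg)
      then show ?thesis by (simp add: mult_ac)
    qed
    then have "(\<integral>\<^sup>+x. ?d x * ?K (w, x) \<partial>lborel) = (\<integral>\<^sup>+x. ?d (x + (t - s) *\<^sub>R a w) * H (w, x + (t - s) *\<^sub>R a w) \<partial>lborel)"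
      by simp
    also have "\<dots> = (\<integral>\<^sup>+x. ?d x * H (w, x) \<partial>lborel)"
      by (rule nn_integral_lborel_shift[of "\<lambda>x. ?d x * H (w, x)"]) measurable
    finally show "(\<integral>\<^sup>+x. ?d x * ?K (w, x) \<partial>lborel) = (\<integral>\<^sup>+x. ?d x * H (w, x) \<partial>lborel)" .
  qed
  also have "\<dots> = (\<integral>\<^sup>+w. H (w, w t - w s) \<partial>M)"
    by (rule nn_integral_increment[OF st H, symmetric])
  finally show ?thesis .
qed


text \<open>
  Induction on the number of steps: \<open>one_step_girsanov\<close> removes the last drift, then the last increment
  is integrated out, which leaves a function \<open>\<Psi>\<close> of the earlier ones. The statement is for all
  nonnegative functions \<open>\<Phi>\<close> of the increments because \<open>\<Psi>\<close> is not of product form even if \<open>\<Phi>\<close> is.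
  Increments are collected in sequences that are continued by 0, so that grids of all sizes
  share one product space.
\<close>

lemma grid_girsanov:
  fixes a :: "nat \<Rightarrow> (real \<Rightarrow> real ^ 'n) \<Rightarrow> real ^ 'n"
    and \<Phi> :: "(nat \<Rightarrow> real ^ 'n) \<Rightarrow> ennreal"
  assumes "strict_mono_on {..m} \<sigma>" "\<sigma> ` {..m} \<subseteq> {0..1}"
    and "\<And>j. j < m \<Longrightarrow> a j \<in> borel_measurable (F (\<sigma> j))"
    and "\<Phi> \<in> borel_measurable (PiM UNIV (\<lambda>_. borel))"
  shows "(\<integral>\<^sup>+w. ennreal (exp (- (\<Sum>j<m. a j w \<bullet> (w (\<sigma> (Suc j)) - w (\<sigma> j)))
        - (\<Sum>j<m. (norm (a j w))\<^sup>2 * (\<sigma> (Suc j) - \<sigma> j)) / 2)) *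
      \<Phi> (\<lambda>j. if j < m then (w (\<sigma> (Suc j)) - w (\<sigma> j)) + (\<sigma> (Suc j) - \<sigma> j) *\<^sub>R a j w else 0) \<partial>M)
    = (\<integral>\<^sup>+w. \<Phi> (\<lambda>j. if j < m then w (\<sigma> (Suc j)) - w (\<sigma> j) else 0) \<partial>M)"
  using assms
proof (induction m arbitrary: \<Phi>)
  case (Suc m)
  define D where "D j w = w (\<sigma> (Suc j)) - w (\<sigma> j)" for j and w :: "real \<Rightarrow> real ^ 'n"
  define \<delta> where "\<delta> j = \<sigma> (Suc j) - \<sigma> j" for j
  define R where "R m w = exp (- (\<Sum>j<m. a j w \<bullet> D j w) - (\<Sum>j<m. (norm (a j w))\<^sup>2 * \<delta> j) / 2)" for m w
  define Y where "Y m w = (\<lambda>j. if j < m then D j w + \<delta> j *\<^sub>R a j w else 0)" for m w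
  define Z where "Z m w = (\<lambda>j. if j < m then D j w else 0)" for m and w :: "real \<Rightarrow> real ^ 'n"
  have sm: "strict_mono_on {..m} \<sigma>" using Suc.prems(1) by (auto simp: strict_mono_on_def)
  have im: "\<sigma> ` {..m} \<subseteq> {0..1}" using Suc.prems(2) by (rule order_trans[rotated]) auto
  note \<Phi>[measurable] = Suc.prems(4)
  have IH: "(\<integral>\<^sup>+w. ennreal (R m w) * \<Psi> (Y m w) \<partial>M) = (\<integral>\<^sup>+w. \<Psi> (Z m w) \<partial>M)"
    if "\<Psi> \<in> borel_measurable (PiM UNIV (\<lambda>_. borel))" for \<Psi>
    using Suc.IH[OF sm im Suc.prems(3) that] unfolding R_def Y_def Z_def D_def \<delta>_def by simp
  have st: "0 \<le> \<sigma> m" "\<sigma> m < \<sigma> (Suc m)" "\<sigma> (Suc m) \<le> 1"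
    using Suc.prems(2) strict_mono_onD[OF Suc.prems(1), of m "Suc m"] by (auto simp: image_subset_iff)
  have \<sigma>le: "\<sigma> j \<le> \<sigma> m" if "j \<le> m" for j using strict_mono_on_leD[OF sm] that by auto
  have \<sigma>0: "0 \<le> \<sigma> j" if "j \<le> Suc m" for j using Suc.prems(2) that by auto
  have [measurable]: "a j \<in> borel_measurable (F (\<sigma> m))" if "j < Suc m" for j
    using that st by (intro measurable_filtration_mono[OF \<sigma>le _ Suc.prems(3)]) auto
  have [measurable]: "D j \<in> borel_measurable (F (\<sigma> m))" if "j < m" for j
    unfolding D_def using that st \<sigma>le \<sigma>0 by (intro borel_measurable_diff coordinate_adapted) auto
  have [measurable]: "R m \<in> borel_measurable (F (\<sigma> m))"
    unfolding R_def by measurable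
  have Yc[measurable]: "(\<lambda>w. Y m w j) \<in> borel_measurable (F (\<sigma> m))"
   and Zc[measurable]: "(\<lambda>w. Z m w j) \<in> borel_measurable (F (\<sigma> m))" for j
    by (cases "j < m"; simp add: Y_def Z_def; measurable)+
  have YPi[measurable]: "Y m \<in> measurable (F (\<sigma> m)) (PiM UNIV (\<lambda>_. borel))"
    and ZPi[measurable]: "Z m \<in> measurable (F (\<sigma> m)) (PiM UNIV (\<lambda>_. borel))"
    using Yc Zc by (auto intro!: measurable_PiM_single')
  have upd[measurable]: "(\<lambda>p. (fst p)(m := snd p)) \<in> measurable (PiM UNIV (\<lambda>_. borel) \<Otimes>\<^sub>M borel) (PiM UNIV (\<lambda>_. borel :: (real ^ 'n) measure))"
    by (rule measurable_fun_upd[where J = UNIV]) auto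
  have updY: "(\<lambda>p. (Y m (fst p))(m := snd p)) \<in> measurable (F (\<sigma> m) \<Otimes>\<^sub>M borel) (PiM UNIV (\<lambda>_. borel))"
    and updZ: "(\<lambda>p. (Z m (fst p))(m := snd p)) \<in> measurable (F (\<sigma> m) \<Otimes>\<^sub>M borel) (PiM UNIV (\<lambda>_. borel))"
    by (rule measurable_fun_upd[where J = UNIV]; simp)+
  define H where "H = (\<lambda>p. ennreal (R m (fst p)) * \<Phi> ((Y m (fst p))(m := snd p)))"
  have H: "H \<in> borel_measurable (F (\<sigma> m) \<Otimes>\<^sub>M borel)"
    unfolding H_def using measurable_compose[OF updY \<Phi>] by measurable
  define H' where "H' = (\<lambda>p. \<Phi> ((Z m (fst p))(m := snd p)))"
  have H': "H' \<in> borel_measurable (F (\<sigma> m) \<Otimes>\<^sub>M borel)"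
    unfolding H'_def using measurable_compose[OF updZ \<Phi>] .
  let ?d = "\<lambda>x :: real ^ 'n. ennreal (\<Prod>i\<in>UNIV. normal_density 0 (sqrt (\<sigma> (Suc m) - \<sigma> m)) (x $ i))"
  define \<Psi> where "\<Psi> y = (\<integral>\<^sup>+x. ?d x * \<Phi> (y(m := x)) \<partial>lborel)" for y
  have \<Phi>u: "(\<lambda>p. \<Phi> ((fst p)(m := snd p))) \<in> borel_measurable (PiM UNIV (\<lambda>_. borel) \<Otimes>\<^sub>M lborel)"
    using measurable_compose[OF upd \<Phi>] by simp
  have \<Psi>: "\<Psi> \<in> borel_measurable (PiM UNIV (\<lambda>_. borel))"
  proof -
    have "(\<lambda>p. ?d (snd p) * \<Phi> ((fst p)(m := snd p))) \<in> borel_measurable (PiM UNIV (\<lambda>_. borel) \<Otimes>\<^sub>M lborel)"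
      by (intro borel_measurable_times_ennreal measurable_compose[OF measurable_snd, of ?d] \<Phi>u) measurable
    from lborel.borel_measurable_nn_integral_fst[OF this] show ?thesis unfolding \<Psi>_def by simp
  qed
  have "(\<integral>\<^sup>+w. ennreal (R (Suc m) w) * \<Phi> (Y (Suc m) w) \<partial>M)
    = (\<integral>\<^sup>+w. ennreal (exp (- (a m w \<bullet> D m w) - (norm (a m w))\<^sup>2 * \<delta> m / 2)) * H (w, D m w + \<delta> m *\<^sub>R a m w) \<partial>M)"
  proof (rule nn_integral_cong)
    fix w
    have "R (Suc m) w = exp (- (a m w \<bullet> D m w) - (norm (a m w))\<^sup>2 * \<delta> m / 2) * R m w"
      unfolding R_def exp_add[symmetric] by (simp add: algebra_simps add_divide_distrib)
    moreover have "Y (Suc m) w = (Y m w)(m := D m w + \<delta> m *\<^sub>R a m w)"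
      unfolding Y_def by (rule first_values_Suc)
    ultimately show "ennreal (R (Suc m) w) * \<Phi> (Y (Suc m) w) =
        ennreal (exp (- (a m w \<bullet> D m w) - (norm (a m w))\<^sup>2 * \<delta> m / 2)) * H (w, D m w + \<delta> m *\<^sub>R a m w)"
      by (simp add: H_def ennreal_mult' mult.assoc)
  qed
  also have "\<dots> = (\<integral>\<^sup>+w. H (w, D m w) \<partial>M)"
    unfolding D_def \<delta>_def using Suc.prems(3)[of m] by (intro one_step_girsanov[OF st _ H]) auto
  also have "\<dots> = (\<integral>\<^sup>+w. (\<integral>\<^sup>+x. ?d x * H (w, x) \<partial>lborel) \<partial>M)"
    unfolding D_def by (rule nn_integral_increment[OF st H])
  also have "\<dots> = (\<integral>\<^sup>+w. ennreal (R m w) * \<Psi> (Y m w) \<partial>M)"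
  proof (rule nn_integral_cong)
    fix w assume "w \<in> space M"
    have "(\<lambda>x. \<Phi> ((Y m w)(m := x))) \<in> borel_measurable lborel"
      using measurable_Pair2[OF \<Phi>u, of "Y m w"] by (simp add: space_PiM)
    then show "(\<integral>\<^sup>+x. ?d x * H (w, x) \<partial>lborel) = ennreal (R m w) * \<Psi> (Y m w)"
      unfolding \<Psi>_def H_def by (subst nn_integral_cmult[symmetric]) (auto simp: mult_ac)
  qed
  also have "\<dots> = (\<integral>\<^sup>+w. \<Psi> (Z m w) \<partial>M)" by (rule IH[OF \<Psi>])
  also have "\<dots> = (\<integral>\<^sup>+w. (\<integral>\<^sup>+x. ?d x * H' (w, x) \<partial>lborel) \<partial>M)"
    unfolding \<Psi>_def H'_def by simp
  also have "\<dots> = (\<integral>\<^sup>+w. H' (w, D m w) \<partial>M)"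
    unfolding D_def by (rule nn_integral_increment[OF st H', symmetric])
  also have "\<dots> = (\<integral>\<^sup>+w. \<Phi> (Z (Suc m) w) \<partial>M)"
    unfolding H'_def Z_def first_values_Suc fst_conv snd_conv ..
  finally show ?case unfolding R_def Y_def Z_def D_def \<delta>_def .
qed simp

end

section \<open>The squared distance of two paths in time\<close>

definition l2_error :: "(real \<Rightarrow> 'b :: real_normed_vector) \<Rightarrow> (real \<Rightarrow> 'b) \<Rightarrow> ennreal" where
  "l2_error x y = (\<integral>\<^sup>+t\<in>{0..1}. ennreal ((norm (x t - y t))\<^sup>2) \<partial>lborel)"

lemma l2_error_commute: "l2_error x y = l2_error y x"
  by (simp add: l2_error_def norm_minus_commute)

lemma l2_error_cong: 
  "(\<And>t. t \<in> {0..1} \<Longrightarrow> x t = x' t) \<Longrightarrow> (\<And>t. t \<in> {0..1} \<Longrightarrow> y t = y' t) \<Longrightarrow> l2_error x y = l2_error x' y'"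
  unfolding l2_error_def by (intro nn_integral_cong) (auto simp: indicator_def)

lemma norm_diff_square_le:
  fixes x y z :: "'b :: real_normed_vector"
  shows "(norm (x - z))\<^sup>2 \<le> 2 * (norm (x - y))\<^sup>2 + 2 * (norm (y - z))\<^sup>2"
proof -
  have "norm (x - z) \<le> norm (x - y) + norm (y - z)"
    using norm_triangle_ineq[of "x - y" "y - z"] by simp
  then have "(norm (x - z))\<^sup>2 \<le> (norm (x - y) + norm (y - z))\<^sup>2" by (intro power_mono) auto
  also have "\<dots> \<le> 2 * (norm (x - y))\<^sup>2 + 2 * (norm (y - z))\<^sup>2"
    using sum_squares_bound[of "norm (x - y)" "norm (y - z)"] by (simp add: power2_sum)
  finally show ?thesis .
qed

lemma l2_error_triangle:
  fixes x y z :: "real \<Rightarrow> 'b :: {second_countable_topology, real_normed_vector}"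
  assumes [measurable]: "x \<in> borel_measurable borel" "y \<in> borel_measurable borel" "z \<in> borel_measurable borel"
  shows "l2_error x z \<le> 2 * l2_error x y + 2 * l2_error y z"
proof -
  have "l2_error x z \<le>
    (\<integral>\<^sup>+t. 2 * (ennreal ((norm (x t - y t))\<^sup>2) * indicator {0..1} t) + 2 * (ennreal ((norm (y t - z t))\<^sup>2) * indicator {0..1} t) \<partial>lborel)"
    unfolding l2_error_def
  proof (rule nn_integral_mono)
    fix t
    have "ennreal ((norm (x t - z t))\<^sup>2) \<le> ennreal (2 * (norm (x t - y t))\<^sup>2 + 2 * (norm (y t - z t))\<^sup>2)"
      by (intro ennreal_leI norm_diff_square_le)
    also have "\<dots> = 2 * ennreal ((norm (x t - y t))\<^sup>2) + 2 * ennreal ((norm (y t - z t))\<^sup>2)"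
      by (simp add: ennreal_plus ennreal_mult')
    finally show "ennreal ((norm (x t - z t))\<^sup>2) * indicator {0..1} t \<le>
      2 * (ennreal ((norm (x t - y t))\<^sup>2) * indicator {0..1} t) + 2 * (ennreal ((norm (y t - z t))\<^sup>2) * indicator {0..1} t)"
      by (cases "t \<in> {0..1}") auto
  qed
  also have "\<dots> = 2 * l2_error x y + 2 * l2_error y z"
    unfolding l2_error_def by (subst nn_integral_add) (auto simp: nn_integral_cmult)
  finally show ?thesis .
qed

section \<open>Change of drift for simple processes\<close>

definition time_grid :: "nat \<Rightarrow> (nat \<Rightarrow> real) \<Rightarrow> bool" where
  "time_grid m \<sigma> \<longleftrightarrow> strict_mono_on {..m} \<sigma> \<and> \<sigma> ` {..m} \<subseteq> {0..1} \<and> \<sigma> 0 = 0 \<and> \<sigma> m = 1"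

lemma ex_time_grid:
  assumes "finite S" "S \<subseteq> {0..1}"
  obtains m \<sigma> where "time_grid m \<sigma>" "S \<subseteq> \<sigma> ` {..m}"
proof -
  let ?S = "insert 0 (insert 1 S)"
  obtain m :: nat and \<sigma> where \<sigma>: "strict_mono_on {..m} \<sigma>" "\<sigma> ` {..m} = ?S"
    "\<sigma> 0 = Min ?S" "\<sigma> m = Max ?S"
    by (rule ex_strict_mono_enumeration[of ?S]) (use assms in auto)
  moreover have "Min ?S = 0" using assms by (intro Min_eqI) auto
  moreover have "Max ?S = 1" using assms by (intro Max_eqI) auto
  ultimately have "time_grid m \<sigma>" using assms unfolding time_grid_def by auto
  then show ?thesis using that \<sigma>(2) by blast
qed

lemma time_gridD:
  assumes "time_grid m \<sigma>"
  shows "strict_mono_on {..m} \<sigma>" "\<sigma> ` {..m} \<subseteq> {0..1}" "\<sigma> 0 = 0" "\<sigma> m = 1"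
    and "\<And>i. i \<le> m \<Longrightarrow> 0 \<le> \<sigma> i" "\<And>i. i \<le> m \<Longrightarrow> \<sigma> i \<le> 1"
    and "\<And>i j. i \<le> m \<Longrightarrow> j \<le> m \<Longrightarrow> \<sigma> i \<le> \<sigma> j \<longleftrightarrow> i \<le> j"
    and "\<And>i j. i \<le> m \<Longrightarrow> j \<le> m \<Longrightarrow> \<sigma> i < \<sigma> j \<longleftrightarrow> i < j"
proof -
  show "strict_mono_on {..m} \<sigma>" "\<sigma> ` {..m} \<subseteq> {0..1}" "\<sigma> 0 = 0" "\<sigma> m = 1"
    using assms unfolding time_grid_def by auto
  then show "\<And>i. i \<le> m \<Longrightarrow> 0 \<le> \<sigma> i" "\<And>i. i \<le> m \<Longrightarrow> \<sigma> i \<le> 1" by auto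
  have l: "i \<le> m \<Longrightarrow> j \<le> m \<Longrightarrow> i < j \<Longrightarrow> \<sigma> i < \<sigma> j" for i j
    using strict_mono_onD[OF \<open>strict_mono_on {..m} \<sigma>\<close>] by auto
  show "i \<le> m \<Longrightarrow> j \<le> m \<Longrightarrow> \<sigma> i \<le> \<sigma> j \<longleftrightarrow> i \<le> j" for i j
    using l[of i j] l[of j i] by (cases i j rule: linorder_cases) auto
  show "i \<le> m \<Longrightarrow> j \<le> m \<Longrightarrow> \<sigma> i < \<sigma> j \<longleftrightarrow> i < j" for i j
    using l[of i j] l[of j i] by (cases i j rule: linorder_cases) auto
qed

lemma time_grid_cell:
  assumes g: "time_grid m \<sigma>" and "j < m" "p \<le> m" and t: "t \<in> {\<sigma> j<..\<sigma> (Suc j)}"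
  shows "\<sigma> p < t \<longleftrightarrow> p \<le> j" "t \<le> \<sigma> p \<longleftrightarrow> j < p"
proof -
  note [simp] = time_gridD(7,8)[OF g]
  have "p \<le> j \<Longrightarrow> \<sigma> p \<le> \<sigma> j" "j < p \<Longrightarrow> \<sigma> (Suc j) \<le> \<sigma> p" using assms by simp_all
  then show "\<sigma> p < t \<longleftrightarrow> p \<le> j" "t \<le> \<sigma> p \<longleftrightarrow> j < p" using t by (cases "p \<le> j"; force)+
qed

lemma has_bochner_integral_cell_function:
  fixes g :: "real \<Rightarrow> 'b :: {banach, second_countable_topology}"
  assumes g: "time_grid m \<sigma>" and c: "\<And>j t. j < m \<Longrightarrow> t \<in> {\<sigma> j<..\<sigma> (Suc j)} \<Longrightarrow> g t = g (\<sigma> (Suc j))"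
    and "p \<le> m"
  shows "has_bochner_integral lborel (\<lambda>t. indicator {0..\<sigma> p} t *\<^sub>R g t)
    (\<Sum>j<p. (\<sigma> (Suc j) - \<sigma> j) *\<^sub>R g (\<sigma> (Suc j)))"
  using assms(3)
proof (induction p)
  case 0
  have "AE t in lborel. t \<noteq> (0::real)" by (rule AE_lborel_singleton)
  then have "AE t in lborel. indicator {0..\<sigma> 0} t *\<^sub>R g t = 0"
    by eventually_elim (auto simp: indicator_def time_gridD(3)[OF g])
  moreover have "(\<lambda>t. indicator {0..\<sigma> 0} t *\<^sub>R g t) = (\<lambda>t. indicator {0} t *\<^sub>R g 0)"
    by (auto simp: time_gridD(3)[OF g] indicator_def)
  ultimately show ?case
    by (subst has_bochner_integral_cong_AE[of _ _ "\<lambda>_. 0"]) auto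
next
  case (Suc p)
  let ?A = "{\<sigma> p<..\<sigma> (Suc p)}"
  have le: "0 \<le> \<sigma> p" "\<sigma> p < \<sigma> (Suc p)" using Suc.prems time_gridD[OF g] by auto
  have "has_bochner_integral lborel (\<lambda>t. indicator ?A t *\<^sub>R g (\<sigma> (Suc p))) (measure lborel ?A *\<^sub>R g (\<sigma> (Suc p)))"
    using le by (intro has_bochner_integral_indicator) auto
  then have "has_bochner_integral lborel (\<lambda>t. indicator {0..\<sigma> p} t *\<^sub>R g t + indicator ?A t *\<^sub>R g (\<sigma> (Suc p)))
    ((\<Sum>j<p. (\<sigma> (Suc j) - \<sigma> j) *\<^sub>R g (\<sigma> (Suc j))) + (\<sigma> (Suc p) - \<sigma> p) *\<^sub>R g (\<sigma> (Suc p)))"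
    using Suc le by (intro has_bochner_integral_add) auto
  moreover have "indicator {0..\<sigma> p} t *\<^sub>R g t + indicator ?A t *\<^sub>R g (\<sigma> (Suc p)) = indicator {0..\<sigma> (Suc p)} t *\<^sub>R g t" for t
    using c[of p t] Suc.prems le by (auto simp: indicator_def)
  ultimately show ?case by (simp add: add.commute)
qed

lemma integral_cell_function:
  fixes g :: "real \<Rightarrow> 'b :: {banach, second_countable_topology}"
  assumes g: "time_grid m \<sigma>" and c: "\<And>j t. j < m \<Longrightarrow> t \<in> {\<sigma> j<..\<sigma> (Suc j)} \<Longrightarrow> g t = g (\<sigma> (Suc j))"
    and "p \<le> m"
  shows "(LINT t:{0..\<sigma> p}|lborel. g t) = (\<Sum>j<p. (\<sigma> (Suc j) - \<sigma> j) *\<^sub>R g (\<sigma> (Suc j)))"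
  using has_bochner_integral_cell_function[OF g, of g p, OF c assms(3)]
  by (simp add: set_lebesgue_integral_def has_bochner_integral_iff)

lemma nn_integral_cell_function:
  fixes g :: "real \<Rightarrow> real"
  assumes g: "time_grid m \<sigma>" and c: "\<And>j t. j < m \<Longrightarrow> t \<in> {\<sigma> j<..\<sigma> (Suc j)} \<Longrightarrow> g t = g (\<sigma> (Suc j))"
    and pos: "\<And>t. 0 \<le> g t"
  shows "(\<integral>\<^sup>+t\<in>{0..1}. ennreal (g t) \<partial>lborel) = ennreal (\<Sum>j<m. (\<sigma> (Suc j) - \<sigma> j) * g (\<sigma> (Suc j)))"
proof -
  have h: "has_bochner_integral lborel (\<lambda>t. indicator {0..1} t *\<^sub>R g t) (\<Sum>j<m. (\<sigma> (Suc j) - \<sigma> j) * g (\<sigma> (Suc j)))"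
    using has_bochner_integral_cell_function[OF g, of g m, OF c order_refl] time_gridD(4)[OF g] by simp
  have "(\<integral>\<^sup>+t\<in>{0..1}. ennreal (g t) \<partial>lborel) = (\<integral>\<^sup>+t. ennreal (indicator {0..1} t *\<^sub>R g t) \<partial>lborel)"
    by (intro nn_integral_cong) (auto simp: indicator_def)
  also have "\<dots> = ennreal (\<Sum>j<m. (\<sigma> (Suc j) - \<sigma> j) * g (\<sigma> (Suc j)))"
    using h pos by (subst nn_integral_eq_integral) (auto simp: has_bochner_integral_iff indicator_def)
  finally show ?thesis .
qed

text \<open>
  A simple process can be read on every grid that contains its times. This brings several processes
  and the times at which a path is observed to a common grid.
\<close>

context
  fixes k :: nat and \<tau> :: "nat \<Rightarrow> real" and m :: nat and \<sigma> :: "nat \<Rightarrow> real"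
  assumes \<tau>: "mono_on {..k} \<tau>" and g: "time_grid m \<sigma>" and sub: "\<tau> ` {..k} \<subseteq> \<sigma> ` {..m}"
begin

lemma simple_step_indicator:
  assumes "i < k"
  obtains p q where "p \<le> q" "q \<le> m" "\<tau> i = \<sigma> p" "\<tau> (Suc i) = \<sigma> q"
    "\<And>j t. j < m \<Longrightarrow> t \<in> {\<sigma> j<..\<sigma> (Suc j)} \<Longrightarrow> t \<in> {\<tau> i<..\<tau> (Suc i)} \<longleftrightarrow> p \<le> j \<and> j < q"
proof -
  have "\<tau> i \<in> \<sigma> ` {..m}" "\<tau> (Suc i) \<in> \<sigma> ` {..m}" using assms by (auto intro!: subsetD[OF sub])
  then obtain p q where pq: "p \<le> m" "q \<le> m" "\<tau> i = \<sigma> p" "\<tau> (Suc i) = \<sigma> q" by auto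
  have "\<tau> i \<le> \<tau> (Suc i)" using assms by (intro mono_onD[OF \<tau>]) auto
  then have "p \<le> q" using pq time_gridD(7)[OF g, of p q] by auto
  then show ?thesis
    using that[of p q] pq time_grid_cell[OF g, of _ p] time_grid_cell[OF g, of _ q] by auto
qed

lemma simple_eval_cell:
  assumes "j < m" "t \<in> {\<sigma> j<..\<sigma> (Suc j)}"
  shows "simple_eval k \<tau> \<xi> t w = simple_eval k \<tau> \<xi> (\<sigma> (Suc j)) w"
  unfolding simple_eval_def
proof (rule sum.cong)
  fix i assume "i \<in> {..<k}"
  then obtain p q where "\<And>j t. j < m \<Longrightarrow> t \<in> {\<sigma> j<..\<sigma> (Suc j)} \<Longrightarrow> t \<in> {\<tau> i<..\<tau> (Suc i)} \<longleftrightarrow> p \<le> j \<and> j < q"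
    using simple_step_indicator[of i] by (metis lessThan_iff)
  from this[OF assms] this[OF assms(1), of "\<sigma> (Suc j)"] assms(2)
  show "indicator {\<tau> i<..\<tau> (Suc i)} t *\<^sub>R \<xi> i w = indicator {\<tau> i<..\<tau> (Suc i)} (\<sigma> (Suc j)) *\<^sub>R \<xi> i w"
    by (auto simp: indicator_def)
qed simp

lemma simple_integral_grid:
  "simple_integral k \<tau> \<xi> w = (\<Sum>j<m. simple_eval k \<tau> \<xi> (\<sigma> (Suc j)) w \<bullet> (w (\<sigma> (Suc j)) - w (\<sigma> j)))"
proof -
  have *: "w (\<tau> (Suc i)) - w (\<tau> i) = (\<Sum>j<m. indicator {\<tau> i<..\<tau> (Suc i)} (\<sigma> (Suc j)) *\<^sub>R (w (\<sigma> (Suc j)) - w (\<sigma> j)))"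
    if i: "i < k" for i
  proof -
    obtain p q where pq: "p \<le> q" "q \<le> m" "\<tau> i = \<sigma> p" "\<tau> (Suc i) = \<sigma> q"
      and ind: "\<And>j t. j < m \<Longrightarrow> t \<in> {\<sigma> j<..\<sigma> (Suc j)} \<Longrightarrow> t \<in> {\<tau> i<..\<tau> (Suc i)} \<longleftrightarrow> p \<le> j \<and> j < q"
      using simple_step_indicator[OF i] by metis
    have "\<sigma> j < \<sigma> (Suc j)" if "j < m" for j using time_gridD(8)[OF g, of j "Suc j"] that by auto
    then have ind': "indicator {\<tau> i<..\<tau> (Suc i)} (\<sigma> (Suc j)) = (if p \<le> j \<and> j < q then 1 else 0 :: real)" if "j < m" for j
      using ind[OF that, of "\<sigma> (Suc j)"] that by (auto simp: indicator_def)
    have "(\<Sum>j<m. indicator {\<tau> i<..\<tau> (Suc i)} (\<sigma> (Suc j)) *\<^sub>R (w (\<sigma> (Suc j)) - w (\<sigma> j)))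
      = (\<Sum>j<m. if j \<in> {p..<q} then w (\<sigma> (Suc j)) - w (\<sigma> j) else 0)"
      using ind' by (intro sum.cong) auto
    also have "\<dots> = (\<Sum>j\<in>{p..<q}. w (\<sigma> (Suc j)) - w (\<sigma> j))"
      using pq(2) by (subst sum.inter_restrict[symmetric]) (auto intro!: sum.cong)
    also have "\<dots> = w (\<sigma> q) - w (\<sigma> p)" using pq(1) by (rule sum_Suc_diff')
    finally show ?thesis using pq by simp
  qed
  have "simple_integral k \<tau> \<xi> w = (\<Sum>i<k. \<Sum>j<m. (indicator {\<tau> i<..\<tau> (Suc i)} (\<sigma> (Suc j)) *\<^sub>R \<xi> i w) \<bullet> (w (\<sigma> (Suc j)) - w (\<sigma> j)))"
    unfolding simple_integral_def
  proof (rule sum.cong)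
    fix i assume "i \<in> {..<k}"
    then have i: "i < k" by simp
    show "\<xi> i w \<bullet> (w (\<tau> (Suc i)) - w (\<tau> i)) = (\<Sum>j<m. (indicator {\<tau> i<..\<tau> (Suc i)} (\<sigma> (Suc j)) *\<^sub>R \<xi> i w) \<bullet> (w (\<sigma> (Suc j)) - w (\<sigma> j)))"
      unfolding *[OF i] by (simp add: inner_sum_right)
  qed simp
  also have "\<dots> = (\<Sum>j<m. simple_eval k \<tau> \<xi> (\<sigma> (Suc j)) w \<bullet> (w (\<sigma> (Suc j)) - w (\<sigma> j)))"
    by (subst sum.swap) (simp only: simple_eval_def inner_sum_left)
  finally show ?thesis .
qed

end

context classical_wiener
begin

lemma simple_eval_adapted:
  assumes s: "simple_process \<mu> k \<tau> \<xi>" and g: "time_grid m \<sigma>" and sub: "\<tau> ` {..k} \<subseteq> \<sigma> ` {..m}" and j: "j < m"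
  shows "simple_eval k \<tau> \<xi> (\<sigma> (Suc j)) \<in> borel_measurable (F (\<sigma> j))"
proof -
  have \<tau>: "mono_on {..k} \<tau>" using s by (simp add: simple_process_def)
  have "(\<lambda>w. indicator {\<tau> i<..\<tau> (Suc i)} (\<sigma> (Suc j)) *\<^sub>R \<xi> i w) \<in> borel_measurable (F (\<sigma> j))" if i: "i < k" for i
  proof (cases "\<sigma> (Suc j) \<in> {\<tau> i<..\<tau> (Suc i)}")
    case True
    have "\<tau> i \<in> \<sigma> ` {..m}" using i by (intro subsetD[OF sub]) auto
    then obtain p where "p \<le> m" "\<tau> i = \<sigma> p" by auto
    then have le: "\<tau> i \<le> \<sigma> j" using True j time_gridD(7,8)[OF g] by auto
    have \<xi>: "\<xi> i \<in> borel_measurable (F (\<tau> i))" using s i by (simp add: simple_process_def)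
    have "\<sigma> j \<le> 1" using time_gridD(6)[OF g, of j] j by simp
    from measurable_filtration_mono[OF le this \<xi>] have "\<xi> i \<in> borel_measurable (F (\<sigma> j))" .
    then show ?thesis by measurable
  qed auto
  then show ?thesis unfolding simple_eval_def by (intro borel_measurable_sum) auto
qed

lemma simple_process_value_measurable:
  assumes s: "simple_process \<mu> k \<tau> \<xi>" and i: "i < k"
  shows "\<xi> i \<in> borel_measurable M"
proof -
  have "\<tau> i \<in> \<tau> ` {..k}" using i by auto
  then have "\<tau> i \<in> {0..1}" using s unfolding simple_process_def by blast
  then have "\<tau> i \<le> 1" by simp
  moreover have "\<xi> i \<in> borel_measurable (F (\<tau> i))" using s i by (simp add: simple_process_def)
  ultimately show ?thesis by (rule measurable_filtration_completion)
qed

lemma simple_integral_measurable: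
  assumes s: "simple_process \<mu> k \<tau> \<xi>"
  shows "simple_integral k \<tau> \<xi> \<in> borel_measurable M"
proof -
  have "\<tau> i \<in> {0..1}" "\<tau> (Suc i) \<in> {0..1}" if "i < k" for i
  proof -
    have "i \<in> {..k}" "Suc i \<in> {..k}" using that by auto
    then show "\<tau> i \<in> {0..1}" "\<tau> (Suc i) \<in> {0..1}" using s unfolding simple_process_def by blast+
  qed
  then show ?thesis unfolding simple_integral_def
    by (intro borel_measurable_sum borel_measurable_inner increment_measurable
        simple_process_value_measurable[OF s]) auto
qed

text \<open>
  On a grid that contains the times of the process and the times in \<open>T\<close>, both sides are functions of
  the grid increments, because the path starts at 0.
\<close>

lemma simple_girsanov:
  fixes \<Phi> :: "(real \<Rightarrow> real ^ 'n) \<Rightarrow> ennreal"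
  assumes s: "simple_process \<mu> k \<tau> \<xi>" and T: "finite T" "T \<subseteq> {0..1}"
    and \<Phi>: "\<Phi> \<in> borel_measurable (PiM T (\<lambda>_. borel))"
  shows "(\<integral>\<^sup>+w. ennreal (exp (- simple_integral k \<tau> \<xi> w
        - (LINT t:{0..1}|lborel. (norm (simple_eval k \<tau> \<xi> t w))\<^sup>2) / 2)) *
      \<Phi> (\<lambda>t\<in>T. w t + (LINT s:{0..t}|lborel. simple_eval k \<tau> \<xi> s w)) \<partial>M)
    = (\<integral>\<^sup>+w. \<Phi> (\<lambda>t\<in>T. w t) \<partial>M)"
proof -
  have \<tau>: "mono_on {..k} \<tau>" "\<tau> ` {..k} \<subseteq> {0..1}" using s by (auto simp: simple_process_def)
  obtain m \<sigma> where g: "time_grid m \<sigma>" and sub: "\<tau> ` {..k} \<union> T \<subseteq> \<sigma> ` {..m}"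
    by (rule ex_time_grid[of "\<tau> ` {..k} \<union> T"]) (use T \<tau> in auto)
  then have sub1: "\<tau> ` {..k} \<subseteq> \<sigma> ` {..m}" by auto
  define a where "a j = simple_eval k \<tau> \<xi> (\<sigma> (Suc j))" for j
  have "\<forall>t\<in>T. \<exists>p\<le>m. \<sigma> p = t" using sub by fastforce
  then obtain p where p: "\<And>t. t \<in> T \<Longrightarrow> p t \<le> m" "\<And>t. t \<in> T \<Longrightarrow> \<sigma> (p t) = t" by metis
  define \<Psi> where "\<Psi> y = \<Phi> (\<lambda>t\<in>T. \<Sum>j<p t. y j)" for y
  have \<Psi>: "\<Psi> \<in> borel_measurable (PiM UNIV (\<lambda>_. borel))"
    unfolding \<Psi>_def
    by (rule measurable_compose[OF _ \<Phi>]) (intro measurable_restrict borel_measurable_sum measurable_component_singleton, simp)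
  let ?D = "\<lambda>j w. w (\<sigma> (Suc j)) - w (\<sigma> j)" and ?\<delta> = "\<lambda>j. \<sigma> (Suc j) - \<sigma> j"
  have cell: "j < m \<Longrightarrow> t \<in> {\<sigma> j<..\<sigma> (Suc j)} \<Longrightarrow> simple_eval k \<tau> \<xi> t w = a j w" for j t w
    unfolding a_def by (rule simple_eval_cell[OF \<tau>(1) g sub1])
  have a_alt: "simple_eval k \<tau> \<xi> (\<sigma> (Suc j)) w = a j w" for j w by (simp add: a_def)
  have I: "simple_integral k \<tau> \<xi> w = (\<Sum>j<m. a j w \<bullet> ?D j w)" for w
    unfolding a_def by (rule simple_integral_grid[OF \<tau>(1) g sub1])
  have Q: "(LINT t:{0..1}|lborel. (norm (simple_eval k \<tau> \<xi> t w))\<^sup>2) = (\<Sum>j<m. (norm (a j w))\<^sup>2 * ?\<delta> j)" for w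
    using integral_cell_function[OF g, of "\<lambda>t. (norm (simple_eval k \<tau> \<xi> t w))\<^sup>2" m] cell
    by (simp add: time_gridD(4)[OF g] a_alt mult.commute)
  have J: "(LINT s:{0..t}|lborel. simple_eval k \<tau> \<xi> s w) = (\<Sum>j<p t. ?\<delta> j *\<^sub>R a j w)" if "t \<in> T" for t w
    using integral_cell_function[OF g, of "\<lambda>t. simple_eval k \<tau> \<xi> t w" "p t"] cell p[OF that]
    by (simp add: a_alt)
  have W: "w t = (\<Sum>j<p t. ?D j w)" if "t \<in> T" "w 0 = 0" for w :: "real \<Rightarrow> real ^ 'n" and t
    using p[OF that(1)] that(2) time_gridD(3)[OF g] sum_lessThan_telescope[of "\<lambda>j. w (\<sigma> j)" "p t"] by simp
  have "(\<integral>\<^sup>+w. ennreal (exp (- simple_integral k \<tau> \<xi> w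
        - (LINT t:{0..1}|lborel. (norm (simple_eval k \<tau> \<xi> t w))\<^sup>2) / 2)) *
      \<Phi> (\<lambda>t\<in>T. w t + (LINT s:{0..t}|lborel. simple_eval k \<tau> \<xi> s w)) \<partial>M)
    = (\<integral>\<^sup>+w. ennreal (exp (- (\<Sum>j<m. a j w \<bullet> ?D j w) - (\<Sum>j<m. (norm (a j w))\<^sup>2 * ?\<delta> j) / 2)) *
      \<Psi> (\<lambda>j. if j < m then ?D j w + ?\<delta> j *\<^sub>R a j w else 0) \<partial>M)"
  proof (rule nn_integral_cong_AE)
    show "AE w in M. ennreal (exp (- simple_integral k \<tau> \<xi> w
        - (LINT t:{0..1}|lborel. (norm (simple_eval k \<tau> \<xi> t w))\<^sup>2) / 2)) *
      \<Phi> (\<lambda>t\<in>T. w t + (LINT s:{0..t}|lborel. simple_eval k \<tau> \<xi> s w)) =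
      ennreal (exp (- (\<Sum>j<m. a j w \<bullet> ?D j w) - (\<Sum>j<m. (norm (a j w))\<^sup>2 * ?\<delta> j) / 2)) *
      \<Psi> (\<lambda>j. if j < m then ?D j w + ?\<delta> j *\<^sub>R a j w else 0)"
      using AE_completion[OF AE_start]
    proof eventually_elim
      case (elim w)
      have "(\<lambda>t\<in>T. w t + (LINT s:{0..t}|lborel. simple_eval k \<tau> \<xi> s w)) =
        (\<lambda>t\<in>T. \<Sum>j<p t. if j < m then ?D j w + ?\<delta> j *\<^sub>R a j w else 0)"
      proof (rule restrict_ext)
        fix t assume t: "t \<in> T"
        have "w t + (LINT s:{0..t}|lborel. simple_eval k \<tau> \<xi> s w) = (\<Sum>j<p t. ?D j w + ?\<delta> j *\<^sub>R a j w)"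
          unfolding J[OF t] sum.distrib using W[of t w, OF t elim] by simp
        also have "\<dots> = (\<Sum>j<p t. if j < m then ?D j w + ?\<delta> j *\<^sub>R a j w else 0)"
          using p(1)[OF t] by (intro sum.cong) auto
        finally show "w t + (LINT s:{0..t}|lborel. simple_eval k \<tau> \<xi> s w) = (\<Sum>j<p t. if j < m then ?D j w + ?\<delta> j *\<^sub>R a j w else 0)" .
      qed
      then show ?case unfolding I Q \<Psi>_def by simp
    qed
  qed
  also have "\<dots> = (\<integral>\<^sup>+w. \<Psi> (\<lambda>j. if j < m then ?D j w else 0) \<partial>M)"
    unfolding a_def using time_gridD(1,2)[OF g] simple_eval_adapted[OF s g sub1] \<Psi> by (rule grid_girsanov)
  also have "\<dots> = (\<integral>\<^sup>+w. \<Phi> (\<lambda>t\<in>T. w t) \<partial>M)"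
  proof (rule nn_integral_cong_AE)
    show "AE w in M. \<Psi> (\<lambda>j. if j < m then ?D j w else 0) = \<Phi> (\<lambda>t\<in>T. w t)"
      using AE_completion[OF AE_start]
    proof eventually_elim
      case (elim w)
      have "(\<lambda>t\<in>T. \<Sum>j<p t. if j < m then ?D j w else 0) = (\<lambda>t\<in>T. w t)"
      proof (rule restrict_ext)
        fix t assume t: "t \<in> T"
        have "(\<Sum>j<p t. if j < m then ?D j w else 0) = (\<Sum>j<p t. ?D j w)"
          using p(1)[OF t] by (intro sum.cong) auto
        then show "(\<Sum>j<p t. if j < m then ?D j w else 0) = w t" using W[of t w, OF t elim] by simp
      qed
      then show ?case unfolding \<Psi>_def by simp
    qed
  qed
  finally show ?thesis .
qed

text \<open>
  Let \<open>D\<close> be the difference of the two processes. By \<open>grid_girsanov\<close>, the mean of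
  \<open>exp(\<theta> \<integral>D dW - \<theta>\<^sup>2/2 \<integral>\<bar>D\<bar>\<^sup>2 dt)\<close> is 1, and on the event the exponent is at least
  \<open>\<theta>\<epsilon> - \<theta>\<^sup>2\<delta>/2\<close>. The choice \<open>\<theta> = \<epsilon>/\<delta>\<close> maximizes this, and Markov's inequality gives the bound.
\<close>

lemma simple_integral_tail_one_sided:
  assumes s: "simple_process \<mu> k \<tau> \<xi>" "simple_process \<mu> k' \<tau>' \<xi>'" and pos: "0 < \<epsilon>" "0 < \<delta>"
  shows "emeasure M {w \<in> space \<mu>. \<epsilon> < simple_integral k \<tau> \<xi> w - simple_integral k' \<tau>' \<xi>' w \<and>
    l2_error (\<lambda>t. simple_eval k \<tau> \<xi> t w) (\<lambda>t. simple_eval k' \<tau>' \<xi>' t w) \<le> ennreal \<delta>}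
    \<le> ennreal (exp (- (\<epsilon>\<^sup>2 / (2 * \<delta>))))" (is "emeasure M ?A \<le> _")
proof -
  interpret M: prob_space M by (rule prob_space_M)
  have \<tau>: "mono_on {..k} \<tau>" "\<tau> ` {..k} \<subseteq> {0..1}" "mono_on {..k'} \<tau>'" "\<tau>' ` {..k'} \<subseteq> {0..1}"
    using s by (auto simp: simple_process_def)
  obtain m \<sigma> where g: "time_grid m \<sigma>" and sub: "\<tau> ` {..k} \<union> \<tau>' ` {..k'} \<subseteq> \<sigma> ` {..m}"
    by (rule ex_time_grid[of "\<tau> ` {..k} \<union> \<tau>' ` {..k'}"]) (use \<tau> in auto)
  then have sub1: "\<tau> ` {..k} \<subseteq> \<sigma> ` {..m}" "\<tau>' ` {..k'} \<subseteq> \<sigma> ` {..m}" by auto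
  let ?V = "\<lambda>t w. simple_eval k \<tau> \<xi> t w - simple_eval k' \<tau>' \<xi>' t w"
  let ?I = "\<lambda>w. simple_integral k \<tau> \<xi> w - simple_integral k' \<tau>' \<xi>' w"
  let ?D = "\<lambda>j w. w (\<sigma> (Suc j)) - w (\<sigma> j)" and ?\<delta> = "\<lambda>j. \<sigma> (Suc j) - \<sigma> j"
  define \<theta> where "\<theta> = \<epsilon> / \<delta>"
  define a where "a j w = (- \<theta>) *\<^sub>R ?V (\<sigma> (Suc j)) w" for j w
  define Q where "Q w = (\<Sum>j<m. ?\<delta> j * (norm (?V (\<sigma> (Suc j)) w))\<^sup>2)" for w
  have cell: "j < m \<Longrightarrow> t \<in> {\<sigma> j<..\<sigma> (Suc j)} \<Longrightarrow> ?V t w = ?V (\<sigma> (Suc j)) w" for j t w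
    using simple_eval_cell[OF \<tau>(1) g sub1(1), of j t \<xi> w] simple_eval_cell[OF \<tau>(3) g sub1(2), of j t \<xi>' w] by simp
  have Q: "l2_error (\<lambda>t. simple_eval k \<tau> \<xi> t w) (\<lambda>t. simple_eval k' \<tau>' \<xi>' t w) = ennreal (Q w)" for w
    unfolding l2_error_def Q_def
  proof (rule nn_integral_cell_function[OF g, of "\<lambda>t. (norm (?V t w))\<^sup>2"])
    fix j t assume "j < m" "t \<in> {\<sigma> j<..\<sigma> (Suc j)}"
    from cell[OF this, of w] show "(norm (?V t w))\<^sup>2 = (norm (?V (\<sigma> (Suc j)) w))\<^sup>2" by (rule arg_cong)
  qed simp
  have \<theta>I: "\<theta> * ?I w = - (\<Sum>j<m. a j w \<bullet> ?D j w)" for w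
    unfolding simple_integral_grid[OF \<tau>(1) g sub1(1)] simple_integral_grid[OF \<tau>(3) g sub1(2)] a_def
    by (simp add: sum_subtractf[symmetric] inner_diff_left[symmetric] sum_negf sum_distrib_left)
  have \<theta>Q: "\<theta>\<^sup>2 * Q w = (\<Sum>j<m. (norm (a j w))\<^sup>2 * ?\<delta> j)" for w
    unfolding Q_def a_def by (simp add: sum_distrib_left power_mult_distrib mult_ac)
  have one: "(\<integral>\<^sup>+w. ennreal (exp (\<theta> * ?I w - \<theta>\<^sup>2 * Q w / 2)) \<partial>M) = 1"
  proof -
    have "a j \<in> borel_measurable (F (\<sigma> j))" if "j < m" for j
      using simple_eval_adapted[OF s(1) g sub1(1) that] simple_eval_adapted[OF s(2) g sub1(2) that]
      unfolding a_def by measurable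
    from grid_girsanov[OF time_gridD(1,2)[OF g] this, of "\<lambda>_. 1"]
    show ?thesis unfolding \<theta>I \<theta>Q using M.emeasure_space_1 by simp
  qed
  have Qm: "Q \<in> borel_measurable M"
  proof -
    have "simple_eval k \<tau> \<xi> (\<sigma> (Suc j)) \<in> borel_measurable M" "simple_eval k' \<tau>' \<xi>' (\<sigma> (Suc j)) \<in> borel_measurable M" if "j < m" for j
    proof -
      have le: "\<sigma> j \<le> 1" using time_gridD(6)[OF g, of j] that by simp
      show "simple_eval k \<tau> \<xi> (\<sigma> (Suc j)) \<in> borel_measurable M"
        by (rule measurable_filtration_completion[OF le simple_eval_adapted[OF s(1) g sub1(1) that]])
      show "simple_eval k' \<tau>' \<xi>' (\<sigma> (Suc j)) \<in> borel_measurable M"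
        by (rule measurable_filtration_completion[OF le simple_eval_adapted[OF s(2) g sub1(2) that]])
    qed
    then show ?thesis unfolding Q_def by (intro borel_measurable_sum) auto
  qed
  note [measurable] = Qm simple_integral_measurable[OF s(1)] simple_integral_measurable[OF s(2)]
  have A: "?A = {w \<in> space M. \<epsilon> < ?I w \<and> ennreal (Q w) \<le> ennreal \<delta>}" unfolding Q by simp
  have "emeasure M ?A = (\<integral>\<^sup>+w. indicator ?A w \<partial>M)"
    unfolding A by (subst nn_integral_indicator) measurable
  also have "\<dots> \<le> (\<integral>\<^sup>+w. ennreal (exp (- (\<epsilon>\<^sup>2 / (2 * \<delta>)))) * ennreal (exp (\<theta> * ?I w - \<theta>\<^sup>2 * Q w / 2)) \<partial>M)"
  proof (rule nn_integral_mono)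
    fix w
    show "indicator ?A w \<le> ennreal (exp (- (\<epsilon>\<^sup>2 / (2 * \<delta>)))) * ennreal (exp (\<theta> * ?I w - \<theta>\<^sup>2 * Q w / 2))"
    proof (cases "w \<in> ?A")
      case True
      then have "\<epsilon> < ?I w" "Q w \<le> \<delta>" using pos unfolding A by auto
      moreover have "0 \<le> \<theta>" using pos by (simp add: \<theta>_def)
      ultimately have "\<theta> * \<epsilon> \<le> \<theta> * ?I w" "\<theta>\<^sup>2 * Q w \<le> \<theta>\<^sup>2 * \<delta>"
        by (auto intro!: mult_left_mono)
      moreover have "\<theta> * \<epsilon> = \<epsilon>\<^sup>2 / \<delta>" "\<theta>\<^sup>2 * \<delta> = \<epsilon>\<^sup>2 / \<delta>"
        using pos by (auto simp: \<theta>_def power2_eq_square)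
      ultimately have 1: "\<epsilon>\<^sup>2 / \<delta> \<le> \<theta> * ?I w" "\<theta>\<^sup>2 * Q w \<le> \<epsilon>\<^sup>2 / \<delta>" by simp_all
      have "0 \<le> - (\<epsilon>\<^sup>2 / (2 * \<delta>)) + (\<theta> * ?I w - \<theta>\<^sup>2 * Q w / 2)"
      proof -
        have "\<epsilon>\<^sup>2 / (2 * \<delta>) = \<epsilon>\<^sup>2 / \<delta> - \<epsilon>\<^sup>2 / \<delta> / 2" by simp
        then show ?thesis using 1 by linarith
      qed
      then have "1 \<le> exp (- (\<epsilon>\<^sup>2 / (2 * \<delta>))) * exp (\<theta> * ?I w - \<theta>\<^sup>2 * Q w / 2)"
        unfolding exp_add[symmetric] by simp
      then have "1 \<le> ennreal (exp (- (\<epsilon>\<^sup>2 / (2 * \<delta>))) * exp (\<theta> * ?I w - \<theta>\<^sup>2 * Q w / 2))"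
        by (simp flip: ennreal_1 add: ennreal_leI)
      then show ?thesis using True by (simp add: ennreal_mult)
    qed simp
  qed
  also have "\<dots> = ennreal (exp (- (\<epsilon>\<^sup>2 / (2 * \<delta>))))"
    using one by (subst nn_integral_cmult) auto
  finally show ?thesis .
qed

end

section \<open>Convergence in probability\<close>

text \<open>
  For \<open>[0,\<infinity>]\<close>-valued \<open>Z\<^sub>n\<close>, convergence to 0 in probability is the same as convergence of the means of
  \<open>min 1 Z\<^sub>n\<close>. In the second form sums are easy to handle, and convergence in mean provides almost
  surely convergent subsequences.
\<close>

context prob_space
begin

lemma nn_integral_min_tendsto_zero:
  fixes Z :: "nat \<Rightarrow> 'a \<Rightarrow> ennreal"
  assumes Z[measurable]: "\<And>n. Z n \<in> borel_measurable M"
    and lim: "\<And>\<epsilon> :: real. 0 < \<epsilon> \<Longrightarrow> (\<lambda>n. measure M {w \<in> space M. ennreal \<epsilon> < Z n w}) \<longlonglongrightarrow> 0"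
  shows "(\<lambda>n. \<integral>\<^sup>+w. min 1 (Z n w) \<partial>M) \<longlonglongrightarrow> 0"
proof (rule tendsto_zero_ennreal)
  fix r :: real assume "0 < r"
  then have "eventually (\<lambda>n. measure M {w \<in> space M. ennreal (r / 2) < Z n w} < r / 2) sequentially"
    using lim[of "r / 2"] by (intro order_tendstoD) auto
  then show "eventually (\<lambda>n. (\<integral>\<^sup>+w. min 1 (Z n w) \<partial>M) < ennreal r) sequentially"
  proof eventually_elim
    case (elim n)
    let ?A = "{w \<in> space M. ennreal (r / 2) < Z n w}"
    have "(\<integral>\<^sup>+w. min 1 (Z n w) \<partial>M) \<le> (\<integral>\<^sup>+w. ennreal (r / 2) + indicator ?A w \<partial>M)"
    proof (rule nn_integral_mono)
      fix w assume "w \<in> space M"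
      then show "min 1 (Z n w) \<le> ennreal (r / 2) + indicator ?A w"
        by (cases "w \<in> ?A") (auto simp: min_le_iff_disj add_increasing)
    qed
    also have "\<dots> = ennreal (r / 2) + ennreal (measure M ?A)"
      by (subst nn_integral_add) (auto simp: emeasure_eq_measure prob_space)
    also have "\<dots> = ennreal (r / 2 + measure M ?A)" using \<open>0 < r\<close> by (subst ennreal_plus) auto
    also have "\<dots> < ennreal r" using elim \<open>0 < r\<close> by (intro ennreal_lessI) auto
    finally show ?case .
  qed
qed

lemma measure_tendsto_zero_if_nn_integral_min:
  fixes Z :: "nat \<Rightarrow> 'a \<Rightarrow> ennreal"
  assumes Z[measurable]: "\<And>n. Z n \<in> borel_measurable M"
    and lim: "(\<lambda>n. \<integral>\<^sup>+w. min 1 (Z n w) \<partial>M) \<longlonglongrightarrow> 0" and "0 < (\<epsilon> :: real)"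
  shows "(\<lambda>n. measure M {w \<in> space M. ennreal \<epsilon> < Z n w}) \<longlonglongrightarrow> 0"
proof -
  let ?e = "min 1 \<epsilon>"
  have bound: "emeasure M {w \<in> space M. ennreal \<epsilon> < Z n w} \<le> ennreal (1 / ?e) * (\<integral>\<^sup>+w. min 1 (Z n w) \<partial>M)" for n
  proof -
    have "emeasure M {w \<in> space M. ennreal \<epsilon> < Z n w} = (\<integral>\<^sup>+w. indicator {w \<in> space M. ennreal \<epsilon> < Z n w} w \<partial>M)"
      by simp
    also have "\<dots> \<le> (\<integral>\<^sup>+w. ennreal (1 / ?e) * min 1 (Z n w) \<partial>M)"
    proof (rule nn_integral_mono)
      fix w
      show "indicator {w \<in> space M. ennreal \<epsilon> < Z n w} w \<le> ennreal (1 / ?e) * min 1 (Z n w)"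
      proof (cases "w \<in> {w \<in> space M. ennreal \<epsilon> < Z n w}")
        case True
        then have "ennreal ?e \<le> min 1 (Z n w)"
          using \<open>0 < \<epsilon>\<close> by (auto simp: min_def less_imp_le intro: order_trans[OF ennreal_leI] simp flip: ennreal_1)
        then have "ennreal (1 / ?e) * ennreal ?e \<le> ennreal (1 / ?e) * min 1 (Z n w)"
          by (rule mult_left_mono) simp
        moreover have "ennreal (1 / ?e) * ennreal ?e = 1"
          using \<open>0 < \<epsilon>\<close> by (subst ennreal_mult[symmetric]) auto
        ultimately show ?thesis using True by simp
      qed simp
    qed
    also have "\<dots> = ennreal (1 / ?e) * (\<integral>\<^sup>+w. min 1 (Z n w) \<partial>M)" by (rule nn_integral_cmult) measurable
    finally show ?thesis .
  qed
  have "(\<lambda>n. ennreal (1 / ?e) * (\<integral>\<^sup>+w. min 1 (Z n w) \<partial>M)) \<longlonglongrightarrow> ennreal (1 / ?e) * 0"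
    by (intro ennreal_tendsto_cmult lim) auto
  then have "(\<lambda>n. ennreal (1 / ?e) * (\<integral>\<^sup>+w. min 1 (Z n w) \<partial>M)) \<longlonglongrightarrow> 0" by simp
  from tendsto_sandwich[OF always_eventually always_eventually tendsto_const this]
  have "(\<lambda>n. emeasure M {w \<in> space M. ennreal \<epsilon> < Z n w}) \<longlonglongrightarrow> 0"
    using bound by simp
  then have "(\<lambda>n. ennreal (measure M {w \<in> space M. ennreal \<epsilon> < Z n w})) \<longlonglongrightarrow> ennreal 0"
    by (simp add: emeasure_eq_measure)
  then show ?thesis by (subst (asm) tendsto_ennreal_iff) auto
qed

lemma nn_integral_min_tendsto_zero_AE:
  fixes Z :: "nat \<Rightarrow> 'a \<Rightarrow> ennreal"
  assumes Z[measurable]: "\<And>n. Z n \<in> borel_measurable M"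
    and lim: "AE w in M. (\<lambda>n. Z n w) \<longlonglongrightarrow> 0"
  shows "(\<lambda>n. \<integral>\<^sup>+w. min 1 (Z n w) \<partial>M) \<longlonglongrightarrow> 0"
proof -
  have "(\<lambda>n. \<integral>\<^sup>+w. min 1 (Z n w) \<partial>M) \<longlonglongrightarrow> (\<integral>\<^sup>+w. 0 \<partial>M)"
  proof (rule nn_integral_dominated_convergence[where w = "\<lambda>_. 1"])
    show "AE w in M. (\<lambda>n. min 1 (Z n w)) \<longlonglongrightarrow> 0"
      using lim
    proof eventually_elim
      case (elim w)
      then have "(\<lambda>n. min 1 (Z n w)) \<longlonglongrightarrow> min 1 0" by (intro tendsto_min tendsto_const)
      then show ?case by simp
    qed
  qed (auto simp: emeasure_space_1)
  then show ?thesis by simp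
qed

lemma AE_subsequence_if_nn_integral_min:
  fixes Z :: "nat \<Rightarrow> 'a \<Rightarrow> ennreal"
  assumes Z[measurable]: "\<And>n. Z n \<in> borel_measurable M"
    and lim: "(\<lambda>n. \<integral>\<^sup>+w. min 1 (Z n w) \<partial>M) \<longlonglongrightarrow> 0"
  shows "\<exists>r :: nat \<Rightarrow> nat. strict_mono r \<and> (AE w in M. (\<lambda>n. Z (r n) w) \<longlonglongrightarrow> 0)"
proof -
  let ?u = "\<lambda>n w. enn2real (min 1 (Z n w))"
  have le: "min 1 (Z n w) \<noteq> \<top>" for n w by (metis ennreal_one_neq_top min.cobounded1 top.extremum_unique)
  have eq: "ennreal (?u n w) = min 1 (Z n w)" for n w
    using le by (simp add: less_top[symmetric])
  have u1: "norm (?u n w) \<le> 1" for n w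
    using enn2real_mono[of "min 1 (Z n w)" 1] by simp
  have int: "integrable M (?u n)" for n
    by (rule integrable_const_bound[of _ 1]) (use u1 in auto)
  have "(\<integral>w. norm (?u n w) \<partial>M) = enn2real (\<integral>\<^sup>+w. min 1 (Z n w) \<partial>M)" for n
    by (subst integral_eq_nn_integral) (auto simp: eq)
  moreover have "(\<lambda>n. enn2real (\<integral>\<^sup>+w. min 1 (Z n w) \<partial>M)) \<longlonglongrightarrow> 0"
    using lim by (intro tendsto_enn2real) auto
  ultimately have "(\<lambda>n. \<integral>w. norm (?u n w) \<partial>M) \<longlonglongrightarrow> 0" by simp
  from tendsto_L1_AE_subseq[OF int this] obtain r :: "nat \<Rightarrow> nat"
    where r: "strict_mono r" "AE w in M. (\<lambda>n. ?u (r n) w) \<longlonglongrightarrow> 0" by blast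
  have "AE w in M. (\<lambda>n. Z (r n) w) \<longlonglongrightarrow> 0"
    using r(2)
  proof eventually_elim
    case (elim w)
    then have "(\<lambda>n. ennreal (?u (r n) w)) \<longlonglongrightarrow> ennreal 0" by (rule tendsto_ennrealI)
    then have m: "(\<lambda>n. min 1 (Z (r n) w)) \<longlonglongrightarrow> 0" by (simp add: eq)
    then have "eventually (\<lambda>n. min 1 (Z (r n) w) < 1) sequentially" by (rule order_tendstoD) simp
    then have "eventually (\<lambda>n. min 1 (Z (r n) w) = Z (r n) w) sequentially"
      by eventually_elim (auto simp: min_def)
    then show ?case using m by (rule Lim_transform_eventually[rotated])
  qed
  then show ?thesis using r(1) by blast
qed

end

section \<open>Translations are continuous in mean square\<close>

lemma nn_integral_square_tendsto_zero:
  fixes g :: "nat \<Rightarrow> real \<Rightarrow> 'b :: {second_countable_topology, real_normed_vector}"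
  assumes [measurable]: "\<And>n. g n \<in> borel_measurable lborel"
    and b: "\<And>n t. norm (g n t) \<le> K" and lim: "AE t in lborel. (\<lambda>n. g n t) \<longlonglongrightarrow> 0"
  shows "(\<lambda>n. \<integral>\<^sup>+t\<in>{a..b}. ennreal ((norm (g n t))\<^sup>2) \<partial>lborel) \<longlonglongrightarrow> 0"
proof -
  have "(\<lambda>n. \<integral>\<^sup>+t\<in>{a..b}. ennreal ((norm (g n t))\<^sup>2) \<partial>lborel) \<longlonglongrightarrow> integral\<^sup>N lborel (\<lambda>t::real. 0)"
  proof (rule nn_integral_dominated_convergence[where w = "\<lambda>t. ennreal (K\<^sup>2) * indicator {a..b} t"])
    show "AE t in lborel. ennreal ((norm (g n t))\<^sup>2) * indicator {a..b} t \<le> ennreal (K\<^sup>2) * indicator {a..b} t" for n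
      using b by (intro AE_I2 mult_right_mono ennreal_leI power_mono) auto
    show "AE t in lborel. (\<lambda>n. ennreal ((norm (g n t))\<^sup>2) * indicator {a..b} t) \<longlonglongrightarrow> 0"
      using lim
    proof eventually_elim
      case (elim t)
      then have "(\<lambda>n. (norm (g n t))\<^sup>2) \<longlonglongrightarrow> (norm (0::'b))\<^sup>2" by (intro tendsto_intros)
      then have "(\<lambda>n. ennreal ((norm (g n t))\<^sup>2)) \<longlonglongrightarrow> ennreal 0" by (intro tendsto_ennrealI) simp
      then show ?case by (cases "t \<in> {a..b}") auto
    qed
    show "(\<integral>\<^sup>+t. ennreal (K\<^sup>2) * indicator {a..b} t \<partial>lborel) < \<infinity>"
      by (subst nn_integral_cmult_indicator) (auto simp: ennreal_mult_less_top emeasure_lborel_Icc_eq)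
  qed auto
  then show ?thesis by simp
qed

text \<open>
  A bounded measurable \<open>f\<close> is the limit almost everywhere of continuous functions with the same bound,
  obtained by projecting continuous approximations to the ball of radius \<open>K\<close>. For continuous functions
  the claim is dominated convergence.
\<close>

lemma translation_L2_continuous:
  fixes f :: "real \<Rightarrow> 'b :: euclidean_space"
  assumes f[measurable]: "f \<in> borel_measurable borel" and K: "\<And>t. norm (f t) \<le> K" and r: "r \<longlonglongrightarrow> 0"
  shows "(\<lambda>n. l2_error (\<lambda>t. f (t - r n)) f) \<longlonglongrightarrow> 0"
proof -
  have "f \<in> borel_measurable lebesgue" using f by (intro measurable_completion) simp
  then have "f measurable_on UNIV" by (rule lebesgue_measurable_imp_measurable_on) simp
  then obtain N g where N: "negligible N" and g: "\<And>n. continuous_on UNIV (g n)"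
    and gf: "\<And>x. x \<notin> N \<Longrightarrow> (\<lambda>n. g n x) \<longlonglongrightarrow> f x"
    unfolding measurable_on_def by auto
  have K0: "0 \<le> K" using K[of 0] norm_ge_zero order_trans by blast
  let ?p = "closest_point (cball (0::'b) K)"
  have pc: "continuous_on UNIV ?p" using K0 by (intro continuous_on_closest_point) auto
  have pK: "norm (?p x) \<le> K" for x
    using closest_point_in_set[of "cball (0::'b) K" x] K0 by auto
  have pf: "?p (f t) = f t" for t using K by (intro closest_point_self) simp
  define h where "h n t = ?p (g n t)" for n t
  have hc: "continuous_on UNIV (h n)" for n
    unfolding h_def by (rule continuous_on_compose2[OF pc g]) simp
  then have [measurable]: "h n \<in> borel_measurable borel" for n by (rule borel_measurable_continuous_onI)
  have hK: "norm (h n t) \<le> K" for n t unfolding h_def by (rule pK)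
  have hf: "(\<lambda>n. h n t) \<longlonglongrightarrow> f t" if "t \<notin> N" for t
    unfolding h_def by (rule continuous_on_tendsto_compose[OF pc gf[OF that], unfolded pf]) auto
  have diffK: "norm (h n t - f t) \<le> 2 * K" for n t
    using norm_triangle_ineq4[of "h n t" "f t"] hK[of n t] K[of t] by linarith
  have AEN: "AE t in lborel. t \<notin> N"
  proof -
    have "N \<in> null_sets lebesgue" using N by (simp add: negligible_iff_null_sets)
    then have "AE t in lebesgue. t \<notin> N" by (rule AE_not_in)
    then show ?thesis using AE_completion_iff by blast
  qed
  have E: "(\<lambda>n. \<integral>\<^sup>+t\<in>{-1..2}. ennreal ((norm (h n t - f t))\<^sup>2) \<partial>lborel) \<longlonglongrightarrow> 0"
  proof (rule nn_integral_square_tendsto_zero[OF _ diffK])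
    show "AE t in lborel. (\<lambda>n. h n t - f t) \<longlonglongrightarrow> 0"
      using AEN
    proof eventually_elim
      case (elim t)
      from tendsto_diff[OF hf[OF elim] tendsto_const[of "f t"]] show ?case by simp
    qed
  qed simp
  show ?thesis
    unfolding l2_error_def
  proof (rule tendsto_zero_ennreal)
    fix e :: real assume "0 < e"
    then have "eventually (\<lambda>n. (\<integral>\<^sup>+t\<in>{-1..2}. ennreal ((norm (h n t - f t))\<^sup>2) \<partial>lborel) < ennreal (e / 16)) sequentially"
      by (intro order_tendstoD[OF E]) simp
    then obtain n where n: "(\<integral>\<^sup>+t\<in>{-1..2}. ennreal ((norm (h n t - f t))\<^sup>2) \<partial>lborel) < ennreal (e / 16)"
      using eventually_happens'[OF sequentially_bot] by blast
    have "(\<lambda>i. \<integral>\<^sup>+t\<in>{0..1}. ennreal ((norm (h n (t - r i) - h n t))\<^sup>2) \<partial>lborel) \<longlonglongrightarrow> 0"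
    proof (rule nn_integral_square_tendsto_zero[where K = "2 * K"])
      show "norm (h n (t - r i) - h n t) \<le> 2 * K" for i t
        using norm_triangle_ineq4[of "h n (t - r i)" "h n t"] hK[of n "t - r i"] hK[of n t] by linarith
      show "AE t in lborel. (\<lambda>i. h n (t - r i) - h n t) \<longlonglongrightarrow> 0"
      proof (rule AE_I2)
        fix t
        have "(\<lambda>i. t - r i) \<longlonglongrightarrow> t - 0" by (intro tendsto_intros r)
        then have "(\<lambda>i. h n (t - r i)) \<longlonglongrightarrow> h n (t - 0)"
          by (intro continuous_on_tendsto_compose[OF hc]) auto
        from tendsto_diff[OF this tendsto_const[of "h n t"]] show "(\<lambda>i. h n (t - r i) - h n t) \<longlonglongrightarrow> 0" by simp
      qed
    qed measurable
    then have "eventually (\<lambda>i. (\<integral>\<^sup>+t\<in>{0..1}. ennreal ((norm (h n (t - r i) - h n t))\<^sup>2) \<partial>lborel) < ennreal (e / 16)) sequentially"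
      using \<open>0 < e\<close> by (intro order_tendstoD) auto
    moreover have "eventually (\<lambda>i. \<bar>r i\<bar> < 1) sequentially"
      using tendsto_rabs[OF r] by (intro order_tendstoD) auto
    ultimately show "eventually (\<lambda>i. (\<integral>\<^sup>+t\<in>{0..1}. ennreal ((norm (f (t - r i) - f t))\<^sup>2) \<partial>lborel) < ennreal e) sequentially"
    proof eventually_elim
      case (elim i)
      have 1: "(\<integral>\<^sup>+t\<in>{0..1}. ennreal ((norm (f (t - r i) - h n (t - r i)))\<^sup>2) \<partial>lborel) \<le> ennreal (e / 16)"
      proof -
        let ?G = "\<lambda>t. ennreal ((norm (h n t - f t))\<^sup>2) * indicator {-1..2} t"
        have "(\<integral>\<^sup>+t\<in>{0..1}. ennreal ((norm (f (t - r i) - h n (t - r i)))\<^sup>2) \<partial>lborel) \<le> (\<integral>\<^sup>+t. ?G (- r i + 1 * t) \<partial>lborel)"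
          using elim(2) by (intro nn_integral_mono) (auto simp: indicator_def norm_minus_commute)
        also have "\<dots> = (\<integral>\<^sup>+t. ?G t \<partial>lborel)"
          by (subst nn_integral_real_affine[of ?G 1 "- r i"]) auto
        finally show ?thesis using n by simp
      qed
      have 2: "(\<integral>\<^sup>+t\<in>{0..1}. ennreal ((norm (h n t - f t))\<^sup>2) \<partial>lborel) \<le> ennreal (e / 16)"
      proof -
        have "(\<integral>\<^sup>+t\<in>{0..1}. ennreal ((norm (h n t - f t))\<^sup>2) \<partial>lborel) \<le> (\<integral>\<^sup>+t\<in>{-1..2}. ennreal ((norm (h n t - f t))\<^sup>2) \<partial>lborel)"
          by (intro nn_integral_mono) (auto simp: indicator_def)
        then show ?thesis using n by simp
      qed
      have "(\<integral>\<^sup>+t\<in>{0..1}. ennreal ((norm (f (t - r i) - f t))\<^sup>2) \<partial>lborel) \<le>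
        2 * (\<integral>\<^sup>+t\<in>{0..1}. ennreal ((norm (f (t - r i) - h n t))\<^sup>2) \<partial>lborel) + 2 * (\<integral>\<^sup>+t\<in>{0..1}. ennreal ((norm (h n t - f t))\<^sup>2) \<partial>lborel)"
        by (rule l2_error_triangle[unfolded l2_error_def]) measurable
      also have "\<dots> \<le> 2 * (2 * (\<integral>\<^sup>+t\<in>{0..1}. ennreal ((norm (f (t - r i) - h n (t - r i)))\<^sup>2) \<partial>lborel) +
          2 * (\<integral>\<^sup>+t\<in>{0..1}. ennreal ((norm (h n (t - r i) - h n t))\<^sup>2) \<partial>lborel)) + 2 * ennreal (e / 16)"
        by (intro add_mono mult_left_mono 2 l2_error_triangle[unfolded l2_error_def]) auto
      also have "\<dots> \<le> 2 * (2 * ennreal (e / 16) + 2 * ennreal (e / 16)) + 2 * ennreal (e / 16)"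
        using 1 elim(1) by (intro add_mono mult_left_mono) auto
      also have "\<dots> = ennreal (2 * (2 * (e / 16) + 2 * (e / 16)) + 2 * (e / 16))"
        using \<open>0 < e\<close> by (simp add: ennreal_plus[symmetric] ennreal_mult'[symmetric] flip: ennreal_numeral del: ennreal_plus)
      also have "\<dots> < ennreal e" using \<open>0 < e\<close> by (intro ennreal_lessI) auto
      finally show ?case .
    qed
  qed
qed

section \<open>Approximation by simple processes\<close>

lemma sum_indicator_cell:
  fixes \<xi> :: "nat \<Rightarrow> 'b :: real_vector" and \<tau> :: "nat \<Rightarrow> real"
  assumes \<tau>: "mono_on {..N} \<tau>" and i: "i < N" and t: "t \<in> {\<tau> i<..\<tau> (Suc i)}"
  shows "(\<Sum>j<N. indicator {\<tau> j<..\<tau> (Suc j)} t *\<^sub>R \<xi> j) = \<xi> i"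
proof -
  have "indicator {\<tau> j<..\<tau> (Suc j)} t *\<^sub>R \<xi> j = (if j = i then \<xi> i else 0)" if "j < N" for j
  proof (cases j i rule: linorder_cases)
    case less
    then have "\<tau> (Suc j) \<le> \<tau> i" using i by (intro mono_onD[OF \<tau>]) auto
    then have "t \<notin> {\<tau> j<..\<tau> (Suc j)}" using t by auto
    then show ?thesis using less by simp
  next
    case equal
    then show ?thesis using t by (simp add: indicator_def)
  next
    case greater
    then have "\<tau> (Suc i) \<le> \<tau> j" using that by (intro mono_onD[OF \<tau>]) auto
    then have "t \<notin> {\<tau> j<..\<tau> (Suc j)}" using t by auto
    then show ?thesis using greater by simp
  qed
  then have "(\<Sum>j<N. indicator {\<tau> j<..\<tau> (Suc j)} t *\<^sub>R \<xi> j) = (\<Sum>j<N. if j = i then \<xi> i else 0)"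
    by (intro sum.cong) auto
  also have "\<dots> = \<xi> i" using i by simp
  finally show ?thesis .
qed

text \<open>
  The grid of mesh \<open>1/N\<close> with offset \<open>\<theta>/N\<close>; the point after the last one below 1 is put at 1.
\<close>

definition shifted_grid :: "nat \<Rightarrow> real \<Rightarrow> nat \<Rightarrow> real" where
  "shifted_grid N \<theta> i = (if i < N then (real i + \<theta>) / real N else 1)"

lemma shifted_grid_mono:
  assumes "0 < N" "\<theta> \<in> {0..1}"
  shows "mono_on {..N} (shifted_grid N \<theta>)" "shifted_grid N \<theta> ` {..N} \<subseteq> {0..1}"
proof -
  have le1: "(real i + \<theta>) / real N \<le> 1" if "i < N" for i
  proof -
    have "real i + 1 \<le> real N" using that by simp
    then show ?thesis using assms by (simp add: divide_le_eq)
  qed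
  show "mono_on {..N} (shifted_grid N \<theta>)"
    using le1 assms by (auto intro!: mono_onI divide_right_mono simp: shifted_grid_def)
  show "shifted_grid N \<theta> ` {..N} \<subseteq> {0..1}"
    using le1 assms by (auto simp: shifted_grid_def)
qed

text \<open>
  Sampling at the last grid point before \<open>t\<close> means evaluating at \<open>t - y/N\<close> for some \<open>y\<close> between 0 and 1,
  where \<open>y + \<theta>\<close> is one of two numbers that depend on \<open>N\<close> and \<open>t\<close> only. Before the first grid point
  the sampled process is 0, as is \<open>f\<close> at nonpositive times.
\<close>

lemma shifted_sample:
  fixes f :: "real \<Rightarrow> 'b :: real_vector" and \<theta> t :: real
  assumes N: "0 < N" and \<theta>: "\<theta> \<in> {0..1}" and t: "0 < t" "t \<le> 1" and f0: "\<And>t. t \<le> 0 \<Longrightarrow> f t = 0"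
  shows "\<exists>y\<in>{0..1}. (y = N * t - \<lceil>N * t\<rceil> + 1 - \<theta> \<or> y = N * t - \<lceil>N * t\<rceil> + 2 - \<theta>) \<and>
    (\<Sum>j<N. indicator {shifted_grid N \<theta> j<..shifted_grid N \<theta> (Suc j)} t *\<^sub>R f (shifted_grid N \<theta> j)) = f (t - y / N)"
proof (cases "t \<le> \<theta> / N")
  case True
  then have c: "N * t \<le> \<theta>" using N by (simp add: field_simps)
  have c0: "0 < N * t" using N t by simp
  have "\<lceil>N * t\<rceil> = 1" using c c0 \<theta> by (intro ceiling_unique) auto
  define y where "y = N * t - \<lceil>N * t\<rceil> + 2 - \<theta>"
  have y: "y = N * t + 1 - \<theta>" by (simp add: y_def \<open>\<lceil>N * t\<rceil> = 1\<close>)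
  have "y \<in> {0..1}" using c c0 \<theta> by (auto simp: y)
  moreover have "f (t - y / N) = 0" using N \<theta> by (intro f0) (simp add: y field_simps)
  moreover have "(\<Sum>j<N. indicator {shifted_grid N \<theta> j<..shifted_grid N \<theta> (Suc j)} t *\<^sub>R f (shifted_grid N \<theta> j)) = 0"
  proof (rule sum.neutral, rule ballI)
    fix j assume "j \<in> {..<N}"
    then have "shifted_grid N \<theta> 0 \<le> shifted_grid N \<theta> j" by (intro mono_onD[OF shifted_grid_mono(1)[OF N \<theta>]]) auto
    moreover have "t \<le> shifted_grid N \<theta> 0" using True N by (simp add: shifted_grid_def)
    ultimately show "indicator {shifted_grid N \<theta> j<..shifted_grid N \<theta> (Suc j)} t *\<^sub>R f (shifted_grid N \<theta> j) = 0"
      by (auto simp: indicator_def)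
  qed
  ultimately show ?thesis using y_def by (intro bexI[of _ y]) auto
next
  case False
  let ?\<tau> = "shifted_grid N \<theta>"
  define i where "i = Max {i. i < N \<and> ?\<tau> i < t}"
  have fin: "finite {i. i < N \<and> ?\<tau> i < t}" by simp
  have "0 \<in> {i. i < N \<and> ?\<tau> i < t}" using False N by (simp add: shifted_grid_def)
  then have "i \<in> {i. i < N \<and> ?\<tau> i < t}" unfolding i_def using fin by (intro Max_in) auto
  then have i: "i < N" "?\<tau> i < t" by auto
  have ti: "t \<le> ?\<tau> (Suc i)"
  proof (rule ccontr)
    assume a: "\<not> t \<le> ?\<tau> (Suc i)"
    then have "Suc i < N" using t by (cases "Suc i < N") (auto simp: shifted_grid_def)
    then have "Suc i \<in> {i. i < N \<and> ?\<tau> i < t}" using a by simp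
    then have "Suc i \<le> i" unfolding i_def by (intro Max_ge[OF fin])
    then show False by simp
  qed
  have lo: "real i + \<theta> < N * t" using i N by (simp add: shifted_grid_def divide_less_eq mult.commute)
  have hi: "N * t \<le> real i + \<theta> + 1"
  proof (cases "Suc i < N")
    case True
    then show ?thesis using ti N by (simp add: shifted_grid_def le_divide_eq mult.commute)
  next
    case False
    then have "real N = real i + 1" using i by auto
    moreover have "N * t \<le> N" using t by (simp add: mult_left_le)
    ultimately show ?thesis using \<theta> unfolding atLeastAtMost_iff by linarith
  qed
  define y where "y = N * t - \<theta> - real i"
  have "y \<in> {0..1}" using lo hi by (auto simp: y_def)
  moreover have "y = N * t - \<lceil>N * t\<rceil> + 1 - \<theta> \<or> y = N * t - \<lceil>N * t\<rceil> + 2 - \<theta>"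
  proof -
    have "int i + 1 \<le> \<lceil>N * t\<rceil>" "\<lceil>N * t\<rceil> \<le> int i + 2" using lo hi \<theta> by (auto simp: le_ceiling_iff ceiling_le_iff)
    then have "\<lceil>N * t\<rceil> = int i + 1 \<or> \<lceil>N * t\<rceil> = int i + 2" by linarith
    then show ?thesis by (auto simp: y_def)
  qed
  moreover have "t - y / N = ?\<tau> i" using i N by (simp add: y_def shifted_grid_def field_simps)
  moreover have "(\<Sum>j<N. indicator {?\<tau> j<..?\<tau> (Suc j)} t *\<^sub>R f (?\<tau> j)) = f (?\<tau> i)"
    using i ti by (intro sum_indicator_cell[OF shifted_grid_mono(1)[OF N \<theta>]]) auto
  ultimately show ?thesis by (intro bexI[of _ y]) auto
qed

context classical_wiener
begin

text \<open>
  On a fixed grid the samples of a merely measurable \<open>f\<close> say little about \<open>f\<close>. On average over the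
  offset \<open>\<theta>\<close> of the grid, however, the mean square error is at most twice the average of
  \<open>\<bar>f(t - y/N) - f(t)\<bar>\<^sup>2\<close> over \<open>t\<close>, \<open>y\<close> and the probability space, by \<open>shifted_sample\<close>. This tends
  to 0 as \<open>N\<close> grows because translations are continuous in mean square, so some offset is good enough. The
  sampled process is adapted since its values are values of \<open>f\<close> at the grid points.
\<close>

lemma bounded_simple_approximation:
  fixes f :: "real \<Rightarrow> (real \<Rightarrow> real ^ 'n) \<Rightarrow> real ^ 'n"
  assumes f: "(\<lambda>p. f (fst p) (snd p)) \<in> borel_measurable (borel \<Otimes>\<^sub>M M)"
    and ad: "\<And>t. t \<in> {0..1} \<Longrightarrow> f t \<in> borel_measurable (F t)"
    and K: "\<And>t w. norm (f t w) \<le> K" and f0: "\<And>t w. t \<le> 0 \<Longrightarrow> f t w = 0"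
    and e: "0 < (e :: real)"
  shows "\<exists>k \<tau> \<xi>. simple_process \<mu> k \<tau> \<xi> \<and>
    (\<integral>\<^sup>+w. l2_error (\<lambda>t. simple_eval k \<tau> \<xi> t w) (\<lambda>t. f t w) \<partial>M) \<le> ennreal e"
proof -
  interpret M: prob_space M by (rule prob_space_M)
  define q where "q N w t y = ennreal ((norm (f (t - y / real N) w - f t w))\<^sup>2)" for N w t y
  have f'[measurable (raw)]: "(\<lambda>x. f (g x) (h x)) \<in> borel_measurable L"
    if "g \<in> borel_measurable L" "h \<in> measurable L M" for g h and L :: "'z measure"
    using measurable_compose[OF measurable_Pair[OF that] f] by simp
  have K0: "0 \<le> K" using K[of 0 undefined] norm_ge_zero order_trans by blast
  have qK: "q N w t y \<le> ennreal ((2 * K)\<^sup>2)" for N w t y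
  proof -
    have "norm (f (t - y / real N) w - f t w) \<le> 2 * K"
      using norm_triangle_ineq4[of "f (t - y / real N) w" "f t w"] K[of "t - y / real N" w] K[of t w] by linarith
    then show ?thesis unfolding q_def by (intro ennreal_leI power_mono) auto
  qed
  define B where "B N = (\<integral>\<^sup>+w. (\<integral>\<^sup>+y\<in>{0..1}. (\<integral>\<^sup>+t\<in>{0..1}. q N w t y \<partial>lborel) \<partial>lborel) \<partial>M)" for N
  have in1: "(\<integral>\<^sup>+t\<in>{0..1}. q N w t y \<partial>lborel) \<le> ennreal ((2 * K)\<^sup>2)" for N w y
  proof -
    have "(\<integral>\<^sup>+t\<in>{0..1}. q N w t y \<partial>lborel) \<le> (\<integral>\<^sup>+t\<in>{0..1::real}. ennreal ((2 * K)\<^sup>2) \<partial>lborel)"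
      using qK by (intro nn_integral_mono mult_right_mono) auto
    also have "\<dots> = ennreal ((2 * K)\<^sup>2)" by (subst nn_integral_cmult_indicator) auto
    finally show ?thesis .
  qed
  have in2: "(\<integral>\<^sup>+y\<in>{0..1}. (\<integral>\<^sup>+t\<in>{0..1}. q N w t y \<partial>lborel) \<partial>lborel) \<le> ennreal ((2 * K)\<^sup>2)" for N w
  proof -
    have "(\<integral>\<^sup>+y\<in>{0..1}. (\<integral>\<^sup>+t\<in>{0..1}. q N w t y \<partial>lborel) \<partial>lborel) \<le> (\<integral>\<^sup>+y\<in>{0..1::real}. ennreal ((2 * K)\<^sup>2) \<partial>lborel)"
      using in1 by (intro nn_integral_mono mult_right_mono) auto
    also have "\<dots> = ennreal ((2 * K)\<^sup>2)" by (subst nn_integral_cmult_indicator) auto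
    finally show ?thesis .
  qed
  have fw: "f' \<in> borel_measurable borel" if "w \<in> space M" "f' = (\<lambda>t. f t w)" for w f'
    unfolding that(2) using that(1) by (intro f') auto
  have qty: "(\<lambda>p. q N w (snd p) (fst p)) \<in> borel_measurable (lborel \<Otimes>\<^sub>M lborel)" if "w \<in> space M" for N w
    unfolding q_def using that by measurable
  have qwyt: "(\<lambda>p. q N (fst (fst p)) (snd p) (snd (fst p)) * indicator {0..1} (snd p)) \<in> borel_measurable ((M \<Otimes>\<^sub>M lborel) \<Otimes>\<^sub>M lborel)" for N
    unfolding q_def by measurable
  have qwy: "(\<lambda>p. (\<integral>\<^sup>+t\<in>{0..1}. q N (fst p) t (snd p) \<partial>lborel) * indicator {0..1} (snd p)) \<in> borel_measurable (M \<Otimes>\<^sub>M lborel)" for N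
    using lborel.borel_measurable_nn_integral_fst[OF qwyt] by (intro borel_measurable_times_ennreal) auto
  have qw: "(\<lambda>w. (\<integral>\<^sup>+y\<in>{0..1}. (\<integral>\<^sup>+t\<in>{0..1}. q N w t y \<partial>lborel) \<partial>lborel)) \<in> borel_measurable M" for N
    using lborel.borel_measurable_nn_integral_fst[OF qwy] by simp
  have "(\<lambda>n. B (Suc n)) \<longlonglongrightarrow> (\<integral>\<^sup>+w. 0 \<partial>M)"
    unfolding B_def
  proof (rule nn_integral_dominated_convergence[where w = "\<lambda>_. ennreal ((2 * K)\<^sup>2)"])
    show "AE w in M. (\<lambda>n. (\<integral>\<^sup>+y\<in>{0..1}. (\<integral>\<^sup>+t\<in>{0..1}. q (Suc n) w t y \<partial>lborel) \<partial>lborel)) \<longlonglongrightarrow> 0"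
    proof (rule AE_I2)
      fix w assume w: "w \<in> space M"
      have "(\<lambda>n. (\<integral>\<^sup>+y\<in>{0..1}. (\<integral>\<^sup>+t\<in>{0..1}. q (Suc n) w t y \<partial>lborel) \<partial>lborel)) \<longlonglongrightarrow> integral\<^sup>N lborel (\<lambda>y::real. 0)"
      proof (rule nn_integral_dominated_convergence[where w = "\<lambda>y. ennreal ((2 * K)\<^sup>2) * indicator {0..1} y"])
        show "(\<lambda>y. (\<integral>\<^sup>+t\<in>{0..1}. q (Suc n) w t y \<partial>lborel) * indicator {0..1} y) \<in> borel_measurable lborel" for n
          using measurable_Pair2[OF qwy w, of "Suc n"] by simp
        show "AE y in lborel. (\<integral>\<^sup>+t\<in>{0..1}. q (Suc n) w t y \<partial>lborel) * indicator {0..1} y \<le> ennreal ((2 * K)\<^sup>2) * indicator {0..1} y" for n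
          using in1 by (intro AE_I2 mult_right_mono) auto
        show "(\<integral>\<^sup>+y. ennreal ((2 * K)\<^sup>2) * indicator {0..1::real} y \<partial>lborel) < \<infinity>"
          by (subst nn_integral_cmult_indicator) auto
        show "AE y in lborel. (\<lambda>n. (\<integral>\<^sup>+t\<in>{0..1}. q (Suc n) w t y \<partial>lborel) * indicator {0..1} y) \<longlonglongrightarrow> 0"
        proof (rule AE_I2)
          fix y :: real
          have "(\<lambda>n. y * inverse (real (Suc n))) \<longlonglongrightarrow> y * 0"
            by (intro tendsto_mult tendsto_const LIMSEQ_inverse_real_of_nat)
          then have r: "(\<lambda>n. y / real (Suc n)) \<longlonglongrightarrow> 0" by (simp add: divide_inverse)
          have "(\<lambda>n. (\<integral>\<^sup>+t\<in>{0..1}. q (Suc n) w t y \<partial>lborel)) \<longlonglongrightarrow> 0"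
            unfolding q_def by (rule translation_L2_continuous[OF fw[OF w refl] K r, unfolded l2_error_def])
          then show "(\<lambda>n. (\<integral>\<^sup>+t\<in>{0..1}. q (Suc n) w t y \<partial>lborel) * indicator {0..1} y) \<longlonglongrightarrow> 0"
            by (cases "y \<in> {0..1}") auto
        qed
      qed auto
      then show "(\<lambda>n. (\<integral>\<^sup>+y\<in>{0..1}. (\<integral>\<^sup>+t\<in>{0..1}. q (Suc n) w t y \<partial>lborel) \<partial>lborel)) \<longlonglongrightarrow> 0" by simp
    qed
  qed (use qw in2 in \<open>auto simp: emeasure_space_1\<close>)
  then have "(\<lambda>n. B (Suc n)) \<longlonglongrightarrow> 0" by simp
  then have "eventually (\<lambda>n. B (Suc n) < ennreal (e / 4)) sequentially" using e by (intro order_tendstoD) auto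
  then obtain n where n: "B (Suc n) < ennreal (e / 4)" using eventually_happens'[OF sequentially_bot] by blast
  define N where "N = Suc n"
  have N: "0 < N" and BN: "B N < ennreal (e / 4)" using n by (auto simp: N_def)
  define a where "a c t = real N * t - of_int \<lceil>real N * t\<rceil> + c" for c t
  define q1 where "q1 w t y = q N w t y * indicator {0..1} y" for w t y
  define err where "err \<theta> w t = (q1 w t (a 1 t - \<theta>) + q1 w t (a 2 t - \<theta>)) * indicator {0..1} t" for \<theta> w t
  have am[measurable]: "a c \<in> borel_measurable borel" for c unfolding a_def by measurable
  have err_m: "(\<lambda>p. err (snd p) (fst (fst p)) (snd (fst p))) \<in> borel_measurable ((M \<Otimes>\<^sub>M lborel) \<Otimes>\<^sub>M lborel)"
    unfolding err_def q1_def q_def by measurable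
  have err_m2: "(\<lambda>p. err (snd (fst p)) (fst (fst p)) (snd p)) \<in> borel_measurable ((M \<Otimes>\<^sub>M lborel) \<Otimes>\<^sub>M lborel)"
    unfolding err_def q1_def q_def by measurable
  have err_w: "(\<lambda>p. err (fst p) w (snd p)) \<in> borel_measurable (lborel \<Otimes>\<^sub>M lborel)" if "w \<in> space M" for w
    unfolding err_def q1_def q_def using that by measurable
  have q1_int: "(\<integral>\<^sup>+\<theta>. q1 w t (c - \<theta>) \<partial>lborel) = (\<integral>\<^sup>+y\<in>{0..1}. q N w t y \<partial>lborel)" if w: "w \<in> space M" for w t c
  proof -
    have "q1 w t \<in> borel_measurable borel"
      unfolding q1_def q_def using w by measurable
    from nn_integral_real_affine[OF this, of "-1" c] show ?thesis by (simp add: q1_def)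
  qed
  \<comment> \<open>for fixed \<open>w\<close> and \<open>t\<close>, integrating over all \<open>\<theta>\<close> turns each of the two terms into an integral over \<open>y\<close>\<close>
  have tot: "(\<integral>\<^sup>+\<theta>. \<integral>\<^sup>+w. \<integral>\<^sup>+t. err \<theta> w t \<partial>lborel \<partial>M \<partial>lborel) = 2 * B N"
  proof -
    interpret P: pair_sigma_finite M "lborel :: real measure" ..
    have "(\<integral>\<^sup>+\<theta>. \<integral>\<^sup>+w. \<integral>\<^sup>+t. err \<theta> w t \<partial>lborel \<partial>M \<partial>lborel) = (\<integral>\<^sup>+w. \<integral>\<^sup>+\<theta>. \<integral>\<^sup>+t. err \<theta> w t \<partial>lborel \<partial>lborel \<partial>M)"
      using lborel.borel_measurable_nn_integral_fst[OF err_m2] by (intro P.Fubini') (simp add: case_prod_beta')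
    also have "\<dots> = (\<integral>\<^sup>+w. 2 * (\<integral>\<^sup>+y\<in>{0..1}. (\<integral>\<^sup>+t\<in>{0..1}. q N w t y \<partial>lborel) \<partial>lborel) \<partial>M)"
    proof (rule nn_integral_cong)
      fix w assume w: "w \<in> space M"
      have q1m[measurable]: "q1 w t \<in> borel_measurable borel" for t
        unfolding q1_def q_def using w by measurable
      have "(\<integral>\<^sup>+\<theta>. \<integral>\<^sup>+t. err \<theta> w t \<partial>lborel \<partial>lborel) = (\<integral>\<^sup>+t. \<integral>\<^sup>+\<theta>. err \<theta> w t \<partial>lborel \<partial>lborel)"
        using err_w[OF w] by (intro lborel_pair.Fubini'[symmetric]) (simp add: case_prod_beta')
      also have "\<dots> = (\<integral>\<^sup>+t. 2 * ((\<integral>\<^sup>+y\<in>{0..1}. q N w t y \<partial>lborel) * indicator {0..1} t) \<partial>lborel)"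
      proof (rule nn_integral_cong)
        fix t :: real
        have "(\<integral>\<^sup>+\<theta>. err \<theta> w t \<partial>lborel) = ((\<integral>\<^sup>+\<theta>. q1 w t (a 1 t - \<theta>) \<partial>lborel) + (\<integral>\<^sup>+\<theta>. q1 w t (a 2 t - \<theta>) \<partial>lborel)) * indicator {0..1} t"
          unfolding err_def by (subst nn_integral_multc) (auto simp: nn_integral_add)
        then show "(\<integral>\<^sup>+\<theta>. err \<theta> w t \<partial>lborel) = 2 * ((\<integral>\<^sup>+y\<in>{0..1}. q N w t y \<partial>lborel) * indicator {0..1} t)"
          unfolding q1_int[OF w] by (simp add: mult_2 distrib_right)
      qed
      also have "\<dots> = 2 * (\<integral>\<^sup>+t. (\<integral>\<^sup>+y. q N w t y * indicator {0..1} y * indicator {0..1} t \<partial>lborel) \<partial>lborel)"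
      proof -
        have m: "(\<lambda>p. q N w (fst p) (snd p) * indicator {0..1} (snd p) * indicator {0..1} (fst p)) \<in> borel_measurable (lborel \<Otimes>\<^sub>M lborel)"
          unfolding q_def using w by measurable
        have "(\<integral>\<^sup>+y\<in>{0..1}. q N w t y \<partial>lborel) * indicator {0..1} t = (\<integral>\<^sup>+y. q N w t y * indicator {0..1} y * indicator {0..1} t \<partial>lborel)" for t
          using nn_integral_multc[of "\<lambda>y. q1 w t y" lborel "indicator {0..1} t"] q1m[of t]
          unfolding q1_def[abs_def] by simp
        then show ?thesis using lborel.borel_measurable_nn_integral_fst[OF m] by (simp add: nn_integral_cmult)
      qed
      also have "\<dots> = 2 * (\<integral>\<^sup>+y. (\<integral>\<^sup>+t. q N w t y * indicator {0..1} y * indicator {0..1} t \<partial>lborel) \<partial>lborel)"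
      proof -
        have m: "(\<lambda>p. q N w (snd p) (fst p) * indicator {0..1} (fst p) * indicator {0..1} (snd p)) \<in> borel_measurable (lborel \<Otimes>\<^sub>M lborel)"
          unfolding q_def using w by measurable
        show ?thesis using m by (subst lborel_pair.Fubini') (simp_all add: case_prod_beta')
      qed
      also have "\<dots> = 2 * (\<integral>\<^sup>+y\<in>{0..1}. (\<integral>\<^sup>+t\<in>{0..1}. q N w t y \<partial>lborel) \<partial>lborel)"
        by (intro arg_cong[of _ _ "\<lambda>x. 2 * x"] nn_integral_cong) (auto simp: indicator_def)
      finally show "(\<integral>\<^sup>+\<theta>. \<integral>\<^sup>+t. err \<theta> w t \<partial>lborel \<partial>lborel) = 2 * (\<integral>\<^sup>+y\<in>{0..1}. (\<integral>\<^sup>+t\<in>{0..1}. q N w t y \<partial>lborel) \<partial>lborel)" .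
    qed
    also have "\<dots> = 2 * B N" unfolding B_def using qw by (rule nn_integral_cmult)
    finally show ?thesis .
  qed
  have "\<exists>\<theta>\<in>{0..1}. (\<integral>\<^sup>+w. \<integral>\<^sup>+t. err \<theta> w t \<partial>lborel \<partial>M) \<le> ennreal e"
  proof (rule ccontr)
    assume "\<not> ?thesis"
    then have gt: "ennreal e \<le> (\<integral>\<^sup>+w. \<integral>\<^sup>+t. err \<theta> w t \<partial>lborel \<partial>M)" if "\<theta> \<in> {0..1}" for \<theta>
      using that by (meson linear)
    have "ennreal e = (\<integral>\<^sup>+\<theta>. ennreal e * indicator {0..1::real} \<theta> \<partial>lborel)"
      by (subst nn_integral_cmult_indicator) auto
    also have "\<dots> \<le> (\<integral>\<^sup>+\<theta>. \<integral>\<^sup>+w. \<integral>\<^sup>+t. err \<theta> w t \<partial>lborel \<partial>M \<partial>lborel)"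
      using gt by (intro nn_integral_mono) (auto simp: indicator_def)
    also have "\<dots> = 2 * B N" by (rule tot)
    also have "\<dots> \<le> 2 * ennreal (e / 4)" using BN by (intro mult_left_mono) auto
    also have "\<dots> = ennreal (e / 2)" using e by (simp flip: ennreal_mult' ennreal_numeral)
    also have "\<dots> < ennreal e" using e by (intro ennreal_lessI) auto
    finally show False by simp
  qed
  then obtain \<theta> where \<theta>: "\<theta> \<in> {0..1}" and le: "(\<integral>\<^sup>+w. \<integral>\<^sup>+t. err \<theta> w t \<partial>lborel \<partial>M) \<le> ennreal e" by blast
  let ?\<tau> = "shifted_grid N \<theta>"
  let ?\<xi> = "\<lambda>i. f (?\<tau> i)"
  have "simple_process \<mu> N ?\<tau> ?\<xi>"
    unfolding simple_process_def
  proof (intro conjI allI impI)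
    show "mono_on {..N} ?\<tau>" "?\<tau> ` {..N} \<subseteq> {0..1}" using shifted_grid_mono[OF N \<theta>] by auto
    fix i assume "i < N"
    then have "?\<tau> i \<in> {0..1}" by (intro subsetD[OF shifted_grid_mono(2)[OF N \<theta>]]) auto
    then show "?\<xi> i \<in> borel_measurable (F (?\<tau> i))" by (rule ad)
    show "bounded (?\<xi> i ` space \<mu>)" using K by (auto simp: bounded_iff)
  qed
  moreover have "(\<integral>\<^sup>+w. l2_error (\<lambda>t. simple_eval N ?\<tau> ?\<xi> t w) (\<lambda>t. f t w) \<partial>M) \<le> (\<integral>\<^sup>+w. \<integral>\<^sup>+t. err \<theta> w t \<partial>lborel \<partial>M)"
    unfolding l2_error_def
  proof (rule nn_integral_mono, rule nn_integral_mono_AE)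
    fix w
    have "AE t in lborel. t \<noteq> (0 :: real)" by (rule AE_lborel_singleton)
    then show "AE t in lborel. ennreal ((norm (simple_eval N ?\<tau> ?\<xi> t w - f t w))\<^sup>2) * indicator {0..1} t \<le> err \<theta> w t"
    proof eventually_elim
      case (elim t)
      show ?case
      proof (cases "t \<in> {0..1}")
        case True
        then have t: "0 < t" "t \<le> 1" using elim by auto
        obtain y where y: "y \<in> {0..1}" "y = a 1 t - \<theta> \<or> y = a 2 t - \<theta>" "simple_eval N ?\<tau> ?\<xi> t w = f (t - y / N) w"
          using shifted_sample[of N \<theta> t "\<lambda>t. f t w", OF N \<theta> t f0] unfolding simple_eval_def a_def by blast
        have "ennreal ((norm (simple_eval N ?\<tau> ?\<xi> t w - f t w))\<^sup>2) = q1 w t y"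
          using y by (simp add: q1_def q_def)
        also have "\<dots> \<le> q1 w t (a 1 t - \<theta>) + q1 w t (a 2 t - \<theta>)" using y(2) by auto
        finally show ?thesis using True by (simp add: err_def)
      qed (simp add: err_def)
    qed
  qed
  ultimately show ?thesis using le order_trans by blast
qed

end

lemma simple_eval_borel: "(\<lambda>t. simple_eval k \<tau> \<xi> t w) \<in> borel_measurable borel"
  unfolding simple_eval_def by measurable

text \<open>
  A density is specified only for times in \<open>[0,1]\<close>; the version that vanishes elsewhere is measurable on
  the whole line.
\<close>

definition path_part :: "(real \<Rightarrow> 'a \<Rightarrow> 'b) \<Rightarrow> real \<Rightarrow> 'a \<Rightarrow> 'b :: real_vector" where
  "path_part v t w = indicator {0..1} t *\<^sub>R v t w"

context classical_wiener
begin

lemma path_part_joint: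
  assumes "L0a \<mu> u v"
  shows "(\<lambda>p. path_part v (fst p) (snd p)) \<in> borel_measurable (borel \<Otimes>\<^sub>M M)"
proof -
  let ?\<Omega> = "{0..1::real} \<times> (UNIV :: (real \<Rightarrow> real ^ 'n) set)"
  have v: "(\<lambda>(t, w). v t w) \<in> borel_measurable (restrict_space borel {0..1} \<Otimes>\<^sub>M M)"
    using assms unfolding L0a_def by auto
  have \<Omega>: "?\<Omega> \<inter> space (borel \<Otimes>\<^sub>M M) \<in> sets (borel \<Otimes>\<^sub>M M)"
  proof -
    have "?\<Omega> \<inter> space (borel \<Otimes>\<^sub>M M) = {0..1} \<times> space M" by (auto simp: space_pair_measure)
    then show ?thesis by auto
  qed
  have "(\<lambda>p. (fst p, snd p)) \<in> measurable (restrict_space (borel \<Otimes>\<^sub>M M) ?\<Omega>) (restrict_space borel {0..1} \<Otimes>\<^sub>M M)"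
    by (intro measurable_Pair measurable_restrict_space2 measurable_restrict_space1 measurable_fst measurable_snd)
       (auto simp: space_restrict_space)
  from measurable_compose[OF this v]
  have "(\<lambda>p. v (fst p) (snd p)) \<in> borel_measurable (restrict_space (borel \<Otimes>\<^sub>M M) ?\<Omega>)"
    by (simp add: case_prod_beta')
  from this[unfolded borel_measurable_restrict_space_iff[OF \<Omega>]]
  have "(\<lambda>p. indicator ?\<Omega> p *\<^sub>R v (fst p) (snd p)) \<in> borel_measurable (borel \<Otimes>\<^sub>M M)" .
  moreover have "indicator ?\<Omega> p *\<^sub>R v (fst p) (snd p) = path_part v (fst p) (snd p)" for p
    by (cases p) (auto simp: path_part_def indicator_def)
  ultimately show ?thesis by simp
qed

lemma path_part_measurable_time:
  assumes "L0a \<mu> u v" "w \<in> space M"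
  shows "(\<lambda>t. path_part v t w) \<in> borel_measurable borel"
  using measurable_Pair1[OF path_part_joint[OF assms(1)] assms(2)] by simp

lemma simple_eval_joint:
  assumes s: "simple_process \<mu> k \<tau> \<xi>"
  shows "(\<lambda>p. simple_eval k \<tau> \<xi> (snd p) (fst p)) \<in> borel_measurable (M \<Otimes>\<^sub>M lborel)"
proof -
  have [measurable]: "\<xi> i \<in> borel_measurable M" if "i < k" for i
    by (rule simple_process_value_measurable[OF s that])
  show ?thesis unfolding simple_eval_def by measurable
qed

lemma l2_error_path_part: "l2_error x (\<lambda>t. v t w) = l2_error x (\<lambda>t. path_part v t w)"
  by (intro l2_error_cong) (auto simp: path_part_def)

lemma l2_error_measurable:
  assumes x: "(\<lambda>p. x (snd p) (fst p)) \<in> borel_measurable (M \<Otimes>\<^sub>M lborel)"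
    and y: "(\<lambda>p. y (snd p) (fst p)) \<in> borel_measurable (M \<Otimes>\<^sub>M lborel)"
  shows "(\<lambda>w. l2_error (\<lambda>t. x t w :: real ^ 'n) (\<lambda>t. y t w)) \<in> borel_measurable M"
proof -
  note [measurable] = x y
  have "(\<lambda>p. ennreal ((norm (x (snd p) (fst p) - y (snd p) (fst p)))\<^sup>2) * indicator {0..1} (snd p)) \<in> borel_measurable (M \<Otimes>\<^sub>M lborel)"
    by measurable
  from lborel.borel_measurable_nn_integral_fst[OF this] show ?thesis by (simp add: l2_error_def)
qed

lemma path_part_joint':
  assumes "L0a \<mu> u v"
  shows "(\<lambda>p. path_part v (snd p) (fst p)) \<in> borel_measurable (M \<Otimes>\<^sub>M lborel)"
proof -
  have "(\<lambda>p. (snd p, fst p)) \<in> measurable (M \<Otimes>\<^sub>M lborel) (borel \<Otimes>\<^sub>M M)" by measurable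
  from measurable_compose[OF this path_part_joint[OF assms]] show ?thesis by simp
qed

lemma simple_error_measurable:
  assumes "L0a \<mu> u v" "simple_process \<mu> k \<tau> \<xi>"
  shows "(\<lambda>w. l2_error (\<lambda>t. simple_eval k \<tau> \<xi> t w) (\<lambda>t. v t w)) \<in> borel_measurable M"
  unfolding l2_error_path_part[where v = v]
  by (rule l2_error_measurable) (rule simple_eval_joint[OF assms(2)], rule path_part_joint'[OF assms(1)])

text \<open>
  Truncation reduces this to bounded processes: since almost every path of \<open>v\<close> is square integrable,
  the truncated processes \<open>f n\<close> converge to \<open>v\<close> in mean square in time by dominated convergence.
\<close>

lemma simple_approximation:
  assumes L: "L0a \<mu> u v"
  shows "\<exists>k \<tau> \<xi>. (\<forall>n. simple_process \<mu> (k n) (\<tau> n) (\<xi> n)) \<and>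
    (\<lambda>n. \<integral>\<^sup>+w. min 1 (l2_error (\<lambda>t. simple_eval (k n) (\<tau> n) (\<xi> n) t w) (\<lambda>t. v t w)) \<partial>M) \<longlonglongrightarrow> 0"
proof -
  interpret M: prob_space M by (rule prob_space_M)
  define f where "f n t w = indicator {0<..1} t *\<^sub>R (if norm (path_part v t w) \<le> real n then path_part v t w else 0)" for n :: nat and t w
  note [measurable] = path_part_joint[OF L]
  have f_joint: "(\<lambda>p. f n (fst p) (snd p)) \<in> borel_measurable (borel \<Otimes>\<^sub>M M)" for n
    unfolding f_def by measurable
  have f_joint': "(\<lambda>p. f n (snd p) (fst p)) \<in> borel_measurable (M \<Otimes>\<^sub>M lborel)" for n
  proof -
    have "(\<lambda>p. (snd p, fst p)) \<in> measurable (M \<Otimes>\<^sub>M lborel) (borel \<Otimes>\<^sub>M M)" by measurable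
    from measurable_compose[OF this f_joint] show ?thesis by simp
  qed
  have f_time: "(\<lambda>t. f n t w) \<in> borel_measurable borel" if "w \<in> space M" for n w
    using measurable_Pair1[OF f_joint that] by simp
  have ad: "f n t \<in> borel_measurable (F t)" if t: "t \<in> {0..1}" for n t
  proof -
    have [measurable]: "v t \<in> borel_measurable (F t)" using L t unfolding L0a_def by auto
    show ?thesis unfolding f_def path_part_def by measurable
  qed
  define P where "P n k \<tau> \<xi> \<longleftrightarrow> simple_process \<mu> k \<tau> \<xi> \<and>
    (\<integral>\<^sup>+w. l2_error (\<lambda>t. simple_eval k \<tau> \<xi> t w) (\<lambda>t. f n t w) \<partial>M) \<le> ennreal (1 / real (Suc n))" for n k \<tau> \<xi>
  have "\<exists>k \<tau> \<xi>. P n k \<tau> \<xi>" for n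
    unfolding P_def
  proof (rule bounded_simple_approximation[OF f_joint ad])
    show "norm (f n t w) \<le> real n" for t w by (simp add: f_def indicator_def)
    show "f n t w = 0" if "t \<le> 0" for t w using that by (simp add: f_def)
  qed simp_all
  then obtain k \<tau> \<xi> where P: "\<And>n. P n (k n) (\<tau> n) (\<xi> n)" by metis
  have s: "simple_process \<mu> (k n) (\<tau> n) (\<xi> n)"
    and e: "(\<integral>\<^sup>+w. l2_error (\<lambda>t. simple_eval (k n) (\<tau> n) (\<xi> n) t w) (\<lambda>t. f n t w) \<partial>M) \<le> ennreal (1 / real (Suc n))" for n
    using P[of n] unfolding P_def by auto
  define R where "R n w = l2_error (\<lambda>t. f n t w) (\<lambda>t. path_part v t w)" for n w
  have Rm[measurable]: "R n \<in> borel_measurable M" for n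
    unfolding R_def[abs_def] by (rule l2_error_measurable) (rule f_joint', rule path_part_joint'[OF L])
  have R: "AE w in M. (\<lambda>n. R n w) \<longlonglongrightarrow> 0"
  proof -
    have "AE w in M. cm_density (u w) (\<lambda>t. v t w)" using L AE_completion unfolding L0a_def by blast
    then show ?thesis
      using AE_space
    proof eventually_elim
      case (elim w)
      have [measurable]: "(\<lambda>t. path_part v t w) \<in> borel_measurable borel" "(\<lambda>t. f n t w) \<in> borel_measurable borel" for n
        using path_part_measurable_time[OF L elim(2)] f_time[OF elim(2)] by auto
      have fin: "(\<integral>\<^sup>+t\<in>{0..1}. ennreal ((norm (v t w))\<^sup>2) \<partial>lborel) < \<infinity>"
        using elim(1) unfolding cm_density_def by auto
      have "(\<lambda>n. R n w) \<longlonglongrightarrow> integral\<^sup>N lborel (\<lambda>t::real. 0)"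
        unfolding R_def l2_error_def
      proof (rule nn_integral_dominated_convergence[where w = "\<lambda>t. ennreal ((norm (path_part v t w))\<^sup>2) * indicator {0..1} t"])
        have "AE t in lborel. t \<noteq> (0::real)" by (rule AE_lborel_singleton)
        then show "AE t in lborel. ennreal ((norm (f n t w - path_part v t w))\<^sup>2) * indicator {0..1} t \<le> ennreal ((norm (path_part v t w))\<^sup>2) * indicator {0..1} t" for n
          by eventually_elim (auto simp: f_def indicator_def)
        show "AE t in lborel. (\<lambda>n. ennreal ((norm (f n t w - path_part v t w))\<^sup>2) * indicator {0..1} t) \<longlonglongrightarrow> 0"
          using \<open>AE t in lborel. t \<noteq> (0::real)\<close>
        proof eventually_elim
          case (elim t)
          obtain N :: nat where N: "norm (path_part v t w) \<le> N" using real_arch_simple by blast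
          have "eventually (\<lambda>n. ennreal ((norm (f n t w - path_part v t w))\<^sup>2) * indicator {0..1} t = 0) sequentially"
            using eventually_ge_at_top[of N]
          proof eventually_elim
            case (elim n)
            then have "norm (path_part v t w) \<le> n" using N by simp
            then show ?case using \<open>t \<noteq> 0\<close> by (auto simp: f_def indicator_def)
          qed
          then show ?case by (rule tendsto_eventually)
        qed
        have "(\<integral>\<^sup>+t\<in>{0..1}. ennreal ((norm (path_part v t w))\<^sup>2) \<partial>lborel) = (\<integral>\<^sup>+t\<in>{0..1}. ennreal ((norm (v t w))\<^sup>2) \<partial>lborel)"
          by (intro nn_integral_cong) (auto simp: path_part_def indicator_def)
        then show "(\<integral>\<^sup>+t\<in>{0..1}. ennreal ((norm (path_part v t w))\<^sup>2) \<partial>lborel) < \<infinity>" using fin by simp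
      qed measurable
      then show ?case by simp
    qed
  qed
  have "AE w in M. (\<lambda>n. 2 * R n w) \<longlonglongrightarrow> 0"
    using R
  proof eventually_elim
    case (elim w)
    from ennreal_tendsto_cmult[OF _ elim, of 2] show ?case by simp
  qed
  then have R2: "(\<lambda>n. \<integral>\<^sup>+w. min 1 (2 * R n w) \<partial>M) \<longlonglongrightarrow> 0"
    by (intro M.nn_integral_min_tendsto_zero_AE) auto
  have E2: "(\<lambda>n. 2 * ennreal (1 / real (Suc n))) \<longlonglongrightarrow> 0"
  proof -
    have "(\<lambda>n. 1 / real (Suc n)) \<longlonglongrightarrow> 0" using LIMSEQ_inverse_real_of_nat by (simp add: divide_inverse)
    then have "(\<lambda>n. ennreal (1 / real (Suc n))) \<longlonglongrightarrow> ennreal 0" by (rule tendsto_ennrealI)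
    from ennreal_tendsto_cmult[OF _ this, of 2] show ?thesis by simp
  qed
  let ?Z = "\<lambda>n w. l2_error (\<lambda>t. simple_eval (k n) (\<tau> n) (\<xi> n) t w) (\<lambda>t. v t w)"
  have bound: "(\<integral>\<^sup>+w. min 1 (?Z n w) \<partial>M) \<le> 2 * ennreal (1 / real (Suc n)) + (\<integral>\<^sup>+w. min 1 (2 * R n w) \<partial>M)" for n
  proof -
    let ?A = "\<lambda>w. l2_error (\<lambda>t. simple_eval (k n) (\<tau> n) (\<xi> n) t w) (\<lambda>t. f n t w)"
    have [measurable]: "?A \<in> borel_measurable M" by (rule l2_error_measurable) (rule simple_eval_joint[OF s], rule f_joint')
    have "(\<integral>\<^sup>+w. min 1 (?Z n w) \<partial>M) \<le> (\<integral>\<^sup>+w. 2 * ?A w + min 1 (2 * R n w) \<partial>M)"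
    proof (rule nn_integral_mono)
      fix w assume w: "w \<in> space M"
      have "?Z n w \<le> 2 * ?A w + 2 * R n w"
        unfolding l2_error_path_part[where v = v] R_def
        by (rule l2_error_triangle[OF simple_eval_borel f_time[OF w] path_part_measurable_time[OF L w]])
      then show "min 1 (?Z n w) \<le> 2 * ?A w + min 1 (2 * R n w)"
        by (cases "2 * R n w \<le> 1") (auto simp: min_def add_increasing)
    qed
    also have "\<dots> = 2 * (\<integral>\<^sup>+w. ?A w \<partial>M) + (\<integral>\<^sup>+w. min 1 (2 * R n w) \<partial>M)"
      by (subst nn_integral_add) (auto simp: nn_integral_cmult)
    also have "\<dots> \<le> 2 * ennreal (1 / real (Suc n)) + (\<integral>\<^sup>+w. min 1 (2 * R n w) \<partial>M)"
      using e by (intro add_mono mult_left_mono) auto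
    finally show ?thesis .
  qed
  have "(\<lambda>n. 2 * ennreal (1 / real (Suc n)) + (\<integral>\<^sup>+w. min 1 (2 * R n w) \<partial>M)) \<longlonglongrightarrow> 0 + 0"
    by (rule tendsto_add[OF E2 R2])
  from tendsto_sandwich[OF always_eventually always_eventually tendsto_const this, of "\<lambda>n. \<integral>\<^sup>+w. min 1 (?Z n w) \<partial>M"]
  have "(\<lambda>n. \<integral>\<^sup>+w. min 1 (?Z n w) \<partial>M) \<longlonglongrightarrow> 0" using bound by simp
  then show ?thesis using s by blast
qed

text \<open>
  Choose a subsequence of approximations with squared error below \<open>8\<^sup>-\<^sup>n\<close> outside an event of
  probability \<open>2\<^sup>-\<^sup>n\<close>. The tail bound for \<open>\<epsilon> = 2\<^sup>-\<^sup>n\<close> and \<open>\<delta> = 4 \<cdot> 8\<^sup>-\<^sup>n\<close> is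
  \<open>exp(- 2\<^sup>n / 8) \<le> 8 \<cdot> 2\<^sup>-\<^sup>n\<close>, so that by the Borel-Cantelli lemma the integrals form almost surely a
  series with summable terms.
\<close>

lemma ex_ito_integral:
  assumes L: "L0a \<mu> u v"
  shows "\<exists>X. has_ito_integral \<mu> v X"
proof -
  interpret M: prob_space M by (rule prob_space_M)
  obtain k0 \<tau>0 \<xi>0 where s0: "\<And>n. simple_process \<mu> (k0 n) (\<tau>0 n) (\<xi>0 n)"
    and lim0: "(\<lambda>n. \<integral>\<^sup>+w. min 1 (l2_error (\<lambda>t. simple_eval (k0 n) (\<tau>0 n) (\<xi>0 n) t w) (\<lambda>t. v t w)) \<partial>M) \<longlonglongrightarrow> 0"
    using simple_approximation[OF L] by blast
  let ?Z0 = "\<lambda>n w. l2_error (\<lambda>t. simple_eval (k0 n) (\<tau>0 n) (\<xi>0 n) t w) (\<lambda>t. v t w)"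
  note Zm = simple_error_measurable[OF L]
  have "\<forall>n. \<exists>N. M.prob {w \<in> space M. ennreal ((1/8)^n) < ?Z0 N w} < (1/2)^n"
  proof
    fix n :: nat
    have "(\<lambda>N. M.prob {w \<in> space M. ennreal ((1/8)^n) < ?Z0 N w}) \<longlonglongrightarrow> 0"
      by (rule M.measure_tendsto_zero_if_nn_integral_min[OF Zm[OF s0] lim0]) simp
    then have "eventually (\<lambda>N. M.prob {w \<in> space M. ennreal ((1/8)^n) < ?Z0 N w} < (1/2)^n) sequentially"
      by (rule order_tendstoD) simp
    then show "\<exists>N. M.prob {w \<in> space M. ennreal ((1/8)^n) < ?Z0 N w} < (1/2)^n"
      using eventually_happens'[OF sequentially_bot] by blast
  qed
  from choice[OF this] obtain r where r: "\<And>n. M.prob {w \<in> space M. ennreal ((1/8)^n) < ?Z0 (r n) w} < (1/2)^n" by blast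
  define k \<tau> \<xi> where "k n = k0 (r n)" and "\<tau> n = \<tau>0 (r n)" and "\<xi> n = \<xi>0 (r n)" for n
  define Z where "Z n w = l2_error (\<lambda>t. simple_eval (k n) (\<tau> n) (\<xi> n) t w) (\<lambda>t. v t w)" for n w
  define I where "I n = simple_integral (k n) (\<tau> n) (\<xi> n)" for n
  have s: "simple_process \<mu> (k n) (\<tau> n) (\<xi> n)" for n unfolding k_def \<tau>_def \<xi>_def by (rule s0)
  have PZ: "M.prob {w \<in> space M. ennreal ((1/8)^n) < Z n w} \<le> (1/2)^n" for n
    using r[of n] by (simp add: Z_def k_def \<tau>_def \<xi>_def)
  have [measurable]: "Z n \<in> borel_measurable M" for n unfolding Z_def[abs_def] by (rule Zm[OF s])
  have [measurable]: "I n \<in> borel_measurable M" for n unfolding I_def by (rule simple_integral_measurable[OF s])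
  define A where "A n = {w \<in> space M. (1/2)^n < \<bar>I (Suc n) w - I n w\<bar>}" for n
  have [measurable]: "A n \<in> sets M" for n unfolding A_def by measurable
  have PA: "M.prob (A n) \<le> 18 * (1/2)^n" for n
  proof -
    define d where "d = 4 * (1/8 :: real)^n"
    have d: "0 < d" by (simp add: d_def)
    let ?D = "\<lambda>w. l2_error (\<lambda>t. simple_eval (k (Suc n)) (\<tau> (Suc n)) (\<xi> (Suc n)) t w) (\<lambda>t. simple_eval (k n) (\<tau> n) (\<xi> n) t w)"
    have Dm[measurable]: "?D \<in> borel_measurable M"
      by (rule l2_error_measurable) (rule simple_eval_joint[OF s], rule simple_eval_joint[OF s])
    let ?B1 = "{w \<in> space M. ennreal ((1/8)^n) < Z n w}"
    let ?B2 = "{w \<in> space M. ennreal ((1/8)^Suc n) < Z (Suc n) w}"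
    let ?C1 = "{w \<in> space M. (1/2)^n < I (Suc n) w - I n w \<and> ?D w \<le> ennreal d}"
    let ?C2 = "{w \<in> space M. (1/2)^n < I n w - I (Suc n) w \<and> ?D w \<le> ennreal d}"
    have sets[simp, intro]: "?B1 \<in> sets M" "?B2 \<in> sets M" "?C1 \<in> sets M" "?C2 \<in> sets M" by measurable
    have "A n \<subseteq> (?B1 \<union> ?B2) \<union> (?C1 \<union> ?C2)"
    proof
      fix w assume w: "w \<in> A n"
      then have ws: "w \<in> space M" by (simp add: A_def)
      show "w \<in> (?B1 \<union> ?B2) \<union> (?C1 \<union> ?C2)"
      proof (cases "w \<in> ?B1 \<union> ?B2")
        case False
        then have z: "Z n w \<le> ennreal ((1/8)^n)" "Z (Suc n) w \<le> ennreal ((1/8)^Suc n)" using ws by auto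
        have "ennreal ((1/8)^Suc n) \<le> ennreal ((1/8)^n)" by (intro ennreal_leI power_decreasing) auto
        then have z2: "Z (Suc n) w \<le> ennreal ((1/8)^n)" using z(2) by (rule order_trans[rotated])
        have "?D w \<le> 2 * Z (Suc n) w + 2 * Z n w"
          unfolding Z_def l2_error_path_part[where v = v]
          using l2_error_triangle[OF simple_eval_borel path_part_measurable_time[OF L ws] simple_eval_borel]
          by (simp add: l2_error_commute[of "\<lambda>t. path_part v t w"])
        also have "\<dots> \<le> 2 * ennreal ((1/8)^n) + 2 * ennreal ((1/8)^n)"
          using z(1) z2 by (intro add_mono mult_left_mono) auto
        also have "\<dots> = ennreal (2 * (1/8)^n + 2 * (1/8)^n)"
          by (subst ennreal_plus) (auto simp: ennreal_mult')
        finally have "?D w \<le> ennreal d" by (simp add: d_def)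
        then show ?thesis using w by (auto simp: A_def abs_if split: if_splits)
      qed auto
    qed
    then have "M.prob (A n) \<le> M.prob ((?B1 \<union> ?B2) \<union> (?C1 \<union> ?C2))"
      by (intro M.finite_measure_mono sets.Un sets)
    also have "\<dots> \<le> M.prob (?B1 \<union> ?B2) + M.prob (?C1 \<union> ?C2)"
      by (intro measure_Un_le sets.Un sets)
    also have "\<dots> \<le> (M.prob ?B1 + M.prob ?B2) + (M.prob ?C1 + M.prob ?C2)"
      by (intro add_mono measure_Un_le sets)
    also have "\<dots> \<le> ((1/2)^n + (1/2)^Suc n) + (8 * (1/2)^n + 8 * (1/2)^n)"
    proof -
      have ex: "exp (- (((1/2)^n)\<^sup>2 / (2 * d))) \<le> 8 * (1/2)^n"
      proof -
        have "(((1/2)^n)\<^sup>2 / (2 * d)) = 2^n / (8::real)"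
          by (simp add: d_def power_divide power2_eq_square field_simps flip: power_mult_distrib)
        moreover have "exp (- (2^n / 8 :: real)) \<le> 8 * (1/2)^n"
        proof -
          have "2^n / 8 \<le> exp (2^n / 8 :: real)" using exp_ge_add_one_self[of "2^n / 8 :: real"] by linarith
          then have "inverse (exp (2^n / 8 :: real)) \<le> inverse (2^n / 8)" by (intro le_imp_inverse_le) auto
          then show ?thesis by (simp add: exp_minus power_divide)
        qed
        ultimately show ?thesis by (simp only:)
      qed
      have c1: "M.prob ?C1 \<le> 8 * (1/2)^n"
        using simple_integral_tail_one_sided[OF s[of "Suc n"] s[of n], of "(1/2)^n" d] d ex
        by (simp add: I_def M.emeasure_eq_measure)
      have c2: "M.prob ?C2 \<le> 8 * (1/2)^n"
        using simple_integral_tail_one_sided[OF s[of n] s[of "Suc n"], of "(1/2)^n" d] d ex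
        unfolding l2_error_commute[of "\<lambda>t. simple_eval (k (Suc n)) (\<tau> (Suc n)) (\<xi> (Suc n)) t _"]
        by (simp add: I_def M.emeasure_eq_measure)
      show ?thesis by (rule add_mono[OF add_mono[OF PZ[of n] PZ[of "Suc n"]] add_mono[OF c1 c2]])
    qed
    also have "\<dots> \<le> 18 * (1/2)^n" by simp
    finally show ?thesis .
  qed
  have "AE w in M. eventually (\<lambda>n. w \<in> space M - A n) sequentially"
  proof (rule borel_cantelli_AE1)
    show "summable (\<lambda>n. M.prob (A n))"
      by (rule summable_comparison_test'[of "\<lambda>n. 18 * (1/2)^n" 0]) (use PA in \<open>auto intro!: summable_mult summable_geometric\<close>)
  qed (auto simp: M.emeasure_eq_measure)
  then have conv: "AE w in M. convergent (\<lambda>n. I n w)"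
  proof eventually_elim
    case (elim w)
    then obtain N where N: "\<And>n. N \<le> n \<Longrightarrow> w \<in> space M - A n" unfolding eventually_sequentially by blast
    have "summable (\<lambda>n. I (Suc n) w - I n w)"
      by (rule summable_comparison_test'[of "\<lambda>n. (1/2)^n" N]) (use N in \<open>auto simp: A_def not_less intro!: summable_geometric\<close>)
    then have "convergent (\<lambda>n. \<Sum>j<n. I (Suc j) w - I j w)" by (simp add: summable_iff_convergent)
    then have "convergent (\<lambda>n. I n w - I 0 w)"
      using sum_lessThan_telescope[of "\<lambda>n. I n w"] by simp
    then show ?case using convergent_diff_const_right_iff by blast
  qed
  define X where "X w = lim (\<lambda>n. I n w)" for w
  have Xm[measurable]: "X \<in> borel_measurable M" unfolding X_def[abs_def] by (rule borel_measurable_lim_metric) measurable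
  have IX: "AE w in M. (\<lambda>n. ennreal \<bar>I n w - X w\<bar>) \<longlonglongrightarrow> 0"
    using conv
  proof eventually_elim
    case (elim w)
    then have "(\<lambda>n. I n w) \<longlonglongrightarrow> X w" unfolding X_def by (simp add: convergent_LIMSEQ_iff)
    then have "(\<lambda>n. \<bar>I n w - X w\<bar>) \<longlonglongrightarrow> 0" by (intro tendsto_rabs_zero LIM_zero)
    then have "(\<lambda>n. ennreal \<bar>I n w - X w\<bar>) \<longlonglongrightarrow> ennreal 0" by (rule tendsto_ennrealI)
    then show ?case by simp
  qed
  have "has_ito_integral \<mu> v X"
    unfolding has_ito_integral_def
  proof (intro conjI Xm exI allI impI)
    show "simple_process \<mu> (k n) (\<tau> n) (\<xi> n)" for n by (rule s)
  next
    fix \<epsilon> :: real assume e: "0 < \<epsilon>"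
    have "(\<lambda>n. M.prob {w \<in> space M. ennreal \<epsilon> < ennreal \<bar>I n w - X w\<bar>}) \<longlonglongrightarrow> 0"
      by (intro M.measure_tendsto_zero_if_nn_integral_min M.nn_integral_min_tendsto_zero_AE IX e) measurable
    then show "(\<lambda>n. measure M {w \<in> space \<mu>. \<epsilon> < \<bar>simple_integral (k n) (\<tau> n) (\<xi> n) w - X w\<bar>}) \<longlonglongrightarrow> 0"
      using e by (simp add: ennreal_less_iff I_def)
    have "(\<lambda>n. M.prob {w \<in> space M. ennreal \<epsilon> < Z n w}) \<longlonglongrightarrow> 0"
    proof (rule tendsto_sandwich[OF always_eventually _ tendsto_const])
      show "(\<lambda>n. (1/2 :: real)^n) \<longlonglongrightarrow> 0" by (intro LIMSEQ_power_zero) simp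
      have "(\<lambda>n. (1/8 :: real)^n) \<longlonglongrightarrow> 0" by (intro LIMSEQ_power_zero) simp
      then have "eventually (\<lambda>n. (1/8 :: real)^n < \<epsilon>) sequentially" using e by (rule order_tendstoD)
      then show "eventually (\<lambda>n. M.prob {w \<in> space M. ennreal \<epsilon> < Z n w} \<le> (1/2)^n) sequentially"
      proof eventually_elim
        case (elim n)
        then have le: "ennreal ((1/8)^n) \<le> ennreal \<epsilon>" by (intro ennreal_leI) simp
        have "M.prob {w \<in> space M. ennreal \<epsilon> < Z n w} \<le> M.prob {w \<in> space M. ennreal ((1/8)^n) < Z n w}"
        proof (rule M.finite_measure_mono)
            show "{w \<in> space M. ennreal ((1/8)^n) < Z n w} \<in> sets M" by measurable
          qed (use le in \<open>auto intro: le_less_trans\<close>)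
        then show ?case using PZ[of n] by simp
      qed
    qed simp
    then show "(\<lambda>n. measure M {w \<in> space \<mu>. ennreal \<epsilon> <
          (\<integral>\<^sup>+t\<in>{0..1}. ennreal ((norm (simple_eval (k n) (\<tau> n) (\<xi> n) t w - v t w))\<^sup>2) \<partial>lborel)}) \<longlonglongrightarrow> 0"
      by (simp add: Z_def l2_error_def)
  qed
  then show ?thesis by blast
qed

end

section \<open>Girsanov's theorem\<close>

text \<open>
  Both bounds come from \<open>2 a b \<le> a\<^sup>2 / \<eta> + \<eta> b\<^sup>2\<close>; the parameter \<open>\<eta>\<close> makes the part that does not
  contain the distance \<open>q\<close> small.
\<close>

lemma l2_estimates:
  fixes x y :: "real \<Rightarrow> 'b :: euclidean_space"
  assumes [measurable]: "x \<in> borel_measurable borel" "y \<in> borel_measurable borel"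
    and q: "l2_error x y \<le> ennreal q" and B: "(\<integral>\<^sup>+t\<in>{0..1}. ennreal ((norm (y t))\<^sup>2) \<partial>lborel) \<le> ennreal B"
    and pos: "0 \<le> q" "0 \<le> B" "0 < \<eta>"
  shows "\<bar>(LINT t:{0..1}|lborel. (norm (x t))\<^sup>2) - (LINT t:{0..1}|lborel. (norm (y t))\<^sup>2)\<bar> \<le> (1 + 1 / \<eta>) * q + \<eta> * B"
    and "s \<in> {0..1} \<Longrightarrow> norm ((LINT t:{0..s}|lborel. x t) - (LINT t:{0..s}|lborel. y t)) \<le> \<eta> + q / \<eta>"
proof -
  have sq: "set_integrable lborel {0..1} (\<lambda>t. (norm (z t))\<^sup>2) \<and> (LINT t:{0..1}|lborel. (norm (z t))\<^sup>2) \<le> b"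
    if [measurable]: "z \<in> borel_measurable borel" and b: "(\<integral>\<^sup>+t\<in>{0..1}. ennreal ((norm (z t))\<^sup>2) \<partial>lborel) \<le> ennreal b" "0 \<le> b" for z :: "real \<Rightarrow> 'b" and b
  proof -
    have e: "(\<integral>\<^sup>+t. ennreal (indicator {0..1} t *\<^sub>R (norm (z t))\<^sup>2) \<partial>lborel) = (\<integral>\<^sup>+t\<in>{0..1}. ennreal ((norm (z t))\<^sup>2) \<partial>lborel)"
      by (intro nn_integral_cong) (auto simp: indicator_def)
    have i: "integrable lborel (\<lambda>t. indicator {0..1} t *\<^sub>R (norm (z t))\<^sup>2)"
      using e b by (intro integrableI_nonneg) (auto simp: indicator_def intro: le_less_trans)
    have "ennreal (LINT t|lborel. indicator {0..1} t *\<^sub>R (norm (z t))\<^sup>2) \<le> ennreal b"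
      using nn_integral_eq_integral[OF i] e b by (simp add: indicator_def)
    then show ?thesis using i b(2) by (simp add: set_integrable_def set_lebesgue_integral_def)
  qed
  have d: "set_integrable lborel {0..1} (\<lambda>t. (norm (x t - y t))\<^sup>2)" "(LINT t:{0..1}|lborel. (norm (x t - y t))\<^sup>2) \<le> q"
    using sq[of "\<lambda>t. x t - y t" q] q pos unfolding l2_error_def by auto
  have yi: "set_integrable lborel {0..1} (\<lambda>t. (norm (y t))\<^sup>2)" "(LINT t:{0..1}|lborel. (norm (y t))\<^sup>2) \<le> B"
    using sq[of y B] B pos by auto
  have one: "set_integrable lborel {0..1} (\<lambda>t::real. c :: real)" for c by (simp add: set_integrable_def)
  have dom: "set_integrable lborel {0..1} z"
    if "set_integrable lborel {0..1} h" "z \<in> borel_measurable borel" "\<And>t. norm (z t) \<le> h t" for z :: "real \<Rightarrow> 'c::{banach, second_countable_topology}" and h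
    using that unfolding set_integrable_def
    by (elim Bochner_Integration.integrable_bound) (auto simp: indicator_def intro: order_trans[OF _ abs_ge_self])
  have xi: "set_integrable lborel {0..1} (\<lambda>t. (norm (x t))\<^sup>2)"
  proof (rule dom)
    show "set_integrable lborel {0..1} (\<lambda>t. 2 * (norm (x t - y t))\<^sup>2 + 2 * (norm (y t))\<^sup>2)"
      using d yi by (intro set_integral_add set_integrable_mult_right) auto
    show "norm ((norm (x t))\<^sup>2) \<le> 2 * (norm (x t - y t))\<^sup>2 + 2 * (norm (y t))\<^sup>2" for t
      using norm_diff_square_le[of "x t" 0 "y t"] by simp
  qed measurable
  have pt: "\<bar>(norm (x t))\<^sup>2 - (norm (y t))\<^sup>2\<bar> \<le> (1 + 1 / \<eta>) * (norm (x t - y t))\<^sup>2 + \<eta> * (norm (y t))\<^sup>2" for t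
  proof -
    let ?d = "norm (x t - y t)" and ?y = "norm (y t)"
    have "\<bar>(norm (x t))\<^sup>2 - (norm (y t))\<^sup>2\<bar> = \<bar>norm (x t) - norm (y t)\<bar> * (norm (x t) + norm (y t))"
    proof -
      have "(norm (x t))\<^sup>2 - (norm (y t))\<^sup>2 = (norm (x t) - norm (y t)) * (norm (x t) + norm (y t))"
        by (simp add: power2_eq_square algebra_simps)
      then show ?thesis by (simp only: abs_mult abs_of_nonneg[OF add_nonneg_nonneg[OF norm_ge_zero norm_ge_zero]])
    qed
    also have "\<dots> \<le> ?d * (?d + 2 * ?y)"
      using norm_triangle_ineq3[of "x t" "y t"] norm_triangle_ineq[of "x t - y t" "y t"] by (intro mult_mono) auto
    also have "\<dots> \<le> (1 + 1 / \<eta>) * ?d\<^sup>2 + \<eta> * ?y\<^sup>2"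
    proof -
      have "0 \<le> (?d - \<eta> * ?y)\<^sup>2 / \<eta>" using pos by simp
      also have "\<dots> = ?d\<^sup>2 / \<eta> - 2 * ?d * ?y + \<eta> * ?y\<^sup>2"
        using pos by (simp add: power2_eq_square field_simps)
      finally show ?thesis by (simp add: power2_eq_square algebra_simps)
    qed
    finally show ?thesis .
  qed
  have rhs: "set_integrable lborel {0..1} (\<lambda>t. (1 + 1 / \<eta>) * (norm (x t - y t))\<^sup>2 + \<eta> * (norm (y t))\<^sup>2)"
    using d yi by (intro set_integral_add set_integrable_mult_right) auto
  have "\<bar>(LINT t:{0..1}|lborel. (norm (x t))\<^sup>2) - (LINT t:{0..1}|lborel. (norm (y t))\<^sup>2)\<bar>
     = norm (LINT t:{0..1}|lborel. (norm (x t))\<^sup>2 - (norm (y t))\<^sup>2)"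
    using xi yi(1) by (subst set_integral_diff) auto
  also have "\<dots> \<le> (LINT t:{0..1}|lborel. (1 + 1 / \<eta>) * (norm (x t - y t))\<^sup>2 + \<eta> * (norm (y t))\<^sup>2)"
    using rhs xi yi(1) pt unfolding set_lebesgue_integral_def set_integrable_def
    by (intro Bochner_Integration.integral_norm_bound_integral) (auto simp: indicator_def right_diff_distrib)
  also have "\<dots> = (1 + 1 / \<eta>) * (LINT t:{0..1}|lborel. (norm (x t - y t))\<^sup>2) + \<eta> * (LINT t:{0..1}|lborel. (norm (y t))\<^sup>2)"
    using d(1) yi(1) by (subst set_integral_add) auto
  also have "\<dots> \<le> (1 + 1 / \<eta>) * q + \<eta> * B"
    using d(2) yi(2) pos by (intro add_mono mult_left_mono) auto
  finally show "\<bar>(LINT t:{0..1}|lborel. (norm (x t))\<^sup>2) - (LINT t:{0..1}|lborel. (norm (y t))\<^sup>2)\<bar> \<le> (1 + 1 / \<eta>) * q + \<eta> * B" .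
  have le1: "r \<le> 1 + r\<^sup>2" for r :: real 
  proof -
    have "0 \<le> (r - 1 / 2)\<^sup>2" by simp
    then show ?thesis by (simp add: power2_eq_square algebra_simps)
  qed
  have l1: "set_integrable lborel {0..1} z" if "set_integrable lborel {0..1} (\<lambda>t. (norm (z t))\<^sup>2)" "z \<in> borel_measurable borel" for z :: "real \<Rightarrow> 'b"
  proof (rule dom[of "\<lambda>t. 1 + (norm (z t))\<^sup>2"])
    show "set_integrable lborel {0..1} (\<lambda>t. 1 + (norm (z t))\<^sup>2)" by (rule set_integral_add(1)[OF one that(1)])
    show "norm (z t) \<le> 1 + (norm (z t))\<^sup>2" for t by (rule le1)
  qed (rule that(2))
  assume s: "s \<in> {0..1}"
  have sub: "set_integrable lborel {0..1} z \<Longrightarrow> set_integrable lborel {0..s} z" for z :: "real \<Rightarrow> 'c::{banach, second_countable_topology}"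
    by (rule set_integrable_subset) (use s in auto)
  have pt2: "norm (x t - y t) \<le> \<eta> + (1 / \<eta>) * (norm (x t - y t))\<^sup>2" for t
  proof -
    have "norm (x t - y t) / \<eta> \<le> 1 + (norm (x t - y t) / \<eta>)\<^sup>2" by (rule le1)
    then have "\<eta> * (norm (x t - y t) / \<eta>) \<le> \<eta> * (1 + (norm (x t - y t) / \<eta>)\<^sup>2)" using pos by (intro mult_left_mono) auto
    moreover have "\<eta> * (norm (x t - y t) / \<eta>) = norm (x t - y t)" using pos by simp
    moreover have "\<eta> * (1 + (norm (x t - y t) / \<eta>)\<^sup>2) = \<eta> + (1 / \<eta>) * (norm (x t - y t))\<^sup>2"
      using pos by (simp add: power2_eq_square field_simps)
    ultimately show ?thesis by simp
  qed
  have ig: "set_integrable lborel {0..1} (\<lambda>t. \<eta> + (1 / \<eta>) * (norm (x t - y t))\<^sup>2)"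
    using d by (intro set_integral_add set_integrable_mult_right one) auto
  have "norm ((LINT t:{0..s}|lborel. x t) - (LINT t:{0..s}|lborel. y t)) = norm (LINT t:{0..s}|lborel. x t - y t)"
    using l1[OF xi] l1[OF yi(1)] by (subst set_integral_diff) (auto intro: sub)
  also have "\<dots> \<le> (LINT t:{0..1}|lborel. \<eta> + (1 / \<eta>) * (norm (x t - y t))\<^sup>2)"
  proof -
    have "set_integrable lborel {0..s} (\<lambda>t. x t - y t)"
      using l1[OF xi] l1[OF yi(1)] by (intro sub set_integral_diff) auto
    then show ?thesis
      using ig s pt2 pos unfolding set_lebesgue_integral_def set_integrable_def
      by (intro Bochner_Integration.integral_norm_bound_integral) (auto simp: indicator_def intro: add_nonneg_nonneg)
  qed
  also have "\<dots> = \<eta> + (1 / \<eta>) * (LINT t:{0..1}|lborel. (norm (x t - y t))\<^sup>2)"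
    using d(1) one by (subst set_integral_add) (auto simp: set_lebesgue_integral_def)
  also have "\<dots> \<le> \<eta> + q / \<eta>" using d(2) pos by (simp add: divide_right_mono)
  finally show "norm ((LINT t:{0..s}|lborel. x t) - (LINT t:{0..s}|lborel. y t)) \<le> \<eta> + q / \<eta>" .
qed

lemma l2_convergence:
  fixes f :: "real \<Rightarrow> 'b :: euclidean_space"
  assumes g: "\<And>n. g n \<in> borel_measurable borel" and f: "f \<in> borel_measurable borel"
    and fin: "(\<integral>\<^sup>+t\<in>{0..1}. ennreal ((norm (f t))\<^sup>2) \<partial>lborel) < \<infinity>" and lim: "(\<lambda>n. l2_error (g n) f) \<longlonglongrightarrow> 0"
  shows "(\<lambda>n. LINT t:{0..1}|lborel. (norm (g n t))\<^sup>2) \<longlonglongrightarrow> (LINT t:{0..1}|lborel. (norm (f t))\<^sup>2)"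
    and "s \<in> {0..1} \<Longrightarrow> (\<lambda>n. LINT t:{0..s}|lborel. g n t) \<longlonglongrightarrow> (LINT t:{0..s}|lborel. f t)"
proof -
  obtain B where B: "0 \<le> B" "(\<integral>\<^sup>+t\<in>{0..1}. ennreal ((norm (f t))\<^sup>2) \<partial>lborel) = ennreal B"
    using fin by (cases "\<integral>\<^sup>+t\<in>{0..1}. ennreal ((norm (f t))\<^sup>2) \<partial>lborel") auto
  have small: "eventually (\<lambda>n. l2_error (g n) f \<le> ennreal q) sequentially" if "0 < q" for q
    using order_tendstoD(2)[OF lim, of "ennreal q"] that by (auto elim: eventually_mono)
  show "(\<lambda>n. LINT t:{0..1}|lborel. (norm (g n t))\<^sup>2) \<longlonglongrightarrow> (LINT t:{0..1}|lborel. (norm (f t))\<^sup>2)"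
  proof (rule tendstoI)
    fix e :: real assume e: "0 < e"
    define \<eta> where "\<eta> = e / (2 * (B + 1))"
    have \<eta>: "0 < \<eta>" "\<eta> * B < e / 2" using e B by (auto simp: \<eta>_def field_simps)
    define c where "c = 1 + 1 / \<eta>"
    have c: "0 < c" using \<eta> by (simp add: c_def add_pos_pos)
    define q where "q = e / (4 * c)"
    have "c * q = e / 4" using c by (simp add: q_def)
    then have q: "0 < q" "(1 + 1 / \<eta>) * q < e / 2" using e c by (simp_all add: q_def flip: c_def)
    show "eventually (\<lambda>n. dist (LINT t:{0..1}|lborel. (norm (g n t))\<^sup>2) (LINT t:{0..1}|lborel. (norm (f t))\<^sup>2) < e) sequentially"
      using small[OF q(1)]
    proof eventually_elim
      case (elim n)
      have "\<bar>(LINT t:{0..1}|lborel. (norm (g n t))\<^sup>2) - (LINT t:{0..1}|lborel. (norm (f t))\<^sup>2)\<bar> \<le> (1 + 1 / \<eta>) * q + \<eta> * B"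
        using l2_estimates(1)[OF g f elim, of B \<eta>] B q \<eta> by simp
      then show ?case using q(2) \<eta>(2) unfolding dist_real_def by linarith
    qed
  qed
  assume s: "s \<in> {0..1}"
  show "(\<lambda>n. LINT t:{0..s}|lborel. g n t) \<longlonglongrightarrow> (LINT t:{0..s}|lborel. f t)"
  proof (rule tendstoI)
    fix e :: real assume e: "0 < e"
    define \<eta> where "\<eta> = e / 3"
    define q where "q = e * \<eta> / 3"
    have \<eta>: "0 < \<eta>" "0 < q" using e by (auto simp: \<eta>_def q_def)
    have q: "\<eta> + q / \<eta> < e" using e \<eta> by (simp add: q_def) (simp add: \<eta>_def)
    show "eventually (\<lambda>n. dist (LINT t:{0..s}|lborel. g n t) (LINT t:{0..s}|lborel. f t) < e) sequentially"
      using small[OF \<eta>(2)]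
    proof eventually_elim
      case (elim n)
      have "norm ((LINT t:{0..s}|lborel. g n t) - (LINT t:{0..s}|lborel. f t)) \<le> \<eta> + q / \<eta>"
        using l2_estimates(2)[OF g f elim, of B \<eta> s] B \<eta> s by simp
      then show ?case using q by (simp add: dist_norm)
    qed
  qed
qed

text \<open>Lipschitz functions that decrease to the indicator of a closed set \<open>C\<close> as \<open>k\<close> grows.\<close>

definition closed_bump :: "'b :: metric_space set \<Rightarrow> nat \<Rightarrow> 'b \<Rightarrow> real" where
  "closed_bump C k x = max 0 (1 - real k * infdist x C)"

lemma closed_bump_range: "0 \<le> closed_bump C k x" "closed_bump C k x \<le> 1"
  by (auto simp: closed_bump_def infdist_nonneg)

lemma continuous_closed_bump: "continuous_on UNIV (closed_bump C k)"
  unfolding closed_bump_def by (intro continuous_intros)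

lemma closed_bump_tendsto:
  assumes "closed C" "C \<noteq> {}"
  shows "(\<lambda>k. closed_bump C k x) \<longlonglongrightarrow> indicator C x"
proof (cases "x \<in> C")
  case True
  then show ?thesis by (simp add: closed_bump_def)
next
  case False
  then have pos: "0 < infdist x C"
    using in_closed_iff_infdist_zero[OF assms] infdist_nonneg[of x C] by (metis less_eq_real_def)
  obtain N :: nat where N: "1 / infdist x C < N" using reals_Archimedean2 by blast
  have "eventually (\<lambda>k. closed_bump C k x = 0) sequentially"
    using eventually_ge_at_top[of N]
  proof eventually_elim
    case (elim k)
    then have "1 / infdist x C \<le> real k" using N by simp
    then have "1 \<le> real k * infdist x C" using pos by (simp add: divide_le_eq)
    then show ?case by (simp add: closed_bump_def)
  qed
  then show ?thesis using False by (simp add: tendsto_eventually)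
qed

lemma ennreal_eq_if_le_complement:
  fixes a b a' b' :: ennreal
  assumes "a \<le> a'" "b \<le> b'" "a + b = 1" "a' + b' = 1"
  shows "a = a'"
proof -
  have "a' + b \<le> a' + b'" using assms(2) by (rule add_left_mono)
  moreover have "a + b \<le> a' + b" using assms(1) by (rule add_right_mono)
  ultimately have "b + a' = b + a" using assms(3,4) by (simp add: add.commute)
  moreover have "b \<noteq> \<top>" using assms(3) by auto
  ultimately show ?thesis using ennreal_add_left_cancel[of b a' a] by auto
qed

context classical_wiener
begin

lemma closed_cylinders_generate:
  "sets \<mu> = sigma_sets (space \<mu>) {{w \<in> space \<mu>. \<forall>t\<in>T. w t \<in> C t} |T C. finite T \<and> T \<subseteq> {0..1} \<and> (\<forall>t. closed (C t))}"
  (is "_ = sigma_sets _ ?E")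
proof
  have E: "?E \<subseteq> sets \<mu>"
  proof safe
    fix T :: "real set" and C :: "real \<Rightarrow> (real ^ 'n) set"
    assume "finite T" "T \<subseteq> {0..1}" "\<forall>t. closed (C t)"
    then show "{w \<in> space \<mu>. \<forall>t\<in>T. w t \<in> C t} \<in> sets \<mu>" by (intro cylinder_measurable) auto
  qed
  then show "sigma_sets (space \<mu>) ?E \<subseteq> sets \<mu>" by (rule sets.sigma_sets_subset)
  define N where "N = sigma (space \<mu>) ?E"
  have spN: "space N = space \<mu>" by (simp add: N_def space_measure_of_conv)
  have setsN: "sets N = sigma_sets (space \<mu>) ?E"
    unfolding N_def using subset_trans[OF E sets.space_closed] by (intro sets_measure_of)
  have c: "(\<lambda>w. w t) \<in> borel_measurable N" if t: "t \<in> {0..1}" for t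
  proof (rule borel_measurableI)
    fix S :: "(real ^ 'n) set" assume "open S"
    have "{w \<in> space \<mu>. \<forall>r\<in>{t}. w r \<in> - S} \<in> ?E"
      using \<open>open S\<close> t by (intro CollectI exI[of _ "{t}"] exI[of _ "\<lambda>_. - S"]) auto
    then have "{w \<in> space \<mu>. \<forall>r\<in>{t}. w r \<in> - S} \<in> sets N" unfolding setsN by (rule sigma_sets.Basic)
    then have "space N - {w \<in> space \<mu>. \<forall>r\<in>{t}. w r \<in> - S} \<in> sets N" by (rule sets.compl_sets)
    moreover have "space N - {w \<in> space \<mu>. \<forall>r\<in>{t}. w r \<in> - S} = (\<lambda>w. w t) -` S \<inter> space N" using spN by auto
    ultimately show "(\<lambda>w. w t) -` S \<inter> space N \<in> sets N" by simp
  qed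
  have "(\<lambda>w. w) \<in> measurable N path_space"
    unfolding path_space_def
  proof (rule measurable_restrict_space2)
    show "(\<lambda>w. w) \<in> space N \<rightarrow> paths" using spN space_wiener by auto
    have "(\<lambda>w t. w t) \<in> measurable N (PiM {0..1} (\<lambda>_. borel))"
      by (rule measurable_PiM_single'[OF c]) (auto simp: spN space_wiener paths_def PiE_def)
    then show "(\<lambda>w. w) \<in> measurable N (PiM {0..1} (\<lambda>_. borel))" .
  qed
  then have idm: "(\<lambda>w. w) \<in> measurable N \<mu>" unfolding measurable_cong_sets[OF refl sets_wiener] .
  show "sets \<mu> \<subseteq> sigma_sets (space \<mu>) ?E"
  proof
    fix A assume A: "A \<in> sets \<mu>"
    then have "(\<lambda>w. w) -` A \<inter> space N = A" using sets.sets_into_space[OF A] spN by auto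
    then show "A \<in> sigma_sets (space \<mu>) ?E" using measurable_sets[OF idm A] setsN by simp
  qed
qed

lemma perturb_measurable:
  assumes L: "L0a \<mu> u v"
  shows "perturb u \<in> measurable M \<mu>"
  unfolding measurable_cong_sets[OF refl sets_wiener] path_space_def
proof (rule measurable_restrict_space2)
  have u: "u \<in> measurable M \<mu>" using L by (simp add: L0a_def)
  show "perturb u \<in> space M \<rightarrow> paths"
  proof
    fix w assume w: "w \<in> space M"
    then have "w \<in> paths" "u w \<in> paths" using space_wiener measurable_space[OF u w] by auto
    then have "continuous_on {0..1} (\<lambda>t. w t + u w t)" by (auto simp: paths_def intro!: continuous_on_add)
    then have "continuous_on {0..1} (perturb u w)"
      unfolding perturb_def by (rule continuous_on_eq) simp
    then show "perturb u w \<in> paths" by (simp add: paths_def perturb_def)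
  qed
  show "perturb u \<in> measurable M (PiM {0..1} (\<lambda>_. borel))"
    unfolding perturb_def
  proof (rule measurable_restrict)
    fix t :: real assume t: "t \<in> {0..1}"
    show "(\<lambda>w. w t + u w t) \<in> borel_measurable M"
      by (intro borel_measurable_add measurable_completion[OF coordinate_measurable[OF t]]
          measurable_compose[OF u coordinate_measurable[OF t]])
  qed
qed

lemma set_integral_measurable:
  fixes g :: "real \<Rightarrow> (real \<Rightarrow> real ^ 'n) \<Rightarrow> 'b :: {banach, second_countable_topology}"
  assumes "(\<lambda>p. g (snd p) (fst p)) \<in> borel_measurable (M \<Otimes>\<^sub>M lborel)" "A \<in> sets borel"
  shows "(\<lambda>w. LINT t:A|lborel. g t w) \<in> borel_measurable M"
proof -
  note [measurable] = assms
  have "(\<lambda>p. indicator A (snd p) *\<^sub>R g (snd p) (fst p)) \<in> borel_measurable (M \<Otimes>\<^sub>M lborel)" by measurable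
  then show ?thesis unfolding set_lebesgue_integral_def
    by (intro lborel.borel_measurable_lebesgue_integral) (simp add: case_prod_beta')
qed

text \<open>
  Let \<open>V n\<close> be the simple processes behind the Ito integral. Along a subsequence, the densities \<open>\<rho>n n\<close>
  and the shifted paths at fixed times converge almost surely to \<open>\<rho>\<close> and \<open>perturb u\<close>. For a
  continuous \<open>\<Phi>\<close> with values in \<open>[0,1]\<close>, Fatou's lemma and \<open>simple_girsanov\<close> give
  \<open>E[\<rho> \<Phi>(U)] \<le> E[\<Phi>]\<close> and the same for \<open>1 - \<Phi>\<close>. The two left-hand sides add up to \<open>E[\<rho>] = 1\<close>, so
  equality holds. Indicators of closed cylinders are limits of such \<open>\<Phi>\<close>, and these cylinders
  determine the measure.
\<close>

lemma girsanov_transform: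
  assumes L: "L0a \<mu> u v" and X: "has_ito_integral \<mu> v X"
    and \<rho>: "\<And>w. \<rho> w = exp (- X w - 1 / 2 * (LINT t:{0..1}|lborel. (norm (v t w))\<^sup>2))"
    and one: "(\<integral>w. \<rho> w \<partial>M) = 1"
  shows "\<rho> \<in> borel_measurable M" and "distr (density M (\<lambda>w. ennreal (\<rho> w))) \<mu> (perturb u) = \<mu>"
proof -
  interpret M: prob_space M by (rule prob_space_M)
  let ?U = "perturb u"
  have U: "?U \<in> measurable M \<mu>" by (rule perturb_measurable[OF L])
  have Xm[measurable]: "X \<in> borel_measurable M" using X by (simp add: has_ito_integral_def)
  have pp: "(LINT t:{0..1}|lborel. (norm (v t w))\<^sup>2) = (LINT t:{0..1}|lborel. (norm (path_part v t w))\<^sup>2)" for w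
    by (intro set_lebesgue_integral_cong) (auto simp: path_part_def)
  have "(\<lambda>w. LINT t:{0..1}|lborel. (norm (path_part v t w))\<^sup>2) \<in> borel_measurable M"
    using path_part_joint'[OF L] by (intro set_integral_measurable) auto
  then have [measurable]: "(\<lambda>w. LINT t:{0..1}|lborel. (norm (v t w))\<^sup>2) \<in> borel_measurable M" unfolding pp .
  have \<rho>_eq: "\<rho> = (\<lambda>w. exp (- X w - 1 / 2 * (LINT t:{0..1}|lborel. (norm (v t w))\<^sup>2)))" using \<rho> by auto
  show \<rho>m[measurable]: "\<rho> \<in> borel_measurable M" unfolding \<rho>_eq by measurable
  have \<rho>1: "(\<integral>\<^sup>+w. ennreal (\<rho> w) \<partial>M) = 1"
  proof -
    have "integrable M \<rho>" using one not_integrable_integral_eq by fastforce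
    moreover have "0 \<le> \<rho> w" for w unfolding \<rho> by simp
    ultimately show ?thesis using one by (simp add: nn_integral_eq_integral)
  qed
  obtain k0 \<tau>0 \<xi>0 where s0: "\<And>n. simple_process \<mu> (k0 n) (\<tau>0 n) (\<xi>0 n)"
    and lim1: "\<And>\<epsilon>. 0 < \<epsilon> \<Longrightarrow> (\<lambda>n. measure M {w \<in> space \<mu>. ennreal \<epsilon> <
          (\<integral>\<^sup>+t\<in>{0..1}. ennreal ((norm (simple_eval (k0 n) (\<tau>0 n) (\<xi>0 n) t w - v t w))\<^sup>2) \<partial>lborel)}) \<longlonglongrightarrow> 0"
    and lim2: "\<And>\<epsilon>. 0 < \<epsilon> \<Longrightarrow> (\<lambda>n. measure M {w \<in> space \<mu>. \<epsilon> < \<bar>simple_integral (k0 n) (\<tau>0 n) (\<xi>0 n) w - X w\<bar>}) \<longlonglongrightarrow> 0"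
    using X unfolding has_ito_integral_def by blast
  define Z0 where "Z0 n w = l2_error (\<lambda>t. simple_eval (k0 n) (\<tau>0 n) (\<xi>0 n) t w) (\<lambda>t. v t w)" for n w
  define D0 where "D0 n w = ennreal \<bar>simple_integral (k0 n) (\<tau>0 n) (\<xi>0 n) w - X w\<bar>" for n w
  have Z0m: "Z0 n \<in> borel_measurable M" for n
    unfolding Z0_def[abs_def] by (rule simple_error_measurable[OF L s0])
  have D0m: "D0 n \<in> borel_measurable M" for n
    unfolding D0_def[abs_def] using simple_integral_measurable[OF s0] by measurable
  have "(\<lambda>n. \<integral>\<^sup>+w. min 1 (Z0 n w) \<partial>M) \<longlonglongrightarrow> 0"
    using lim1 by (intro M.nn_integral_min_tendsto_zero[of Z0, OF Z0m]) (simp add: Z0_def l2_error_def)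
  then obtain r1 :: "nat \<Rightarrow> nat" where r1: "strict_mono r1" "AE w in M. (\<lambda>n. Z0 (r1 n) w) \<longlonglongrightarrow> 0"
    using M.AE_subsequence_if_nn_integral_min[of Z0, OF Z0m] by blast
  have "(\<lambda>n. \<integral>\<^sup>+w. min 1 (D0 n w) \<partial>M) \<longlonglongrightarrow> 0"
    using lim2 by (intro M.nn_integral_min_tendsto_zero[of D0, OF D0m]) (simp add: D0_def ennreal_less_iff)
  from LIMSEQ_subseq_LIMSEQ[OF this r1(1)] have "(\<lambda>n. \<integral>\<^sup>+w. min 1 (D0 (r1 n) w) \<partial>M) \<longlonglongrightarrow> 0" by (simp add: comp_def)
  then obtain r2 :: "nat \<Rightarrow> nat" where r2: "strict_mono r2" "AE w in M. (\<lambda>n. D0 (r1 (r2 n)) w) \<longlonglongrightarrow> 0"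
    using M.AE_subsequence_if_nn_integral_min[of "\<lambda>n. D0 (r1 n)", OF D0m] by blast
  define r where "r n = r1 (r2 n)" for n
  define k \<tau> \<xi> where "k n = k0 (r n)" and "\<tau> n = \<tau>0 (r n)" and "\<xi> n = \<xi>0 (r n)" for n
  define V where "V n t w = simple_eval (k n) (\<tau> n) (\<xi> n) t w" for n t w
  define I where "I n = simple_integral (k n) (\<tau> n) (\<xi> n)" for n
  have s: "simple_process \<mu> (k n) (\<tau> n) (\<xi> n)" for n unfolding k_def \<tau>_def \<xi>_def by (rule s0)
  have [measurable]: "I n \<in> borel_measurable M" for n unfolding I_def by (rule simple_integral_measurable[OF s])
  have Vj: "(\<lambda>p. V n (snd p) (fst p)) \<in> borel_measurable (M \<Otimes>\<^sub>M lborel)" for n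
    unfolding V_def by (rule simple_eval_joint[OF s])
  define \<rho>n where "\<rho>n n w = exp (- I n w - (LINT t:{0..1}|lborel. (norm (V n t w))\<^sup>2) / 2)" for n w
  have \<rho>nm[measurable]: "\<rho>n n \<in> borel_measurable M" for n
  proof -
    have [measurable]: "(\<lambda>w. LINT t:{0..1}|lborel. (norm (V n t w))\<^sup>2) \<in> borel_measurable M"
      using Vj[of n] by (intro set_integral_measurable) auto
    show ?thesis unfolding \<rho>n_def[abs_def] by measurable
  qed
  have ZL: "AE w in M. (\<lambda>n. l2_error (\<lambda>t. V n t w) (\<lambda>t. v t w)) \<longlonglongrightarrow> 0"
    using r1(2)
  proof eventually_elim
    case (elim w)
    from LIMSEQ_subseq_LIMSEQ[OF this r2(1)] show ?case
      by (simp add: comp_def Z0_def V_def k_def \<tau>_def \<xi>_def r_def)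
  qed
  have IL: "AE w in M. (\<lambda>n. I n w) \<longlonglongrightarrow> X w"
    using r2(2)
  proof eventually_elim
    case (elim w)
    then have "(\<lambda>n. ennreal \<bar>I n w - X w\<bar>) \<longlonglongrightarrow> ennreal 0"
      by (simp add: D0_def I_def k_def \<tau>_def \<xi>_def r_def)
    then have "(\<lambda>n. \<bar>I n w - X w\<bar>) \<longlonglongrightarrow> 0" by (subst (asm) tendsto_ennreal_iff) auto
    then show ?case by (simp add: tendsto_rabs_zero_iff LIM_zero_iff)
  qed
  have cm: "AE w in M. cm_density (u w) (\<lambda>t. v t w)" using L AE_completion unfolding L0a_def by blast
  have limits: "AE w in M. (\<lambda>n. \<rho>n n w) \<longlonglongrightarrow> \<rho> w \<and>
     (\<forall>t\<in>{0..1}. (\<lambda>n. w t + (LINT s:{0..t}|lborel. V n s w)) \<longlonglongrightarrow> ?U w t)"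
    using ZL IL cm AE_space
  proof eventually_elim
    case (elim w)
    have m: "(\<lambda>t. path_part v t w) \<in> borel_measurable borel" by (rule path_part_measurable_time[OF L elim(4)])
    have mV: "(\<lambda>t. V n t w) \<in> borel_measurable borel" for n unfolding V_def by (rule simple_eval_borel)
    have "(\<integral>\<^sup>+t\<in>{0..1}. ennreal ((norm (path_part v t w))\<^sup>2) \<partial>lborel) = (\<integral>\<^sup>+t\<in>{0..1}. ennreal ((norm (v t w))\<^sup>2) \<partial>lborel)"
      by (intro nn_integral_cong) (auto simp: path_part_def indicator_def)
    then have fin: "(\<integral>\<^sup>+t\<in>{0..1}. ennreal ((norm (path_part v t w))\<^sup>2) \<partial>lborel) < \<infinity>"
      using elim(3) unfolding cm_density_def by simp
    have lim: "(\<lambda>n. l2_error (\<lambda>t. V n t w) (\<lambda>t. path_part v t w)) \<longlonglongrightarrow> 0"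
      using elim(1) unfolding l2_error_path_part[where v = v] .
    note conv = l2_convergence[of "\<lambda>n t. V n t w", OF mV m fin lim]
    have "(\<lambda>n. exp (- I n w - (LINT t:{0..1}|lborel. (norm (V n t w))\<^sup>2) / 2)) \<longlonglongrightarrow>
       exp (- X w - (LINT t:{0..1}|lborel. (norm (path_part v t w))\<^sup>2) / 2)"
      by (intro tendsto_intros conv(1) elim(2)) simp
    then have 1: "(\<lambda>n. \<rho>n n w) \<longlonglongrightarrow> \<rho> w" by (simp add: \<rho>n_def \<rho> pp)
    have 2: "(\<lambda>n. w t + (LINT s:{0..t}|lborel. V n s w)) \<longlonglongrightarrow> ?U w t" if t: "t \<in> {0..1}" for t
    proof -
      have "u w t = (LINT s:{0..t}|lborel. v s w)" using elim(3) t unfolding cm_density_def by auto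
      also have "\<dots> = (LINT s:{0..t}|lborel. path_part v s w)"
        using t by (intro set_lebesgue_integral_cong) (auto simp: path_part_def)
      finally have "?U w t = w t + (LINT s:{0..t}|lborel. path_part v s w)" using t by (simp add: perturb_def)
      then show ?thesis using tendsto_add[OF tendsto_const conv(2)[OF t], of "w t"] by simp
    qed
    show ?case using 1 2 by blast
  qed
  have fatou: "(\<integral>\<^sup>+w. ennreal (\<rho> w) * ennreal (\<Phi> (\<lambda>t\<in>T. ?U w t)) \<partial>M) \<le> (\<integral>\<^sup>+w. ennreal (\<Phi> (\<lambda>t\<in>T. w t)) \<partial>M)"
    if T: "finite T" "T \<subseteq> {0..1}" and \<Phi>[measurable]: "\<Phi> \<in> borel_measurable (PiM T (\<lambda>_. borel))"
      and cont: "\<And>x y. (\<And>t. t \<in> T \<Longrightarrow> (\<lambda>n. x n t) \<longlonglongrightarrow> y t) \<Longrightarrow> (\<lambda>n. \<Phi> (\<lambda>t\<in>T. x n t)) \<longlonglongrightarrow> \<Phi> (\<lambda>t\<in>T. y t)"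
    for T and \<Phi> :: "(real \<Rightarrow> real ^ 'n) \<Rightarrow> real"
  proof -
    let ?Un = "\<lambda>n w. (\<lambda>t\<in>T. w t + (LINT s:{0..t}|lborel. V n s w))"
    have Um: "?Un n \<in> measurable M (PiM T (\<lambda>_. borel))" for n
    proof (rule measurable_restrict)
      fix t assume "t \<in> T"
      then show "(\<lambda>w. w t + (LINT s:{0..t}|lborel. V n s w)) \<in> borel_measurable M"
        using T by (intro borel_measurable_add measurable_completion coordinate_measurable set_integral_measurable[OF Vj]) auto
    qed
    have [measurable]: "(\<lambda>w. \<Phi> (?Un n w)) \<in> borel_measurable M" for n by (rule measurable_compose[OF Um \<Phi>])
    have "(\<integral>\<^sup>+w. ennreal (\<rho> w) * ennreal (\<Phi> (\<lambda>t\<in>T. ?U w t)) \<partial>M) =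
      (\<integral>\<^sup>+w. liminf (\<lambda>n. ennreal (\<rho>n n w) * ennreal (\<Phi> (?Un n w))) \<partial>M)"
    proof (rule nn_integral_cong_AE)
      show "AE w in M. ennreal (\<rho> w) * ennreal (\<Phi> (\<lambda>t\<in>T. ?U w t)) = liminf (\<lambda>n. ennreal (\<rho>n n w) * ennreal (\<Phi> (?Un n w)))"
        using limits
      proof eventually_elim
        case (elim w)
        have "(\<lambda>n. \<Phi> (?Un n w)) \<longlonglongrightarrow> \<Phi> (\<lambda>t\<in>T. ?U w t)"
          by (rule cont) (use elim T in auto)
        then have "(\<lambda>n. ennreal (\<rho>n n w) * ennreal (\<Phi> (?Un n w))) \<longlonglongrightarrow> ennreal (\<rho> w) * ennreal (\<Phi> (\<lambda>t\<in>T. ?U w t))"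
          using elim by (intro tendsto_mult_ennreal tendsto_ennrealI) auto
        from lim_imp_Liminf[OF sequentially_bot this] show ?case by simp
      qed
    qed
    also have "\<dots> \<le> liminf (\<lambda>n. \<integral>\<^sup>+w. ennreal (\<rho>n n w) * ennreal (\<Phi> (?Un n w)) \<partial>M)"
      by (rule nn_integral_liminf) measurable
    also have "(\<lambda>n. \<integral>\<^sup>+w. ennreal (\<rho>n n w) * ennreal (\<Phi> (?Un n w)) \<partial>M) = (\<lambda>n. \<integral>\<^sup>+w. ennreal (\<Phi> (\<lambda>t\<in>T. w t)) \<partial>M)"
    proof
      fix n
      have "(\<lambda>x. ennreal (\<Phi> x)) \<in> borel_measurable (PiM T (\<lambda>_. borel))" by measurable
      from simple_girsanov[OF s[of n] T this]
      show "(\<integral>\<^sup>+w. ennreal (\<rho>n n w) * ennreal (\<Phi> (?Un n w)) \<partial>M) = (\<integral>\<^sup>+w. ennreal (\<Phi> (\<lambda>t\<in>T. w t)) \<partial>M)"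
        by (simp add: \<rho>n_def I_def V_def)
    qed
    also have "liminf \<dots> = (\<integral>\<^sup>+w. ennreal (\<Phi> (\<lambda>t\<in>T. w t)) \<partial>M)" by (simp add: Liminf_const)
    finally show ?thesis .
  qed
  have coordm: "(\<lambda>w. \<lambda>t\<in>T. w t) \<in> measurable M (PiM T (\<lambda>_. borel))" if "T \<subseteq> {0..1}" for T
    using that by (intro measurable_restrict measurable_completion coordinate_measurable) auto
  have Ucoordm: "(\<lambda>w. \<lambda>t\<in>T. ?U w t) \<in> measurable M (PiM T (\<lambda>_. borel))" if "T \<subseteq> {0..1}" for T
    using that by (intro measurable_restrict measurable_compose[OF U coordinate_measurable]) auto
  have eq: "(\<integral>\<^sup>+w. ennreal (\<rho> w) * ennreal (\<Phi> (\<lambda>t\<in>T. ?U w t)) \<partial>M) = (\<integral>\<^sup>+w. ennreal (\<Phi> (\<lambda>t\<in>T. w t)) \<partial>M)"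
    if T: "finite T" "T \<subseteq> {0..1}" and \<Phi>[measurable]: "\<Phi> \<in> borel_measurable (PiM T (\<lambda>_. borel))"
      and cont: "\<And>x y. (\<And>t. t \<in> T \<Longrightarrow> (\<lambda>n. x n t) \<longlonglongrightarrow> y t) \<Longrightarrow> (\<lambda>n. \<Phi> (\<lambda>t\<in>T. x n t)) \<longlonglongrightarrow> \<Phi> (\<lambda>t\<in>T. y t)"
      and range: "\<And>x. 0 \<le> \<Phi> x" "\<And>x. \<Phi> x \<le> 1"
    for T and \<Phi> :: "(real \<Rightarrow> real ^ 'n) \<Rightarrow> real"
  proof -
    let ?a = "\<integral>\<^sup>+w. ennreal (\<rho> w) * ennreal (\<Phi> (\<lambda>t\<in>T. ?U w t)) \<partial>M"
    let ?b = "\<integral>\<^sup>+w. ennreal (\<rho> w) * ennreal (1 - \<Phi> (\<lambda>t\<in>T. ?U w t)) \<partial>M"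
    let ?a' = "\<integral>\<^sup>+w. ennreal (\<Phi> (\<lambda>t\<in>T. w t)) \<partial>M" and ?b' = "\<integral>\<^sup>+w. ennreal (1 - \<Phi> (\<lambda>t\<in>T. w t)) \<partial>M"
    have [measurable]: "(\<lambda>w. \<Phi> (\<lambda>t\<in>T. ?U w t)) \<in> borel_measurable M" "(\<lambda>w. \<Phi> (\<lambda>t\<in>T. w t)) \<in> borel_measurable M"
      using measurable_compose[OF Ucoordm[OF T(2)] \<Phi>] measurable_compose[OF coordm[OF T(2)] \<Phi>] by auto
    have a: "?a \<le> ?a'" by (rule fatou[OF T \<Phi> cont])
    have b: "?b \<le> ?b'"
      by (rule fatou[OF T, of "\<lambda>x. 1 - \<Phi> x"]) (auto intro!: tendsto_diff tendsto_const cont)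
    have split1: "ennreal (\<Phi> x) + ennreal (1 - \<Phi> x) = 1" for x
      using range[of x] by (subst ennreal_plus[symmetric]) auto
    have ab: "?a + ?b = 1"
      by (subst nn_integral_add[symmetric]) (auto simp: distrib_left[symmetric] split1 \<rho>1)
    have ab': "?a' + ?b' = 1"
      by (subst nn_integral_add[symmetric]) (auto simp: split1 emeasure_space_1)
    show ?thesis by (rule ennreal_eq_if_le_complement[OF a b ab ab'])
  qed
  let ?\<nu> = "density M (\<lambda>w. ennreal (\<rho> w))"
  let ?E = "{{w \<in> space \<mu>. \<forall>t\<in>T. w t \<in> C t} |T C. finite T \<and> T \<subseteq> {0..1} \<and> (\<forall>t. closed (C t))} :: (real \<Rightarrow> real ^ 'n) set set"
  have closed_eq: "emeasure (distr ?\<nu> \<mu> ?U) {w \<in> space \<mu>. \<forall>t\<in>T. w t \<in> C t} = emeasure \<mu> {w \<in> space \<mu>. \<forall>t\<in>T. w t \<in> C t}"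
    if T: "finite T" "T \<subseteq> {0..1}" and C: "\<And>t. closed (C t)" for T and C :: "real \<Rightarrow> (real ^ 'n) set"
  proof (cases "\<exists>t\<in>T. C t = {}")
    case True
    then have e: "{w \<in> space \<mu>. \<forall>t\<in>T. w t \<in> C t} = {}" by auto
    show ?thesis unfolding e by simp
  next
    case False
    define \<Phi> where "\<Phi> j x = (\<Prod>t\<in>T. closed_bump (C t) j (x t))" for j x
    define \<Psi> :: "(real \<Rightarrow> real ^ 'n) \<Rightarrow> ennreal" where "\<Psi> x = indicator {x. \<forall>t\<in>T. x t \<in> C t} x" for x
    have \<Phi>01: "0 \<le> \<Phi> j x" "\<Phi> j x \<le> 1" for j x
      unfolding \<Phi>_def by (auto intro!: prod_nonneg prod_le_1 closed_bump_range)
    have \<Phi>m: "\<Phi> j \<in> borel_measurable (PiM T (\<lambda>_. borel))" for j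
      unfolding \<Phi>_def[abs_def]
    proof (rule borel_measurable_prod)
      fix t assume "t \<in> T"
      show "(\<lambda>x. closed_bump (C t) j (x t)) \<in> borel_measurable (PiM T (\<lambda>_. borel))"
        by (rule measurable_compose[OF measurable_component_singleton[OF \<open>t \<in> T\<close>] borel_measurable_continuous_onI[OF continuous_closed_bump]])
    qed
    have \<Phi>c: "(\<lambda>n. \<Phi> j (\<lambda>t\<in>T. x n t)) \<longlonglongrightarrow> \<Phi> j (\<lambda>t\<in>T. y t)" if "\<And>t. t \<in> T \<Longrightarrow> (\<lambda>n. x n t) \<longlonglongrightarrow> y t" for j x y
    proof -
      have "(\<lambda>n. \<Prod>t\<in>T. closed_bump (C t) j (x n t)) \<longlonglongrightarrow> (\<Prod>t\<in>T. closed_bump (C t) j (y t))"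
        using that by (intro tendsto_prod continuous_on_tendsto_compose[OF continuous_closed_bump]) auto
      then show ?thesis by (simp add: \<Phi>_def)
    qed
    have \<Phi>lim: "(\<lambda>j. ennreal (\<Phi> j x)) \<longlonglongrightarrow> \<Psi> x" for x
    proof -
      have "(\<lambda>j. \<Phi> j x) \<longlonglongrightarrow> (\<Prod>t\<in>T. indicator (C t) (x t))"
        unfolding \<Phi>_def using False C by (intro tendsto_prod closed_bump_tendsto) auto
      then have "(\<lambda>j. ennreal (\<Phi> j x)) \<longlonglongrightarrow> ennreal (\<Prod>t\<in>T. indicator (C t) (x t))" by (rule tendsto_ennrealI)
      moreover have "ennreal (\<Prod>t\<in>T. indicator (C t) (x t)) = \<Psi> x"
      proof (cases "\<forall>t\<in>T. x t \<in> C t")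
        case True
        then have "(\<Prod>t\<in>T. indicator (C t) (x t)) = (1 :: real)" by (intro prod.neutral) simp
        then show ?thesis using True by (simp add: \<Psi>_def)
      next
        case False
        then obtain t where "t \<in> T" "x t \<notin> C t" by blast
        then have "(\<Prod>t\<in>T. indicator (C t) (x t)) = (0 :: real)" by (intro prod_zero T(1) bexI[of _ t]) auto
        then show ?thesis using False by (simp add: \<Psi>_def)
      qed
      ultimately show ?thesis by simp
    qed
    have \<Phi>U[measurable]: "(\<lambda>w. \<Phi> j (\<lambda>t\<in>T. ?U w t)) \<in> borel_measurable M" for j
      by (rule measurable_compose[OF Ucoordm[OF T(2)] \<Phi>m])
    have \<Phi>W[measurable]: "(\<lambda>w. \<Phi> j (\<lambda>t\<in>T. w t)) \<in> borel_measurable M" for j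
      by (rule measurable_compose[OF coordm[OF T(2)] \<Phi>m])
    have [measurable]: "(\<lambda>w. \<Psi> (\<lambda>t\<in>T. ?U w t)) \<in> borel_measurable M" 
      by (rule borel_measurable_LIMSEQ_order[OF \<Phi>lim]) measurable
    have [measurable]: "(\<lambda>w. \<Psi> (\<lambda>t\<in>T. w t)) \<in> borel_measurable M" 
      by (rule borel_measurable_LIMSEQ_order[OF \<Phi>lim]) measurable
    let ?A = "{w \<in> space \<mu>. \<forall>t\<in>T. w t \<in> C t}"
    have A: "?A \<in> sets \<mu>" using T C by (intro cylinder_measurable) auto
    have lA: "(\<lambda>j. \<integral>\<^sup>+w. ennreal (\<rho> w) * ennreal (\<Phi> j (\<lambda>t\<in>T. ?U w t)) \<partial>M) \<longlonglongrightarrow> (\<integral>\<^sup>+w. ennreal (\<rho> w) * \<Psi> (\<lambda>t\<in>T. ?U w t) \<partial>M)"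
    proof (rule nn_integral_dominated_convergence[where w = "\<lambda>w. ennreal (\<rho> w)"])
      show "AE w in M. ennreal (\<rho> w) * ennreal (\<Phi> j (\<lambda>t\<in>T. ?U w t)) \<le> ennreal (\<rho> w)" for j
      proof (rule AE_I2)
        fix w
        have "ennreal (\<rho> w) * ennreal (\<Phi> j (\<lambda>t\<in>T. ?U w t)) \<le> ennreal (\<rho> w) * 1"
          using \<Phi>01 by (intro mult_left_mono) auto
        then show "ennreal (\<rho> w) * ennreal (\<Phi> j (\<lambda>t\<in>T. ?U w t)) \<le> ennreal (\<rho> w)" by simp
      qed
      show "AE w in M. (\<lambda>j. ennreal (\<rho> w) * ennreal (\<Phi> j (\<lambda>t\<in>T. ?U w t))) \<longlonglongrightarrow> ennreal (\<rho> w) * \<Psi> (\<lambda>t\<in>T. ?U w t)"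
        by (intro AE_I2 ennreal_tendsto_cmult \<Phi>lim) simp
    qed (use \<rho>1 in auto)
    have lB: "(\<lambda>j. \<integral>\<^sup>+w. ennreal (\<Phi> j (\<lambda>t\<in>T. w t)) \<partial>M) \<longlonglongrightarrow> (\<integral>\<^sup>+w. \<Psi> (\<lambda>t\<in>T. w t) \<partial>M)"
    proof (rule nn_integral_dominated_convergence[where w = "\<lambda>w. 1"])
      show "AE w in M. ennreal (\<Phi> j (\<lambda>t\<in>T. w t)) \<le> 1" for j
        using \<Phi>01 by (intro AE_I2) simp
      show "AE w in M. (\<lambda>j. ennreal (\<Phi> j (\<lambda>t\<in>T. w t))) \<longlonglongrightarrow> \<Psi> (\<lambda>t\<in>T. w t)"
        by (intro AE_I2 \<Phi>lim)
    qed (auto simp: emeasure_space_1)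
    have e: "(\<lambda>j. \<integral>\<^sup>+w. ennreal (\<rho> w) * ennreal (\<Phi> j (\<lambda>t\<in>T. ?U w t)) \<partial>M) = (\<lambda>j. \<integral>\<^sup>+w. ennreal (\<Phi> j (\<lambda>t\<in>T. w t)) \<partial>M)"
      by (rule ext) (rule eq[OF T \<Phi>m \<Phi>c \<Phi>01])
    have lim_eq: "(\<integral>\<^sup>+w. ennreal (\<rho> w) * \<Psi> (\<lambda>t\<in>T. ?U w t) \<partial>M) = (\<integral>\<^sup>+w. \<Psi> (\<lambda>t\<in>T. w t) \<partial>M)"
      by (rule LIMSEQ_unique[OF lA[unfolded e] lB])
    have "emeasure (distr ?\<nu> \<mu> ?U) ?A = emeasure ?\<nu> (?U -` ?A \<inter> space M)"
      using A U by (subst emeasure_distr) auto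
    also have "\<dots> = (\<integral>\<^sup>+w. ennreal (\<rho> w) * indicator (?U -` ?A \<inter> space M) w \<partial>M)"
      using measurable_sets[OF U A] by (subst emeasure_density) auto
    also have "\<dots> = (\<integral>\<^sup>+w. ennreal (\<rho> w) * \<Psi> (\<lambda>t\<in>T. ?U w t) \<partial>M)"
      using measurable_space[OF U] by (intro nn_integral_cong) (auto simp: \<Psi>_def indicator_def)
    also have "\<dots> = (\<integral>\<^sup>+w. indicator ?A w \<partial>M)"
      unfolding lim_eq by (intro nn_integral_cong) (auto simp: \<Psi>_def indicator_def)
    also have "\<dots> = emeasure \<mu> ?A" using A by simp
    finally show ?thesis .
  qed
  show "distr ?\<nu> \<mu> ?U = \<mu>"
  proof (rule measure_eqI_generator_eq[where E = ?E and \<Omega> = "space \<mu>" and A = "\<lambda>_. space \<mu>"])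
    show "Int_stable ?E"
    proof (rule Int_stableI)
      fix a b assume "a \<in> ?E" "b \<in> ?E"
      then obtain T C T' C' where T: "a = {w \<in> space \<mu>. \<forall>t\<in>T. w t \<in> C t}" "finite T" "T \<subseteq> {0..1}" "\<And>t. closed (C t)"
        and T': "b = {w \<in> space \<mu>. \<forall>t\<in>T'. w t \<in> C' t}" "finite T'" "T' \<subseteq> {0..1}" "\<And>t. closed (C' t)" by auto
      let ?C = "\<lambda>t. (if t \<in> T then C t else UNIV) \<inter> (if t \<in> T' then C' t else UNIV)"
      have "a \<inter> b = {w \<in> space \<mu>. \<forall>t\<in>T \<union> T'. w t \<in> ?C t}" using T(1) T'(1) by auto
      moreover have "finite (T \<union> T') \<and> T \<union> T' \<subseteq> {0..1} \<and> (\<forall>t. closed (?C t))" using T T' by auto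
      ultimately show "a \<inter> b \<in> ?E" by (intro CollectI exI[of _ "T \<union> T'"] exI[of _ ?C] conjI) auto
    qed
    show "?E \<subseteq> Pow (space \<mu>)" by auto
    show "emeasure (distr ?\<nu> \<mu> ?U) A = emeasure \<mu> A" if "A \<in> ?E" for A
    proof -
      obtain T C where T: "A = {w \<in> space \<mu>. \<forall>t\<in>T. w t \<in> C t}" "finite T" "T \<subseteq> {0..1}" "\<And>t. closed (C t)"
        using \<open>A \<in> ?E\<close> by blast
      show ?thesis unfolding T(1) by (rule closed_eq[OF T(2-4)])
    qed
    show "sets (distr ?\<nu> \<mu> ?U) = sigma_sets (space \<mu>) ?E" "sets \<mu> = sigma_sets (space \<mu>) ?E"
      using closed_cylinders_generate by simp_all
    have "space \<mu> = {w \<in> space \<mu>. \<forall>t\<in>{}. w t \<in> UNIV}" by simp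
    then have "space \<mu> \<in> ?E" by (intro CollectI exI[of _ "{}"] exI[of _ "\<lambda>_. UNIV"]) auto
    then show "range (\<lambda>_::nat. space \<mu>) \<subseteq> ?E" by blast
    show "(\<Union>i::nat. space \<mu>) = space \<mu>" by simp
    have "emeasure (distr ?\<nu> \<mu> ?U) (space \<mu>) = emeasure \<mu> (space \<mu>)"
      using closed_eq[of "{}" "\<lambda>_. UNIV"] by simp
    then show "emeasure (distr ?\<nu> \<mu> ?U) (space \<mu>) \<noteq> \<infinity>" by (simp add: emeasure_space_1)
  qed
qed

end

section \<open>Unique Girsanov measures and invertibility\<close>

theorem theorem2p20:
  fixes \<mu> :: "(real \<Rightarrow> real ^ 'n) measure"
    and u :: "(real \<Rightarrow> real ^ 'n) \<Rightarrow> (real \<Rightarrow> real ^ 'n)"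
    and v :: "real \<Rightarrow> (real \<Rightarrow> real ^ 'n) \<Rightarrow> real ^ 'n"
  assumes "classical_wiener \<mu>"
    and "L0a \<mu> u v"
    and "(\<integral>w. girsanov_density \<mu> v w \<partial>completion \<mu>) = 1"
  shows "(\<exists>!\<nu>. absolutely_continuous (completion \<mu>) \<nu> \<and> girsanov_measure \<mu> (perturb u) \<nu>)
    \<longleftrightarrow> as_invertible \<mu> (perturb u)"
proof -
  interpret classical_wiener \<mu> by fact
  have "has_ito_integral \<mu> v (ito_integral \<mu> v)"
    unfolding ito_integral_def using ex_ito_integral[OF assms(2)] by (rule someI_ex)
  from girsanov_transform[OF assms(2) this girsanov_density_def assms(3)]
  have "girsanov_density \<mu> v \<in> borel_measurable M"
    and "distr (density M (\<lambda>w. ennreal (girsanov_density \<mu> v w))) \<mu> (perturb u) = \<mu>" .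
  note \<rho> = this
  have "0 < ennreal (girsanov_density \<mu> v w)" for w
    by (simp add: girsanov_density_def)
  note invertible = invertible_if_ex1_girsanov_measure[OF prob_space_axioms sets_wiener
      perturb_measurable[OF assms(2)] measurable_compose[OF \<rho>(1) measurable_ennreal] this \<rho>(2)]
  show ?thesis
    by (rule iffI[OF invertible ex1_girsanov_measure_if_invertible])
qed

end
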